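(* $\mathcal B$ trace defines the field $(\mathbb{Q}_p,+,\times)$.
   Context: Fix a prime $p$; $\mathbb{Q}_p$ is the field of $p$-adic numbers in the language of rings. Let $K$ be a $(2^{\aleph_0})^+$-saturated elementary extension of $\mathbb{Q}_p$, $\mathrm{Val}_p : K^\times \to \Gamma$ the $p$-adic valuation (which is $K$-definable), $V$ its valuation ring, $\Gamma_\geq$ the nonnegative elements of $\Gamma$. For $a\in K$, $t\in\Gamma$ let $B(a,t)=\{a'\in K:\mathrm{Val}_p(a-a')\ge t\}$. Let $\mathbb B$ be the set of balls $B(a,t)$ with $a\in V$, $t\in\Gamma_\ge$, identified with the quotient of $V\times\Gamma_\ge$ by the $K$-definable equivalence relation $(a,t)\sim(a',t')$ iff $B(a,t)=B(a',t')$. $\mathcal B$ is the structure induced on $\mathbb B$ by $K$: domain $\mathbb B$, with a predicate for every subset of each $\mathbb B^n$ definable with parameters in $K^{\mathrm{eq}}$. "Definable" means definable with parameters. For structures $\mathcal M,\mathcal O$ and an injection $\tau:O\to M^m$, $\mathcal M$ trace defines $\mathcal O$ via $\tau$ if for every $n$ and every $\mathcal O$-definable $X\subseteq O^n$ there is an $\mathcal M$-definable $Y\subseteq M^{mn}$ with $X=\{(a_1,\dots,a_n)\in O^n:(\tau(a_1),\dots,\tau(a_n))\in Y\}$; $\mathcal M$ trace defines $\mathcal O$ if it does so via some injection $\tau:O\to M^m$ for some $m$. *)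

theory Defs
  imports Complex_Main "HOL-Computational_Algebra.Primes"
begin

datatype 'a tm = Var nat | Cst 'a | Zero | One
  | Add "'a tm" "'a tm" | Mul "'a tm" "'a tm" | Minus "'a tm"

datatype 'a fm = Eq "'a tm" "'a tm" | FNot "'a fm" | FAnd "'a fm" "'a fm" | FEx nat "'a fm"

primrec eval :: "'a::comm_ring_1 tm \<Rightarrow> (nat \<Rightarrow> 'a) \<Rightarrow> 'a" where
  "eval (Var i) \<rho> = \<rho> i"
| "eval (Cst c) \<rho> = c"
| "eval Zero \<rho> = 0"
| "eval One \<rho> = 1"
| "eval (Add s t) \<rho> = eval s \<rho> + eval t \<rho>"
| "eval (Mul s t) \<rho> = eval s \<rho> * eval t \<rho>"
| "eval (Minus s) \<rho> = - eval s \<rho>"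

primrec sat :: "'a::comm_ring_1 fm \<Rightarrow> (nat \<Rightarrow> 'a) \<Rightarrow> bool" where
  "sat (Eq s t) \<rho> = (eval s \<rho> = eval t \<rho>)"
| "sat (FNot \<phi>) \<rho> = (\<not> sat \<phi> \<rho>)"
| "sat (FAnd \<phi> \<psi>) \<rho> = (sat \<phi> \<rho> \<and> sat \<psi> \<rho>)"
| "sat (FEx i \<phi>) \<rho> = (\<exists>a. sat \<phi> (\<rho>(i := a)))"

definition asg :: "'a::comm_ring_1 list \<Rightarrow> nat \<Rightarrow> 'a" where
  "asg xs i = (if i < length xs then xs ! i else 0)"

definition definable :: "nat \<Rightarrow> 'a::comm_ring_1 list set \<Rightarrow> bool" where
  "definable n X \<longleftrightarrow> (\<exists>\<phi>. X = {xs. length xs = n \<and> sat \<phi> (asg xs)})"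

definition elementary_embedding :: "('a::comm_ring_1 \<Rightarrow> 'b::comm_ring_1) \<Rightarrow> bool" where
  "elementary_embedding e \<longleftrightarrow> (\<forall>\<phi> \<rho>. sat \<phi> \<rho> \<longleftrightarrow> sat (map_fm e \<phi>) (e \<circ> \<rho>))"

text \<open>kappa-saturation for kappa = (2^aleph0)^+: every finitely satisfiable 1-type over a
  parameter set of cardinality at most 2^aleph0 = |R| is realized.  A 1-type is a set of
  formulas all of whose free variables are interpreted by the same element.\<close>
definition saturated_2aleph0_plus :: "'k::comm_ring_1 itself \<Rightarrow> bool" where
  "saturated_2aleph0_plus _ \<longleftrightarrow>
     (\<forall>(A :: 'k set) (\<Sigma> :: 'k fm set).
        (\<exists>f :: 'k \<Rightarrow> real. inj_on f A) \<longrightarrow>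
        (\<forall>\<phi>\<in>\<Sigma>. set_fm \<phi> \<subseteq> A) \<longrightarrow>
        (\<forall>\<Sigma>0. finite \<Sigma>0 \<and> \<Sigma>0 \<subseteq> \<Sigma> \<longrightarrow> (\<exists>x. \<forall>\<phi>\<in>\<Sigma>0. sat \<phi> (\<lambda>_. x))) \<longrightarrow>
        (\<exists>x. \<forall>\<phi>\<in>\<Sigma>. sat \<phi> (\<lambda>_. x)))"

text \<open>(Q, val) is a field of p-adic numbers: the completion of the rationals with respect to
  the p-adic valuation.  val is meaningful on nonzero elements only.  These conditions
  determine (Q, val) up to unique isomorphism.\<close>
definition padic_field :: "nat \<Rightarrow> ('q::field_char_0 \<Rightarrow> int) \<Rightarrow> bool" where
  "padic_field p val \<longleftrightarrow>
     (\<forall>x y. x \<noteq> 0 \<and> y \<noteq> 0 \<longrightarrow> val (x * y) = val x + val y)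
   \<and> (\<forall>x y. x \<noteq> 0 \<and> y \<noteq> 0 \<and> x + y \<noteq> 0 \<longrightarrow> val (x + y) \<ge> min (val x) (val y))
   \<and> val (of_nat p) = 1
   \<and> (\<forall>k::int. k \<noteq> 0 \<and> \<not> int p dvd k \<longrightarrow> val (of_int k) = 0)
   \<and> (\<forall>x. \<forall>N::int. \<exists>r::rat. x = of_rat r \<or> val (x - of_rat r) \<ge> N)
   \<and> (\<forall>s :: nat \<Rightarrow> 'q.
        (\<forall>N::int. \<exists>M. \<forall>i\<ge>M. \<forall>j\<ge>M. s i = s j \<or> val (s i - s j) \<ge> N) \<longrightarrow>
        (\<exists>l. \<forall>N::int. \<exists>M. \<forall>i\<ge>M. s i = l \<or> val (s i - l) \<ge> N))"

definition val_ring :: "('q::field_char_0 \<Rightarrow> int) \<Rightarrow> 'q set" where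
  "val_ring val = {x. x = 0 \<or> val x \<ge> 0}"

text \<open>The valuation ring V of K: defined in K by (the image under e of) any formula that
  defines Z_p in Q_p.  By elementarity all such formulas define the same subset of K.\<close>
definition ext_val_ring ::
  "('q::field_char_0 \<Rightarrow> int) \<Rightarrow> ('q \<Rightarrow> 'k::field) \<Rightarrow> 'k set" where
  "ext_val_ring val e =
     {x. \<exists>\<phi>. (\<forall>y. y \<in> val_ring val \<longleftrightarrow> sat \<phi> (\<lambda>_. y)) \<and> sat (map_fm e \<phi>) (\<lambda>_. x)}"

text \<open>B(a, Val_p(c)) = {x. Val_p(x - a) \<ge> Val_p(c)} for c \<noteq> 0, i.e. (x-a)/c \<in> V.\<close>
definition ball :: "'k::field set \<Rightarrow> 'k \<Rightarrow> 'k \<Rightarrow> 'k set" where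
  "ball V a c = {x. (x - a) / c \<in> V}"

text \<open>The set of balls B(a,t), a \<in> V, t \<in> Gamma_{\<ge>0} (t = Val_p(c), c \<in> V nonzero).\<close>
definition balls :: "'k::field set \<Rightarrow> 'k set set" where
  "balls V = {ball V a c | a c. a \<in> V \<and> c \<in> V \<and> c \<noteq> 0}"

definition decode :: "'k::field set \<Rightarrow> nat \<Rightarrow> 'k list \<Rightarrow> 'k set list" where
  "decode V k zs = map (\<lambda>i. ball V (zs ! (2 * i)) (zs ! (2 * i + 1))) [0..<k]"

definition codes :: "'k::field set \<Rightarrow> nat \<Rightarrow> 'k list \<Rightarrow> bool" where
  "codes V k zs \<longleftrightarrow> length zs = 2 * k \<and>
     (\<forall>i<k. zs ! (2 * i) \<in> V \<and> zs ! (2 * i + 1) \<in> V \<and> zs ! (2 * i + 1) \<noteq> 0)"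

text \<open>Definable subsets of B^k in the structure induced on B by K (= subsets of B^k
  definable in K^eq, i.e. whose preimage under the K-definable quotient map is K-definable).\<close>
definition ball_definable :: "'k::field set \<Rightarrow> nat \<Rightarrow> 'k set list set \<Rightarrow> bool" where
  "ball_definable V k Y \<longleftrightarrow>
     Y \<subseteq> {bs. length bs = k \<and> set bs \<subseteq> balls V}
   \<and> definable (2 * k) {zs. codes V k zs \<and> decode V k zs \<in> Y}"

definition balls_trace_define :: "'k::field set \<Rightarrow> 'q::comm_ring_1 itself \<Rightarrow> bool" where
  "balls_trace_define V _ \<longleftrightarrow>
     (\<exists>m (\<tau> :: 'q \<Rightarrow> 'k set list).
        inj \<tau> \<and> (\<forall>a. length (\<tau> a) = m \<and> set (\<tau> a) \<subseteq> balls V) \<and>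
        (\<forall>n (X :: 'q list set). definable n X \<longrightarrow>
           (\<exists>Y. ball_definable V (m * n) Y \<and>
                X = {xs. length xs = n \<and> concat (map \<tau> xs) \<in> Y})))"

end

theory Submission
  imports Defs "HOL-Computational_Algebra.Polynomial" "HOL-Analysis.Abstract_Topology_2"
begin

text \<open>
  Take \<open>c \<in> K\<close> with \<open>v c\<close> larger than every integer and send \<open>a\<close> to the ball
  \<open>\<tau> a = B(c a, v (c\<^sup>2))\<close>. A ball definable condition that traces a closed definable
  set \<open>X\<close> is: some \<open>x\<close> in the extension of \<open>X\<close> to \<open>K\<close> has \<open>c x\<^sub>i\<close> in the
  \<open>i\<close>-th ball. Such an \<open>x\<close> is infinitely close to the given point \<open>a\<close>, and by elementarity
  no such \<open>x\<close> exists if \<open>a \<notin> X\<close>. So it suffices that every definable set is a Boolean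
  combination of closed definable sets, and this follows from Macintyre's quantifier
  elimination, because \<open>{f = 0}\<close> and \<open>{f is an n-th power}\<close> are closed.

  For the elimination, compactness reduces the claim to a one-step extension of partial
  field isomorphisms of \<open>K\<close> that preserve \<open>n\<close>-th powers. Such a map extends to a relatively
  algebraically closed subfield \<open>F\<close>, and finitely many polynomials over \<open>F\<close> take on \<open>F\<close>, up to
  \<open>N\<close>-th powers, the values that they take at any given \<open>t \<in> K\<close>. Both steps use that every \<open>t\<close>
  has a center \<open>c \<in> F\<close> with respect to a polynomial \<open>g\<close>, around which \<open>v (g t)\<close> is, up to a bounded
  error, the minimum of the valuations of the Taylor terms.
\<close>

section \<open>Valuation rings with finite residue field\<close>

text \<open>A predicate on balls sees a point of K only up to an infinitesimal, so the existential
  trace is exact only for sets containing their limit points. Negation is therefore applied to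
  predicates on balls, never under that quantifier. Closedness rests on integer valuations and is
  proved for the p-adic numbers only. Elimination is done in K, where compactness is available: the
  parameters come from the p-adic field, which injects into the reals, so saturation applies. But K
  is a field without known completeness and with infinite valuations. All that is used about it is
  therefore collected in \<open>pclosed\<close>, a list of first-order schemes proved once for the
  p-adic numbers and transferred. Membership of x in V means that 1 + p^3 x^4 is a square, so maps
  that preserve powers preserve valuations automatically. The value group is never formed;
  \<open>vle\<close> compares elements instead. Infinite valuations force a recurring dichotomy.
  Valuations that differ by an integer are matched by multiplying with natural numbers, which lie in
  every subfield and are fixed by every partial isomorphism. Gaps beyond all integers make one term
  of a polynomial dominate.\<close>

locale vring =
  fixes V :: "'k::field set" and p :: nat
  assumes prime_p: "prime p"
    and one_V: "1 \<in> V"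
    and diff_V: "x \<in> V \<Longrightarrow> y \<in> V \<Longrightarrow> x - y \<in> V"
    and mult_V: "x \<in> V \<Longrightarrow> y \<in> V \<Longrightarrow> x * y \<in> V"
    and inverse_V: "x \<notin> V \<Longrightarrow> inverse x \<in> V"
    and p_nonunit: "inverse (of_nat p) \<notin> V"
    and residue: "x \<in> V \<Longrightarrow> \<exists>k<p. (x - of_nat k) / of_nat p \<in> V"
begin

abbreviation \<pi> :: 'k where "\<pi> \<equiv> of_nat p"

lemma zero_V: "0 \<in> V"
  using diff_V[OF one_V one_V] by simp

lemma minus_V: "x \<in> V \<Longrightarrow> - x \<in> V"
  using diff_V[OF zero_V, of x] by simp

lemma add_V: "x \<in> V \<Longrightarrow> y \<in> V \<Longrightarrow> x + y \<in> V"
  using diff_V[OF _ minus_V, of x y] by simp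

lemma power_V: "x \<in> V \<Longrightarrow> x ^ n \<in> V"
  by (induction n) (auto intro: one_V mult_V)

lemma of_nat_V: "of_nat n \<in> V"
  by (induction n) (auto intro: one_V zero_V add_V)

lemma pi_nonzero: "\<pi> \<noteq> 0"
  using p_nonunit zero_V by force

text \<open>\<open>vle x y\<close> says \<open>v x \<le> v y\<close>, with \<open>v 0 = \<infinity>\<close>.\<close>
definition vle :: "'k \<Rightarrow> 'k \<Rightarrow> bool" where
  "vle x y \<longleftrightarrow> (\<exists>w\<in>V. y = x * w)"

lemma vle_refl [simp]: "vle x x"
  unfolding vle_def using one_V by (metis mult.right_neutral)

lemma vle_0 [simp]: "vle x 0"
  unfolding vle_def using zero_V by (metis mult_zero_right)

lemma vle_0_iff [simp]: "vle 0 y \<longleftrightarrow> y = 0"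
  unfolding vle_def using one_V by auto

lemma vle_trans: "vle x y \<Longrightarrow> vle y z \<Longrightarrow> vle x z"
  unfolding vle_def by (metis mult.assoc mult_V)

lemma vle_iff: "x \<noteq> 0 \<Longrightarrow> vle x y \<longleftrightarrow> y / x \<in> V"
  unfolding vle_def by (auto simp: field_simps) (metis mult.commute nonzero_divide_eq_eq)

lemma vle_1_iff: "vle 1 x \<longleftrightarrow> x \<in> V"
  unfolding vle_def by auto

lemma vle_total: "vle x y \<or> vle y x"
proof (cases "x = 0 \<or> y = 0")
  case False
  then show ?thesis using inverse_V[of "y / x"] by (auto simp: vle_iff)
qed auto

lemma vle_mult: "vle a b \<Longrightarrow> vle c d \<Longrightarrow> vle (a * c) (b * d)"
  unfolding vle_def using mult_V by (metis mult.assoc mult.left_commute)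

lemma vle_mult_left: "vle a b \<Longrightarrow> vle (c * a) (c * b)"
  by (rule vle_mult) auto

lemma vle_mult_cancel: "c \<noteq> 0 \<Longrightarrow> vle (c * a) (c * b) \<longleftrightarrow> vle a b"
  unfolding vle_def by (auto simp: mult.assoc)

lemma vle_mult_right: "vle a b \<Longrightarrow> w \<in> V \<Longrightarrow> vle a (b * w)"
  unfolding vle_def using mult_V by (metis mult.assoc)

lemma vle_mult_V: "vle a b \<Longrightarrow> w \<in> V \<Longrightarrow> vle a (w * b)"
  using vle_mult_right by (simp add: mult.commute)

lemma vle_add: "vle a x \<Longrightarrow> vle a y \<Longrightarrow> vle a (x + y)"
  unfolding vle_def using add_V by (metis distrib_left)

lemma vle_minus_iff [simp]: "vle a (- x) \<longleftrightarrow> vle a x"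
  unfolding vle_def by (metis minus_V minus_minus mult_minus_right)

lemma vle_minus_iff2 [simp]: "vle (- a) x \<longleftrightarrow> vle a x"
  unfolding vle_def by (metis minus_V minus_minus mult_minus_right mult_minus_left)

lemma vle_diff: "vle a x \<Longrightarrow> vle a y \<Longrightarrow> vle a (x - y)"
  using vle_add[of a x "- y"] by simp

lemma vle_diff_commute: "vle a (x - y) \<longleftrightarrow> vle a (y - x)"
  using vle_minus_iff[of a "x - y"] by simp

lemma vle_sum: "(\<And>i. i \<in> I \<Longrightarrow> vle a (f i)) \<Longrightarrow> vle a (sum f I)"
  by (induction I rule: infinite_finite_induct) (auto intro: vle_add)

lemma vle_power: "vle a b \<Longrightarrow> vle (a ^ n) (b ^ n)"
  by (induction n) (auto intro: vle_mult)

lemma vle_of_mult: "vle (a * w) b \<Longrightarrow> w \<in> V \<Longrightarrow> vle a b"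
  unfolding vle_def using mult_V by (metis mult.assoc)

lemma vle_inverse: "x \<noteq> 0 \<Longrightarrow> y \<noteq> 0 \<Longrightarrow> vle (inverse y) (inverse x) \<longleftrightarrow> vle x y"
  by (auto simp: vle_iff field_simps)

lemma pi_not_dvd_1: "\<not> vle \<pi> 1"
  using p_nonunit pi_nonzero by (simp add: vle_iff inverse_eq_divide)

text \<open>If p divided u, it would divide 1. By totality u then divides p, hence u - 1, hence
  1.\<close>

lemma one_unit: assumes "vle \<pi> (u - 1)" shows "u \<in> V" "vle u 1"
proof -
  show "u \<in> V"
    using assms add_V[of "u - 1" 1] one_V vle_of_mult[of 1 \<pi> "u - 1"] of_nat_V
    by (simp add: vle_1_iff)
  have "\<not> vle \<pi> u"
    using vle_diff[of \<pi> u "u - 1"] assms pi_not_dvd_1 by auto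
  then have "vle u \<pi>" using vle_total by blast
  then have "vle u (u - 1)" using assms vle_trans by blast
  then show "vle u 1" using vle_diff[of u u "u - 1"] by simp
qed

text \<open>This makes p a generator of the maximal ideal. A residue k that is nonzero modulo p is
  inverted by Bezout, so some integral multiple of x is congruent to 1 modulo p and
  \<open>one_unit\<close> applies.\<close>

lemma unit_or_pi:
  assumes x: "x \<in> V" shows "vle x 1 \<or> vle \<pi> x"
proof (rule disjCI)
  assume nv: "\<not> vle \<pi> x"
  obtain k where k: "k < p" "vle \<pi> (x - of_nat k)"
    using residue[OF x] pi_nonzero by (auto simp: vle_iff)
  have "k \<noteq> 0" using k nv by (metis diff_zero of_nat_0)
  then have "coprime k p" using k prime_p
    by (metis prime_imp_coprime coprime_commute nat_dvd_not_less not_gr0)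
  then obtain l m where lm: "k * l = p * m + 1"
    using coprime_bezout_strong[of k p] prime_p \<open>k \<noteq> 0\<close> by (metis not_prime_1)
  have "x * of_nat l - 1 = (x - of_nat k) * of_nat l + \<pi> * of_nat m"
    using arg_cong[OF lm, of "of_nat :: nat \<Rightarrow> 'k"] by (simp add: algebra_simps)
  moreover have "vle \<pi> ((x - of_nat k) * of_nat l + \<pi> * of_nat m)"
    using k by (intro vle_add vle_mult_right of_nat_V) auto
  ultimately have "vle (x * of_nat l) 1" using one_unit by simp
  then show "vle x 1" using vle_of_mult of_nat_V by blast
qed

text \<open>Discreteness of the value group: p has the least positive valuation, so every strict
  inequality leaves a gap of at least \<open>v p\<close>.\<close>

lemma not_vle:
  assumes "\<not> vle x y" shows "vle (\<pi> * y) x"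
proof -
  have y: "y \<noteq> 0" and yx: "vle y x" using assms vle_total by auto
  then have "x / y \<in> V" by (simp add: vle_iff)
  moreover have "\<not> vle (x / y) 1"
    using vle_mult_left[of "x / y" 1 y] assms y by auto
  ultimately have "vle \<pi> (x / y)" using unit_or_pi by blast
  then show ?thesis using vle_mult_left[of \<pi> "x / y" y] y by (simp add: mult.commute)
qed

lemma vle_pi_power: "m \<le> n \<Longrightarrow> vle (\<pi> ^ m) (\<pi> ^ n)"
  by (metis le_add_diff_inverse of_nat_V power_V power_add vle_mult_right vle_refl)

lemma not_vle_self: "x \<noteq> 0 \<Longrightarrow> \<not> vle (\<pi> * x) x"
  using vle_mult_cancel[of x \<pi> 1] pi_not_dvd_1 by (simp add: mult.commute)

lemma vle_pi_power_iff: "vle (\<pi> ^ m) (\<pi> ^ n) \<longleftrightarrow> m \<le> n"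
proof
  assume *: "vle (\<pi> ^ m) (\<pi> ^ n)"
  show "m \<le> n"
  proof (rule ccontr)
    assume "\<not> m \<le> n"
    then have "vle (\<pi> ^ Suc n) (\<pi> ^ m)" by (intro vle_pi_power) auto
    then have "vle (\<pi> ^ Suc n) (\<pi> ^ n)" using * vle_trans by blast
    then show False using not_vle_self[of "\<pi> ^ n"] pi_nonzero by simp
  qed
qed (rule vle_pi_power)

section \<open>Equal valuations and relative closeness\<close>

definition same :: "'k \<Rightarrow> 'k \<Rightarrow> bool" where
  "same x y \<longleftrightarrow> vle x y \<and> vle y x"

lemma same_refl [simp]: "same x x"
  by (simp add: same_def)

lemma same_sym: "same x y \<Longrightarrow> same y x"
  by (simp add: same_def)

lemma same_trans: "same x y \<Longrightarrow> same y z \<Longrightarrow> same x z"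
  unfolding same_def using vle_trans by blast

lemma same_0_iff: "same x y \<Longrightarrow> x = 0 \<longleftrightarrow> y = 0"
  unfolding same_def by auto

lemma same_mult: "same a b \<Longrightarrow> same c d \<Longrightarrow> same (a * c) (b * d)"
  unfolding same_def using vle_mult by blast

text \<open>A bounded gap consists of unit steps by \<open>not_vle\<close>. Its contrapositive is
  the main use: if no integral difference can occur, the gap exceeds every integer.\<close>

lemma same_pi_power:
  assumes "vle x y" "\<not> vle (\<pi> ^ n * x) y"
  shows "\<exists>i<n. same y (\<pi> ^ i * x)"
  using assms
proof (induction n)
  case (Suc n)
  show ?case
  proof (cases "vle (\<pi> ^ n * x) y")
    case True
    have "\<not> vle (\<pi> * (\<pi> ^ n * x)) y" using Suc.prems by (simp add: mult.assoc)
    then have "vle y (\<pi> ^ n * x)"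
      using not_vle[of y "\<pi> ^ n * x"] by blast
    then show ?thesis using True by (auto simp: same_def)
  next
    case False
    then show ?thesis using Suc less_SucI by blast
  qed
qed simp

text \<open>\<open>near n x y\<close> says that \<open>x / y \<in> 1 + p\<^sup>n V\<close>.\<close>
definition near :: "nat \<Rightarrow> 'k \<Rightarrow> 'k \<Rightarrow> bool" where
  "near n x y \<longleftrightarrow> vle (\<pi> ^ n * y) (x - y)"

lemma near_refl [simp]: "near n x x"
  by (simp add: near_def)

lemma near_mono: "near n x y \<Longrightarrow> m \<le> n \<Longrightarrow> near m x y"
  unfolding near_def by (rule vle_trans[OF vle_mult[OF vle_pi_power vle_refl]])

lemma near_same: assumes "near n x y" "0 < n" shows "same x y"
proof (cases "y = 0")
  case True
  then show ?thesis using assms by (simp add: near_def)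
next
  case False
  have "near 1 x y" using near_mono[OF assms(1), of 1] assms by simp
  then have "vle (y * \<pi>) (y * (x / y - 1))"
    using False by (simp add: near_def algebra_simps)
  then have "vle \<pi> (x / y - 1)" using False by (simp add: vle_mult_cancel)
  from one_unit[OF this] have "vle 1 (x / y)" "vle (x / y) 1" by (auto simp: vle_1_iff)
  from this[THEN vle_mult_left, of y] show ?thesis using False by (simp add: same_def)
qed

lemma near_0_iff: "near n x y \<Longrightarrow> 0 < n \<Longrightarrow> x = 0 \<longleftrightarrow> y = 0"
  using near_same same_0_iff by blast

lemma near_sym: assumes "near n x y" "0 < n" shows "near n y x"
proof -
  have "vle (\<pi> ^ n * x) (\<pi> ^ n * y)"
    using near_same[OF assms] by (auto simp: same_def intro: vle_mult_left)
  from vle_trans[OF this assms(1)[unfolded near_def]] show ?thesis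
    unfolding near_def by (rule iffD1[OF vle_diff_commute])
qed

lemma near_mult_left: "near n x y \<Longrightarrow> near n (a * x) (a * y)"
  unfolding near_def using vle_mult_left[of _ _ a]
  by (metis mult.left_commute right_diff_distrib)

lemma near_cancel: "a \<noteq> 0 \<Longrightarrow> near n (a * x) (a * y) \<longleftrightarrow> near n x y"
  using near_mult_left[of n "a * x" "a * y" "inverse a"] near_mult_left by (auto simp: mult.assoc[symmetric])

lemma near_1: "near n x 1 \<longleftrightarrow> vle (\<pi> ^ n) (x - 1)"
  by (simp add: near_def)

lemma near_1_V: "near n u 1 \<Longrightarrow> 0 < n \<Longrightarrow> u \<in> V"
  using near_same[of n u 1] by (auto simp: same_def vle_1_iff)

lemma dominant_near:
  assumes "finite I" "j \<in> I" "\<And>i. i \<in> I \<Longrightarrow> i \<noteq> j \<Longrightarrow> vle (\<pi> ^ n * T j) (T i)"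
  shows "near n (sum T I) (T j)"
proof -
  have "sum T I - T j = sum T (I - {j})" using assms(1,2) by (simp add: sum.remove)
  then show ?thesis using assms(3) by (auto simp: near_def intro: vle_sum)
qed

lemma residue_power:
  assumes "x \<in> V" shows "\<exists>k::nat. vle (\<pi> ^ n) (x - of_nat k)"
proof (induction n)
  case 0
  then show ?case using assms by (auto simp: vle_1_iff intro!: exI[of _ 0])
next
  case (Suc n)
  then obtain k w where k: "x - of_nat k = \<pi> ^ n * w" "w \<in> V" by (auto simp: vle_def)
  then obtain l where "vle \<pi> (w - of_nat l)" using residue pi_nonzero by (auto simp: vle_iff)
  then have "vle (\<pi> ^ n * \<pi>) (\<pi> ^ n * (w - of_nat l))" by (rule vle_mult_left)
  moreover have "\<pi> ^ n * (w - of_nat l) = x - of_nat (k + p ^ n * l)"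
    using k by (simp add: algebra_simps)
  ultimately show ?case by (metis mult.commute power_Suc)
qed

text \<open>A failure leaves a gap of \<open>v p\<close>, which n-th powers enlarge to n times
  \<open>v p\<close>. The lemma permits comparing valuations after raising to a power, when only the
  powers lie in a given subfield.\<close>

lemma vle_power_iff: assumes "0 < n" shows "vle (x ^ n) (y ^ n) \<longleftrightarrow> vle x y"
proof
  assume *: "vle (x ^ n) (y ^ n)"
  show "vle x y"
  proof (rule ccontr)
    assume nv: "\<not> vle x y"
    then have "y \<noteq> 0" by auto
    from nv have "vle (\<pi> * y) x" by (rule not_vle)
    then have "vle ((\<pi> * y) ^ n) (y ^ n)" using * vle_power vle_trans by blast
    then have "vle (y ^ n * \<pi> ^ n) (y ^ n * 1)" by (simp add: power_mult_distrib mult.commute)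
    then have "vle (\<pi> ^ n) (\<pi> ^ 0)" using \<open>y \<noteq> 0\<close> by (subst (asm) vle_mult_cancel) auto
    then show False using assms by (simp only: vle_pi_power_iff)
  qed
qed (rule vle_power)

lemma same_power_iff: "0 < n \<Longrightarrow> same (x ^ n) (y ^ n) \<longleftrightarrow> same x y"
  by (simp add: same_def vle_power_iff)

text \<open>\<open>cont a H\<close> says that \<open>v a\<close> is a lower bound for the Gauss valuation of \<open>H\<close>.\<close>
definition cont :: "'k \<Rightarrow> 'k poly \<Rightarrow> bool" where
  "cont a H \<longleftrightarrow> (\<forall>j. vle a (coeff H j))"

lemma cont_0 [simp]: "cont a 0"
  by (simp add: cont_def)

lemma cont_pCons [simp]: "cont a (pCons b H) \<longleftrightarrow> vle a b \<and> cont a H"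
  unfolding cont_def by (auto simp: coeff_pCons split: nat.splits)

lemma cont_add: "cont a G \<Longrightarrow> cont a H \<Longrightarrow> cont a (G + H)"
  by (simp add: cont_def vle_add)

lemma cont_smult: "cont a G \<Longrightarrow> w \<in> V \<Longrightarrow> cont a (smult w G)"
  by (simp add: cont_def vle_mult_V)

lemma cont_smult_mult: "cont a G \<Longrightarrow> cont (c * a) (smult c G)"
  by (simp add: cont_def vle_mult_left)

lemma cont_poly: "cont a H \<Longrightarrow> x \<in> V \<Longrightarrow> vle a (poly H x)"
  by (induction H) (auto intro: vle_add vle_mult_V)

lemma cont_pcompose: "cont a H \<Longrightarrow> u \<in> V \<Longrightarrow> w \<in> V \<Longrightarrow> cont a (pcompose H [:u, w:])"
  by (induction H) (auto simp: pcompose_pCons intro!: cont_add cont_smult)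

lemma cont_pderiv: "cont a H \<Longrightarrow> cont a (pderiv H)"
  unfolding cont_def coeff_pderiv by (simp add: vle_mult_V of_nat_V del: of_nat_Suc)

text \<open>Translation by an element of V does not lower the Gauss valuation. The remainder
  therefore keeps the bound, and no factorial is divided out.\<close>

lemma taylor2:
  assumes "cont a H" "y \<in> V"
  shows "\<exists>r. pcompose H [:y, 1:] = pCons (poly H y) (pCons (poly (pderiv H) y) r) \<and> cont a r"
proof -
  let ?G = "pcompose H [:y, 1:]"
  obtain b c r where G: "?G = pCons b (pCons c r)" by (metis pCons_cases)
  have "b = poly H y" using arg_cong[OF G, of "\<lambda>q. poly q 0"] by (simp add: poly_pcompose)
  moreover have "c = poly (pderiv H) y"
    using arg_cong[OF G, of "\<lambda>q. poly (pderiv q) 0"]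
    by (simp add: pderiv_pcompose poly_pcompose pderiv_pCons)
  moreover have "cont a r" using cont_pcompose[OF assms one_V] G by simp
  ultimately show ?thesis using G by blast
qed

lemma taylor2_poly:
  assumes "cont a H" "x \<in> V" "y \<in> V"
  shows "\<exists>w. vle a w \<and> poly H x = poly H y + (x - y) * poly (pderiv H) y + (x - y)^2 * w"
proof -
  obtain r where r: "pcompose H [:y, 1:] = pCons (poly H y) (pCons (poly (pderiv H) y) r)" "cont a r"
    using taylor2[OF assms(1,3)] by blast
  have "poly H x = poly (pcompose H [:y, 1:]) (x - y)" by (simp add: poly_pcompose)
  also have "\<dots> = poly H y + (x - y) * poly (pderiv H) y + (x - y)^2 * poly r (x - y)"
    unfolding r by (simp add: algebra_simps power2_eq_square)
  finally show ?thesis using cont_poly[OF r(2) diff_V[OF assms(2,3)]] by blast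
qed

lemma poly_diff_vle:
  assumes "cont a H" "x \<in> V" "y \<in> V"
  shows "vle (a * (x - y)) (poly H x - poly H y)"
proof -
  obtain w where w: "vle a w" "poly H x = poly H y + (x - y) * poly (pderiv H) y + (x - y)^2 * w"
    using taylor2_poly[OF assms] by blast
  have "poly H x - poly H y = (poly (pderiv H) y + (x - y) * w) * (x - y)"
    by (simp add: w algebra_simps power2_eq_square)
  moreover have "vle a (poly (pderiv H) y + (x - y) * w)"
    using w diff_V assms by (intro vle_add cont_poly cont_pderiv vle_mult_V) auto
  ultimately show ?thesis using vle_mult[OF _ vle_refl] by metis
qed

end

section \<open>Henselian fields with value group elementarily like the integers\<close>

definition pw :: "nat \<Rightarrow> 'a::monoid_mult \<Rightarrow> bool" where
  "pw N x \<longleftrightarrow> (\<exists>z. z ^ N = x)"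

lemma pw_power_mult:
  fixes x r :: "'k::field"
  assumes "r \<noteq> 0" shows "pw N (r ^ N * x) \<longleftrightarrow> pw N x"
proof
  assume "pw N (r ^ N * x)"
  then obtain z where "z ^ N = r ^ N * x" by (auto simp: pw_def)
  then have "(z / r) ^ N = x" using assms by (simp add: power_divide)
  then show "pw N x" by (auto simp: pw_def)
next
  assume "pw N x"
  then show "pw N (r ^ N * x)" by (auto simp: pw_def simp flip: power_mult_distrib)
qed

lemma pw_dvd: "pw N x \<Longrightarrow> M dvd N \<Longrightarrow> pw M x"
  unfolding pw_def by (metis dvd_def mult.commute power_mult)

definition fieldset :: "'k::field set \<Rightarrow> bool" where
  "fieldset F \<longleftrightarrow> 1 \<in> F \<and> (\<forall>x\<in>F. \<forall>y\<in>F. x - y \<in> F \<and> x * y \<in> F) \<and> (\<forall>x\<in>F. inverse x \<in> F)"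

lemma fieldset_closed:
  assumes "fieldset F"
  shows "1 \<in> F" "0 \<in> F" "x \<in> F \<Longrightarrow> y \<in> F \<Longrightarrow> x - y \<in> F" "x \<in> F \<Longrightarrow> y \<in> F \<Longrightarrow> x * y \<in> F"
    "x \<in> F \<Longrightarrow> inverse x \<in> F" "x \<in> F \<Longrightarrow> - x \<in> F" "x \<in> F \<Longrightarrow> y \<in> F \<Longrightarrow> x + y \<in> F"
    "x \<in> F \<Longrightarrow> y \<in> F \<Longrightarrow> x / y \<in> F" "x \<in> F \<Longrightarrow> x ^ n \<in> F" "of_nat m \<in> F"
proof -
  have d: "x - y \<in> F" and m: "x * y \<in> F" and i: "inverse x \<in> F" if "x \<in> F" "y \<in> F" for x y
    using assms that by (auto simp: fieldset_def)
  show one: "1 \<in> F" using assms by (auto simp: fieldset_def)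
  show z: "0 \<in> F" using d[OF one one] by simp
  have u: "- x \<in> F" if "x \<in> F" for x using d[OF z that] by simp
  have a: "x + y \<in> F" if "x \<in> F" "y \<in> F" for x y using d[OF that(1) u[OF that(2)]] by simp
  show "of_nat m \<in> F" by (induction m) (auto intro: one z a)
  show "x \<in> F \<Longrightarrow> x ^ n \<in> F" by (induction n) (auto intro: one m)
  show "x \<in> F \<Longrightarrow> y \<in> F \<Longrightarrow> x / y \<in> F" using m[OF _ i] by (simp add: field_class.field_divide_inverse)
  show "x \<in> F \<Longrightarrow> - x \<in> F" "x \<in> F \<Longrightarrow> y \<in> F \<Longrightarrow> x + y \<in> F" by (auto intro: u a)
qed (use assms in \<open>auto simp: fieldset_def\<close>)

definition polys :: "'k::field set \<Rightarrow> 'k poly \<Rightarrow> bool" where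
  "polys F g \<longleftrightarrow> (\<forall>i. coeff g i \<in> F)"

lemma polys_0: "fieldset F \<Longrightarrow> polys F 0"
  by (simp add: polys_def fieldset_closed)

lemma polys_pCons: "fieldset F \<Longrightarrow> polys F (pCons a g) \<longleftrightarrow> a \<in> F \<and> polys F g"
  unfolding polys_def by (auto simp: coeff_pCons split: nat.splits)

lemma polys_add: "fieldset F \<Longrightarrow> polys F g \<Longrightarrow> polys F h \<Longrightarrow> polys F (g + h)"
  by (simp add: polys_def fieldset_closed)

lemma polys_smult: "fieldset F \<Longrightarrow> polys F g \<Longrightarrow> a \<in> F \<Longrightarrow> polys F (smult a g)"
  by (simp add: polys_def fieldset_closed)

lemma polys_pderiv: "fieldset F \<Longrightarrow> polys F g \<Longrightarrow> polys F (pderiv g)"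
  by (simp add: polys_def coeff_pderiv fieldset_closed del: of_nat_Suc)

lemma polys_pcompose:
  "fieldset F \<Longrightarrow> polys F g \<Longrightarrow> c \<in> F \<Longrightarrow> z \<in> F \<Longrightarrow> polys F (pcompose g [:c, z:])"
  by (induction g) (auto simp: pcompose_pCons polys_pCons polys_0 intro!: polys_add polys_smult fieldset_closed(2))

text \<open>The degree bound serves inductions over a field that is not yet relatively algebraically
  closed: below the least degree of a missing root, all results with this hypothesis are
  available.\<close>

definition roots_in :: "nat \<Rightarrow> 'k::field set \<Rightarrow> bool" where
  "roots_in n F \<longleftrightarrow> (\<forall>g x. g \<noteq> 0 \<longrightarrow> polys F g \<longrightarrow> degree g \<le> n \<longrightarrow> poly g x = 0 \<longrightarrow> x \<in> F)"

lemma roots_in_mono: "roots_in n F \<Longrightarrow> m \<le> n \<Longrightarrow> roots_in m F"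
  unfolding roots_in_def using le_trans by blast

lemma roots_in_power:
  assumes "roots_in n F" "fieldset F" "0 < m" "m \<le> n" "s ^ m \<in> F"
  shows "s \<in> F"
proof -
  let ?g = "monom 1 m - [:s ^ m:] :: 'a poly"
  have c: "coeff ?g i = (if i = m then 1 else if i = 0 then - (s ^ m) else 0)" for i
    using assms(3) by (simp add: coeff_pCons split: nat.splits)
  have "degree ?g \<le> n" using assms(4)
    by (intro degree_diff_le) (auto intro: order.trans[OF degree_monom_le])
  moreover have "polys F ?g" unfolding polys_def c using assms by (simp add: fieldset_closed)
  moreover have "?g \<noteq> 0" using c[of m] by (metis coeff_0 zero_neq_one)
  moreover have "poly ?g s = 0" by (simp add: poly_monom)
  ultimately show ?thesis using assms(1) unfolding roots_in_def by blast
qed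

text \<open>Hensel's lemma is stated in the normal form a + X + X^2 (...), so that for fixed
  \<open>n\<close> it is one first-order sentence in the coefficients. The last axiom says that
  every valuation is congruent modulo \<open>N\<close> to one of 0, ..., \<open>N - 1\<close>, the
  first-order trace of the value group being the integers.\<close>

locale pclosed = vring V p for V :: "'k::field set" and p +
  assumes char0: "0 < n \<Longrightarrow> (of_nat n :: 'k) \<noteq> 0"
    and hensel_form: "a / of_nat p \<in> V \<Longrightarrow> (\<And>i. i < n \<Longrightarrow> c i \<in> V) \<Longrightarrow>
      \<exists>x. x / of_nat p \<in> V \<and> a + x + (\<Sum>i<n. c i * x ^ (i + 2)) = 0"
    and zgroup: "x \<noteq> 0 \<Longrightarrow> 0 < N \<Longrightarrow>
      \<exists>y. y \<noteq> 0 \<and> (\<exists>r<N. x * y ^ N / of_nat p ^ r \<in> V \<and> of_nat p ^ r / (x * y ^ N) \<in> V)"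
begin

text \<open>Substituting a + \<delta> y and dividing by \<delta> squared brings \<open>g\<close>
  into the normal form of \<open>hensel_form\<close>. There the constant term \<epsilon> is -y times
  a one-unit, which bounds y and gives the distance estimate.\<close>

lemma hensel:
  assumes g: "cont 1 g" and a: "a \<in> V" and d: "poly (pderiv g) a = \<delta>" "\<delta> \<noteq> 0"
    and v: "vle (\<pi> * \<delta>\<^sup>2) (poly g a)"
  shows "\<exists>x\<in>V. poly g x = 0 \<and> vle (poly g a) (\<delta> * (x - a))"
proof -
  obtain r where r: "pcompose g [:a, 1:] = pCons (poly g a) (pCons \<delta> r)" "cont 1 r"
    using taylor2[OF g a] d(1) by blast
  have dV: "\<delta> \<in> V" using cont_poly[OF cont_pderiv[OF g] a] d(1) by (simp add: vle_1_iff)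
  define \<epsilon> where "\<epsilon> = poly g a / \<delta>\<^sup>2"
  define c where "c i = coeff r i * \<delta> ^ i" for i
  have eps: "poly g a = \<delta>\<^sup>2 * \<epsilon>" using d by (simp add: \<epsilon>_def)
  have "vle (\<delta>\<^sup>2 * \<pi>) (\<delta>\<^sup>2 * \<epsilon>)" using v by (simp add: eps mult.commute)
  then have "vle \<pi> \<epsilon>" using d by (simp add: vle_mult_cancel)
  then have "\<epsilon> / \<pi> \<in> V" by (simp add: vle_iff pi_nonzero)
  moreover have c: "c i \<in> V" for i
    using r(2) dV unfolding c_def cont_def by (simp add: vle_1_iff mult_V power_V)
  ultimately obtain y where y: "y / \<pi> \<in> V" "\<epsilon> + y + (\<Sum>i<Suc (degree r). c i * y ^ (i + 2)) = 0"
    using hensel_form[of \<epsilon> "Suc (degree r)" c] by blast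
  have py: "vle \<pi> y" using y pi_nonzero by (simp add: vle_iff)
  then have yV: "y \<in> V" using vle_of_mult[of 1 \<pi> y] of_nat_V by (simp add: vle_1_iff)
  define q where "q = poly r (\<delta> * y)"
  have q: "(\<Sum>i<Suc (degree r). c i * y ^ (i + 2)) = y\<^sup>2 * q"
    unfolding q_def poly_altdef lessThan_Suc_atMost sum_distrib_left c_def
    by (intro sum.cong) (auto simp: power_mult_distrib power_add power2_eq_square mult_ac)
  have qV: "q \<in> V" using cont_poly[OF r(2), of "\<delta> * y"] dV yV by (simp add: q_def vle_1_iff mult_V)
  have "poly g (a + \<delta> * y) = poly (pcompose g [:a, 1:]) (\<delta> * y)" by (simp add: poly_pcompose)
  also have "\<dots> = \<delta>\<^sup>2 * (\<epsilon> + y + y\<^sup>2 * q)"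
    unfolding r q_def by (simp add: eps algebra_simps power2_eq_square)
  also have "\<dots> = 0" using y(2) q by simp
  finally have root: "poly g (a + \<delta> * y) = 0" .
  have eq: "\<epsilon> = - (y * (1 + y * q))"
    using y(2) unfolding q by (simp add: algebra_simps power2_eq_square add_eq_0_iff)
  have "vle \<pi> (1 + y * q - 1)" using py qV by (simp add: vle_mult_right)
  then have "vle (1 + y * q) 1" by (rule one_unit)
  then have "vle \<epsilon> y" unfolding eq using vle_mult_left[of "1 + y * q" 1 y] by simp
  then have "vle (\<delta>\<^sup>2 * \<epsilon>) (\<delta>\<^sup>2 * y)" by (rule vle_mult_left)
  then have "vle (poly g a) (\<delta> * (a + \<delta> * y - a))" by (simp add: eps power2_eq_square mult.assoc)
  moreover have "a + \<delta> * y \<in> V" using a dV yV by (simp add: add_V mult_V)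
  ultimately show ?thesis using root by blast
qed

lemma coprime_unit: assumes "\<not> p dvd m" shows "vle (of_nat m) 1"
proof (rule ccontr)
  assume "\<not> ?thesis"
  then have *: "vle \<pi> (of_nat m)" using unit_or_pi[OF of_nat_V] by blast
  have "coprime m p" using prime_imp_coprime[OF prime_p assms] by (simp add: coprime_commute)
  moreover have "m \<noteq> 0" using assms by (metis dvd_0_right)
  ultimately obtain k l where "m * k = p * l + 1"
    using coprime_bezout_strong[of m p] prime_p by (metis not_prime_1)
  then have "of_nat m * of_nat k - \<pi> * of_nat l = 1"
    by (metis add_diff_cancel_left' of_nat_1 of_nat_add of_nat_mult)
  moreover have "vle \<pi> (of_nat m * of_nat k - \<pi> * of_nat l)"
    using * by (intro vle_diff vle_mult_right of_nat_V) auto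
  ultimately show False using pi_not_dvd_1 by simp
qed

text \<open>Valuations of K may be infinite, but those of positive natural numbers are finite.
  Losses caused by integer factors can thus be absorbed into exponents of p.\<close>

lemma nat_same_pi: assumes "0 < n" shows "\<exists>k. same (of_nat n) (\<pi> ^ k)"
  using assms
proof (induction n rule: less_induct)
  case (less n)
  show ?case
  proof (cases "p dvd n")
    case True
    then obtain m where m: "n = p * m" by blast
    then have "0 < m" "m < n" using less.prems prime_p prime_gt_1_nat[of p] by auto
    then obtain k where "same (of_nat m) (\<pi> ^ k)" using less.IH by blast
    then have "same (\<pi> * of_nat m) (\<pi> * \<pi> ^ k)" by (intro same_mult) auto
    then show ?thesis unfolding m by (metis of_nat_mult power_Suc)
  next
    case False
    then have "same (of_nat n) (\<pi> ^ 0)" by (simp add: same_def coprime_unit vle_1_iff of_nat_V)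
    then show ?thesis by blast
  qed
qed

lemma power_root:
  assumes N: "0 < N" and u: "vle (\<pi> * of_nat N ^ 2) (u - 1)"
  shows "\<exists>r. r ^ N = u"
proof -
  have "vle \<pi> (u - 1)" using vle_of_mult[OF u] power_V of_nat_V by blast
  then have uV: "u \<in> V" by (rule one_unit)
  define g where "g = monom 1 N - [:u:]"
  have g: "cont 1 g" unfolding cont_def g_def using uV
    by (auto simp: coeff_pCons vle_1_iff one_V zero_V minus_V diff_V split: nat.splits)
  have d: "poly (pderiv g) 1 = of_nat N"
    by (simp add: g_def pderiv_diff pderiv_monom pderiv_pCons poly_monom)
  have "vle (\<pi> * of_nat N ^ 2) (poly g 1)"
    using u vle_diff_commute by (simp add: g_def poly_monom)
  from hensel[OF g one_V d char0[OF N] this] obtain r where "poly g r = 0" by blast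
  then show ?thesis by (auto simp: g_def poly_monom)
qed

text \<open>The exponent 2 k + 1 is the valuation of p N^2, the precision that Hensel's lemma needs
  for X^N - u at 1, where the derivative is N.\<close>

lemma one_unit_pw:
  assumes N: "0 < N"
  shows "\<exists>M>0. \<forall>x y. y \<noteq> 0 \<longrightarrow> near M x y \<longrightarrow> (\<exists>r. r \<noteq> 0 \<and> x = r ^ N * y)"
proof -
  obtain k where k: "same (of_nat N) (\<pi> ^ k)" using nat_same_pi[OF N] by blast
  have "\<exists>r. r \<noteq> 0 \<and> x = r ^ N * y" if y: "y \<noteq> 0" and n: "near (2 * k + 1) x y" for x y
  proof -
    define u where "u = x / y"
    have u: "near (2 * k + 1) u 1" using near_cancel[OF y, of "2 * k + 1" u 1] n y by (simp add: u_def)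
    have "vle (of_nat N ^ 2) ((\<pi> ^ k) ^ 2)" using k by (simp add: same_def vle_power)
    then have "vle (\<pi> * of_nat N ^ 2) (\<pi> * (\<pi> ^ k) ^ 2)" by (rule vle_mult_left)
    also have "\<pi> * (\<pi> ^ k) ^ 2 = \<pi> ^ (2 * k + 1)" by (simp flip: power_mult add: mult.commute)
    finally have "vle (\<pi> * of_nat N ^ 2) (u - 1)" using u vle_trans unfolding near_1 by blast
    then obtain r where r: "r ^ N = u" using power_root[OF N] by blast
    moreover have "u \<noteq> 0" using near_0_iff[OF u] by simp
    ultimately have "r \<noteq> 0" using N by (metis power_0_left less_not_refl)
    moreover have "x = r ^ N * y" using r y by (simp add: u_def)
    ultimately show ?thesis by blast
  qed
  then show ?thesis by (intro exI[of _ "2 * k + 1"]) auto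
qed

lemma near_pw:
  assumes "0 < N"
  shows "\<exists>M>0. \<forall>x y. near M x y \<longrightarrow> (pw N x \<longleftrightarrow> pw N y)"
proof -
  obtain M where M: "M > 0" "\<forall>x y. y \<noteq> 0 \<longrightarrow> near M x y \<longrightarrow> (\<exists>r. r \<noteq> 0 \<and> x = r ^ N * y)"
    using one_unit_pw[OF assms] by blast
  have "pw N x \<longleftrightarrow> pw N y" if "near M x y" for x y
  proof (cases "y = 0")
    case True
    then show ?thesis using near_0_iff[OF that M(1)] by simp
  next
    case False
    then show ?thesis using M that pw_power_mult by blast
  qed
  then show ?thesis using M(1) by blast
qed

lemma unit_near_nat:
  assumes u: "u \<in> V" "vle u 1"
  shows "\<exists>k::nat. (of_nat k :: 'k) \<noteq> 0 \<and> near n u (of_nat k)"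
proof -
  \<comment> \<open>The exponent \<open>Suc n\<close> forces k to be a unit even for n = 0.\<close>
  obtain k where k: "vle (\<pi> ^ Suc n) (u - of_nat k)" using residue_power[OF u(1)] by blast
  have pk: "vle \<pi> (u - of_nat k)" using vle_trans[OF vle_pi_power[of 1 "Suc n"] k] by simp
  have "\<not> vle \<pi> (of_nat k)"
  proof
    assume "vle \<pi> (of_nat k)"
    then have "vle \<pi> u" using vle_add[OF pk, of "of_nat k"] by simp
    then show False using u(2) vle_trans pi_not_dvd_1 by blast
  qed
  then have k1: "vle (of_nat k) 1" using unit_or_pi[OF of_nat_V] by blast
  have "vle (of_nat k * \<pi> ^ Suc n) (1 * (u - of_nat k))" using vle_mult[OF k1 k] .
  then have "near (Suc n) u (of_nat k)" by (simp add: near_def mult_ac)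
  then have "near n u (of_nat k)" by (rule near_mono) simp
  moreover have "of_nat k \<noteq> (0::'k)" using k1 by auto
  ultimately show ?thesis by blast
qed

text \<open>Natural numbers represent all classes modulo N-th powers: \<open>zgroup\<close> removes
  the valuation up to a power p^r, and the remaining unit is close to a natural number. Consequently
  every subfield meets every class, and partial isomorphisms fix the representatives.\<close>

lemma power_rep:
  fixes x :: 'k
  assumes "x \<noteq> 0" "0 < N"
  shows "\<exists>l::nat. 0 < l \<and> (\<exists>r. r \<noteq> 0 \<and> x = of_nat l * r ^ N)"
proof -
  obtain y r where y: "y \<noteq> 0" and xy: "x * y ^ N / \<pi> ^ r \<in> V" "\<pi> ^ r / (x * y ^ N) \<in> V"
    using zgroup[OF assms] by blast
  define w where "w = x * y ^ N / \<pi> ^ r"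
  have w: "w \<in> V" "vle w 1"
    using xy assms y pi_nonzero by (auto simp: w_def vle_iff)
  obtain M where M: "M > 0" "\<And>x y. y \<noteq> 0 \<Longrightarrow> near M x y \<Longrightarrow> \<exists>r. r \<noteq> 0 \<and> x = r ^ N * y"
    using one_unit_pw[OF assms(2)] by blast
  obtain k where k0: "of_nat k \<noteq> (0::'k)" and k: "near M w (of_nat k)" using unit_near_nat[OF w] by blast
  obtain s where s: "s \<noteq> 0" "w = s ^ N * of_nat k" using M(2)[OF k0 k] by blast
  have "x = of_nat (p ^ r * k) * (s / y) ^ N"
    using s(2) y pi_nonzero by (simp add: w_def field_simps power_divide)
  moreover have "0 < p ^ r * k" using k0 prime_p prime_gt_0_nat[of p] by (cases k) auto
  moreover have "s / y \<noteq> 0" using s y by simp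
  ultimately show ?thesis by blast
qed

text \<open>The unit z / s is close to a natural number k, and s k lies in F. Agreement of
  valuations with one element of F thus gives approximation by F to every finite precision.\<close>

lemma same_V_near:
  assumes F: "fieldset F" and s: "s \<in> F" "same z s" "s \<noteq> 0"
  shows "\<exists>s'\<in>F. s' \<noteq> 0 \<and> near n z s'"
proof -
  have "z / s \<in> V" "vle (z / s) 1"
    using s vle_mult_cancel[OF s(3), of "z / s" 1] by (auto simp: same_def vle_iff)
  then obtain k where k: "(of_nat k :: 'k) \<noteq> 0" "near n (z / s) (of_nat k)" using unit_near_nat by blast
  have "near n (s * (z / s)) (s * of_nat k)" by (rule near_mult_left[OF k(2)])
  then show ?thesis using s k(1) F by (intro bexI[of _ "s * of_nat k"]) (auto simp: fieldset_closed)
qed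

text \<open>Approximate z^m by s' in F so well that the quotient is an m-th power r^m. Then z / r is
  an m-th root of s'.\<close>

lemma root_of_same:
  assumes F: "fieldset F" and m: "0 < m" and b: "b \<in> F" "same (z ^ m) b" "z \<noteq> 0"
  shows "\<exists>s. s ^ m \<in> F \<and> same z s \<and> s \<noteq> 0"
proof -
  have b0: "b \<noteq> 0" using b same_0_iff by fastforce
  obtain M where M: "M > 0" "\<And>x y. y \<noteq> 0 \<Longrightarrow> near M x y \<Longrightarrow> \<exists>r. r \<noteq> 0 \<and> x = r ^ m * y"
    using one_unit_pw[OF m] by blast
  obtain s' where s': "s' \<in> F" "s' \<noteq> 0" "near M (z ^ m) s'"
    using same_V_near[OF F b(1,2) b0] by blast
  then obtain r where r: "r \<noteq> 0" "z ^ m = r ^ m * s'" using M by blast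
  have "s' = (z / r) ^ m" using r by (simp add: power_divide)
  moreover from this have "same z (z / r)"
    using near_same[OF s'(3) M(1)] same_power_iff[OF m] by metis
  ultimately show ?thesis using s' b(3) r by (intro exI[of _ "z / r"]) auto
qed

lemma same_in_field:
  assumes F: "fieldset F" "roots_in n F" and m: "0 < m" "m \<le> n" and b: "b \<in> F" "same (z ^ m) b" "z \<noteq> 0"
  shows "\<exists>s\<in>F. s \<noteq> 0 \<and> same z s"
  using root_of_same[OF F(1) m(1) b] roots_in_power[OF F(2,1) m] by blast

end

section \<open>Centers of polynomials\<close>

lemma pcompose_linear_linear:
  "pcompose [:c, z:] [:u, w:] = [:c + z * u, z * (w::'a::comm_ring_1):]"
  by (simp add: pcompose_pCons algebra_simps)

context vring
begin

lemma vle_min: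
  assumes "finite I" "I \<noteq> {}" shows "\<exists>i\<in>I. \<forall>j\<in>I. vle (f i) (f j)"
  using assms
proof (induction I rule: finite_ne_induct)
  case (insert x I)
  then obtain i where i: "i \<in> I" "\<forall>j\<in>I. vle (f i) (f j)" by blast
  show ?case
  proof (cases "vle (f i) (f x)")
    case False
    then have "vle (f x) (f i)" using vle_total by blast
    then show ?thesis using i vle_trans by (intro bexI[of _ x]) auto
  qed (use i in auto)
qed simp

lemma vle_perturb:
  assumes "vle a b" "vle (\<pi> * b) (a' - a)" "b \<noteq> 0" shows "vle a' b"
proof (rule ccontr)
  assume "\<not> ?thesis"
  then have "vle (\<pi> * b) a'" by (rule not_vle)
  then have "vle (\<pi> * b) a" using vle_diff[OF _ assms(2)] by fastforce
  then show False using assms vle_trans not_vle_self by blast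
qed

text \<open>\<open>center g c z M\<close>: up to the error \<open>M\<close>, \<open>v (g (c + z))\<close> is the Gauss valuation of \<open>g\<close> on the
  ball around \<open>c\<close> of radius \<open>v z\<close>.\<close>
definition center :: "'k poly \<Rightarrow> 'k \<Rightarrow> 'k \<Rightarrow> nat \<Rightarrow> bool" where
  "center g c z M \<longleftrightarrow> cont (poly g (c + z)) (smult (\<pi> ^ M) (pcompose g [:c, z:]))"

lemma center_mono:
  assumes "center g c z M" "M \<le> N" shows "center g c z N"
proof -
  have "smult (\<pi> ^ N) (pcompose g [:c, z:]) = smult (\<pi> ^ (N - M)) (smult (\<pi> ^ M) (pcompose g [:c, z:]))"
    using assms by (simp flip: power_add)
  then show ?thesis using assms cont_smult power_V of_nat_V unfolding center_def by metis
qed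

text \<open>The point c + z is kept while the ball shrinks. The new polynomial arises from the old
  one by a substitution with coefficients in V, so its Gauss valuation can only rise while the value
  stays the same.\<close>

lemma center_refine:
  assumes "center g c z M" "c + z = c' + z'" "vle z z'"
  shows "center g c' z' M"
proof (cases "z = 0")
  case True
  then show ?thesis using assms by simp
next
  case False
  have V: "z' / z \<in> V" "(c' - c) / z \<in> V"
  proof -
    show z': "z' / z \<in> V" using assms False by (simp add: vle_iff)
    have "(c' - c) / z = 1 - z' / z" using assms(2) False
      by (simp add: diff_divide_distrib[symmetric] field_simps)
    then show "(c' - c) / z \<in> V" using diff_V one_V z' by simp
  qed
  have "pcompose g [:c', z':] = pcompose (pcompose g [:c, z:]) [:(c' - c) / z, z' / z:]"
    using False by (simp add: pcompose_assoc[symmetric] pcompose_linear_linear)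
  then have "smult (\<pi> ^ M) (pcompose g [:c', z':]) =
      pcompose (smult (\<pi> ^ M) (pcompose g [:c, z:])) [:(c' - c) / z, z' / z:]"
    by (simp add: pcompose_smult)
  then show ?thesis using cont_pcompose[OF _ V(2,1)] assms unfolding center_def by metis
qed

lemma poly_near:
  assumes Q: "cont (poly Q x) (smult (\<pi> ^ M) Q)" and xy: "x \<in> V" "y \<in> V" "vle (\<pi> ^ (M + L)) (y - x)"
  shows "near L (poly Q y) (poly Q x)"
proof -
  have "vle (poly Q x * (y - x)) (\<pi> ^ M * (poly Q y - poly Q x))"
    using poly_diff_vle[OF Q xy(2,1)] by (simp add: right_diff_distrib)
  moreover have "vle (poly Q x * \<pi> ^ (M + L)) (poly Q x * (y - x))" by (rule vle_mult_left[OF xy(3)])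
  ultimately have "vle (poly Q x * \<pi> ^ (M + L)) (\<pi> ^ M * (poly Q y - poly Q x))" using vle_trans by blast
  then have "vle (\<pi> ^ M * (\<pi> ^ L * poly Q x)) (\<pi> ^ M * (poly Q y - poly Q x))"
    by (simp add: power_add mult_ac)
  then show ?thesis using pi_nonzero by (simp add: vle_mult_cancel near_def)
qed

end

context pclosed
begin

text \<open>Hensel's lemma at 1 after division by e. The derivative has valuation at most M there,
  so 2 M + 1 meets the hypothesis, and the root lies at distance at least (2 M + 1 + L) - M from
  1.\<close>

lemma newton:
  assumes e: "cont e H" "e \<noteq> 0" and d: "vle (poly (pderiv H) 1) (\<pi> ^ M * e)"
    and H1: "vle (\<pi> ^ (2 * M + 1 + L) * e) (poly H 1)"
  shows "\<exists>x\<in>V. poly H x = 0 \<and> vle (\<pi> ^ (M + 1 + L)) (x - 1)"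
proof -
  define g where "g = smult (inverse e) H"
  define \<delta> where "\<delta> = poly (pderiv g) 1"
  have g: "cont 1 g" using cont_smult_mult[OF e(1), of "inverse e"] e(2) by (simp add: g_def)
  have de: "poly (pderiv H) 1 = e * \<delta>" "poly H 1 = e * poly g 1"
    using e by (auto simp: \<delta>_def g_def pderiv_smult)
  have d1: "vle \<delta> (\<pi> ^ M)" using d e(2) by (simp add: de mult.commute[of _ e] vle_mult_cancel)
  then obtain w where w: "w \<in> V" "\<pi> ^ M = \<delta> * w" by (auto simp: vle_def)
  have d0: "\<delta> \<noteq> 0" using w pi_nonzero by (metis mult_eq_0_iff power_not_zero)
  have g1: "vle (\<pi> ^ (2 * M + 1 + L)) (poly g 1)"
    using H1 e(2) by (simp add: de mult.commute[of _ e] vle_mult_cancel)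
  have "vle (\<pi> * \<delta>\<^sup>2) (\<pi> * (\<pi> ^ M)\<^sup>2)" by (intro vle_mult_left vle_power d1)
  also have "\<pi> * (\<pi> ^ M)\<^sup>2 = \<pi> ^ (2 * M + 1)" by (simp flip: power_mult add: mult.commute)
  finally have "vle (\<pi> * \<delta>\<^sup>2) (poly g 1)" using g1 vle_pi_power[of "2 * M + 1" "2 * M + 1 + L"] vle_trans by (meson le_add1)
  from hensel[OF g one_V \<delta>_def[symmetric] d0 this]
  obtain x where x: "x \<in> V" "poly g x = 0" "vle (poly g 1) (\<delta> * (x - 1))" by blast
  have "vle (\<pi> ^ (2 * M + 1 + L)) (\<delta> * (x - 1) * w)"
    using vle_mult_right[OF vle_trans[OF g1 x(3)] w(1)] .
  also have "\<delta> * (x - 1) * w = \<pi> ^ M * (x - 1)" by (simp add: w)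
  also have "\<pi> ^ (2 * M + 1 + L) = \<pi> ^ M * \<pi> ^ (M + 1 + L)" by (simp add: mult_2 add_ac flip: power_add)
  finally have "vle (\<pi> ^ (M + 1 + L)) (x - 1)" by (rule vle_mult_cancel[THEN iffD1, OF power_not_zero[OF pi_nonzero]])
  moreover have "poly H x = 0" using x(2) e(2) by (simp add: g_def)
  ultimately show ?thesis using x(1) by blast
qed

text \<open>A center for the derivative controls j times the j-th coefficient. The factors j up to
  the degree all divide \<open>fact (degree H)\<close>, whose valuation is finite, so a single
  constant removes them.\<close>

lemma center_pderiv:
  assumes "center (pderiv g) c z M" and H: "H = pcompose g [:c, z:]"
  shows "\<exists>N. \<forall>j>0. vle (poly (pderiv H) 1) (\<pi> ^ N * coeff H j)"
proof -
  let ?n = "degree H"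
  have pd: "pderiv H = smult z (pcompose (pderiv g) [:c, z:])"
    by (simp add: H pderiv_pcompose pderiv_pCons)
  have *: "vle (poly (pderiv H) 1) (\<pi> ^ M * (of_nat j * coeff H j))" if "j > 0" for j
  proof -
    obtain i where i: "j = Suc i" using \<open>j > 0\<close> gr0_conv_Suc by blast
    have "vle (z * poly (pderiv g) (c + z)) (z * coeff (smult (\<pi> ^ M) (pcompose (pderiv g) [:c, z:])) i)"
      using assms(1) by (simp add: center_def cont_def vle_mult_left)
    moreover have "z * coeff (smult (\<pi> ^ M) (pcompose (pderiv g) [:c, z:])) i = \<pi> ^ M * coeff (pderiv H) i"
      by (simp add: pd)
    moreover have "z * poly (pderiv g) (c + z) = poly (pderiv H) 1" by (simp add: pd poly_pcompose)
    ultimately have "vle (poly (pderiv H) 1) (\<pi> ^ M * coeff (pderiv H) i)" by (simp only:)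
    then show ?thesis by (simp add: coeff_pderiv i del: of_nat_Suc)
  qed
  obtain k where k: "vle (of_nat (fact ?n)) (\<pi> ^ k)" using nat_same_pi[of "fact ?n"] by (auto simp: same_def)
  have "vle (poly (pderiv H) 1) (\<pi> ^ (M + k) * coeff H j)" if j: "j > 0" for j
  proof (cases "j \<le> ?n")
    case True
    then obtain m where m: "fact ?n = j * m" using dvd_fact[of j ?n] j by (auto simp: dvd_def)
    have "vle (of_nat j) (of_nat (fact ?n))" unfolding m of_nat_mult by (intro vle_mult_right of_nat_V) auto
    then have "vle (of_nat j) (\<pi> ^ k)" using k vle_trans by blast
    then have "vle (\<pi> ^ M * (of_nat j * coeff H j)) (\<pi> ^ M * (\<pi> ^ k * coeff H j))"
      by (intro vle_mult) auto
    from vle_trans[OF *[OF j] this] show ?thesis by (simp add: power_add mult.assoc)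
  next
    case False
    then show ?thesis by (simp add: coeff_eq_0)
  qed
  then show ?thesis by blast
qed

text \<open>The constant term vanishes at the root x. Since 1 - x is divisible by p^(M + 1) and the
  derivative exceeds e by at most M, the linear term dominates all higher ones; there is no error
  term.\<close>

lemma center_at_root:
  assumes e: "cont e H" "e \<noteq> 0" and d: "vle (poly (pderiv H) 1) (\<pi> ^ M * e)"
    and x: "x \<in> V" "poly H x = 0" "vle (\<pi> ^ (M + 1)) (x - 1)"
  shows "cont (poly H 1) (pcompose H [:x, 1 - x:])"
proof -
  define \<gamma> where "\<gamma> = poly (pderiv H) x"
  obtain r where r: "pcompose H [:x, 1:] = pCons 0 (pCons \<gamma> r)" "cont e r"
    using taylor2[OF e(1) x(1)] x(2) \<gamma>_def by auto
  have x1: "vle (\<pi> ^ (M + 1)) (1 - x)" using x(3) vle_diff_commute by blast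
  have V1: "1 - x \<in> V" using x diff_V one_V by blast
  have "vle (e * (x - 1)) (\<gamma> - poly (pderiv H) 1)"
    unfolding \<gamma>_def by (rule poly_diff_vle[OF cont_pderiv[OF e(1)] x(1) one_V])
  moreover have "vle (\<pi> * (\<pi> ^ M * e)) (e * (x - 1))"
    using vle_mult_left[OF x(3), of e] by (simp add: mult_ac)
  ultimately have g: "vle \<gamma> (\<pi> ^ M * e)"
    using vle_perturb[OF d] vle_trans e(2) pi_nonzero by (metis mult_eq_0_iff power_not_zero)
  have small: "vle (\<pi> * \<gamma>) ((1 - x) * b)" if "vle e b" for b
  proof -
    have "vle (\<pi> * \<gamma>) (\<pi> * (\<pi> ^ M * e))" by (rule vle_mult_left[OF g])
    moreover have "vle (\<pi> * (\<pi> ^ M * e)) ((1 - x) * b)"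
      using vle_mult[OF x1 that] by (simp add: mult.assoc)
    ultimately show ?thesis by (rule vle_trans)
  qed
  define q where "q = poly r (1 - x)"
  have "poly H 1 = poly (pcompose H [:x, 1:]) (1 - x)" by (simp add: poly_pcompose)
  also have "\<dots> = (1 - x) * \<gamma> + (1 - x) * ((1 - x) * q)"
    unfolding r(1) q_def by (simp add: algebra_simps)
  finally have H1: "poly H 1 = (1 - x) * \<gamma> + (1 - x) * ((1 - x) * q)" .
  have "vle (\<pi> * \<gamma>) ((1 - x) * q)" unfolding q_def by (rule small) (rule cont_poly[OF r(2) V1])
  then have "near 1 (\<gamma> + (1 - x) * q) \<gamma>" by (simp add: near_def)
  then have "near 1 (poly H 1) ((1 - x) * \<gamma>)"
    using near_mult_left[of 1 "\<gamma> + (1 - x) * q" \<gamma> "1 - x"] by (simp add: H1 algebra_simps)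
  then have v1: "vle (poly H 1) ((1 - x) * \<gamma>)" using near_same[of 1] by (simp add: same_def)
  have eq: "pcompose H [:x, 1 - x:] = pcompose (pCons 0 (pCons \<gamma> r)) [:0, 1 - x:]"
    unfolding r(1)[symmetric] by (simp add: pcompose_assoc[symmetric] pcompose_linear_linear)
  show ?thesis unfolding cont_def eq coeff_pcompose_linear
  proof
    fix j
    consider "j = 0" | "j = 1" | i where "j = Suc (Suc i)" by (metis One_nat_def not0_implies_Suc)
    then show "vle (poly H 1) ((1 - x) ^ j * coeff (pCons 0 (pCons \<gamma> r)) j)"
    proof cases
      case 3
      have "vle (\<pi> * \<gamma>) ((1 - x) * coeff r i)" using r(2) small by (simp add: cont_def)
      then have "vle \<gamma> ((1 - x) * coeff r i)" using vle_of_mult[of \<gamma> \<pi>] of_nat_V by (simp add: mult.commute)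
      then have "vle ((1 - x) * \<gamma>) ((1 - x) * ((1 - x) * coeff r i))" by (rule vle_mult_left)
      then have "vle ((1 - x) * \<gamma>) ((1 - x) * ((1 - x) * coeff r i) * (1 - x) ^ i)"
        using vle_mult_right power_V V1 by blast
      then show ?thesis using vle_trans[OF v1] by (simp add: 3 mult_ac)
    qed (use v1 in auto)
  qed
qed

text \<open>Induction on the degree: a center for the derivative is one for \<open>g\<close>, unless \<open>g t\<close> is so
  small that Hensel's lemma yields a root close to \<open>t\<close>; this root is then a center.\<close>
theorem center_exists:
  assumes F: "fieldset F" and r: "roots_in n F" and g: "polys F g" "degree g \<le> n"
  shows "\<exists>c\<in>F. \<exists>M. center g c (t - c) M"
  using r g
proof (induction n arbitrary: g)
  case 0
  then obtain a where "g = [:a:]" by (metis degree_eq_zeroE le_zero_eq)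
  then have "center g 0 (t - 0) 0" by (simp add: center_def)
  then show ?case using F fieldset_closed(2) by blast
next
  case (Suc n)
  have "degree (pderiv g) \<le> n" using Suc.prems(3) by (intro degree_le) (simp add: coeff_pderiv coeff_eq_0)
  then obtain c M where c: "c \<in> F" "center (pderiv g) c (t - c) M"
    using Suc.IH[OF roots_in_mono[OF Suc.prems(1)] polys_pderiv[OF F Suc.prems(2)]] by auto
  define z where "z = t - c"
  define H where "H = pcompose g [:c, z:]"
  obtain N where N: "\<And>j. j > 0 \<Longrightarrow> vle (poly (pderiv H) 1) (\<pi> ^ N * coeff H j)"
    using center_pderiv[OF c(2) H_def[unfolded z_def]] z_def H_def by blast
  have H1: "poly H 1 = poly g t" "poly g (c + z) = poly g t" by (auto simp: H_def z_def poly_pcompose)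
  have cen: "center g c (t - c) K" if "cont (poly H 1) (smult (\<pi> ^ K) H)" for K
    using that H1 by (simp add: center_def H_def z_def)
  \<comment> \<open>The upper end \<open>Suc (degree H)\<close> keeps the index set nonempty when H
    is constant.\<close>
  define I where "I = {1..Suc (degree H)}"
  obtain i where i: "i \<in> I" "\<And>j. j \<in> I \<Longrightarrow> vle (coeff H i) (coeff H j)"
    using vle_min[of I "coeff H"] by (auto simp: I_def)
  define e where "e = coeff H i"
  have ej: "vle e (coeff H j)" if "j > 0" for j
    using i(2)[of j] that by (cases "j \<le> Suc (degree H)") (auto simp: e_def I_def coeff_eq_0)
  have i0: "i > 0" using i(1) by (simp add: I_def)
  show ?case
  \<comment> \<open>If the constant coefficient is strictly smaller than all others, the value at t
    has its valuation and c is a center without error.\<close>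
  proof (cases "vle e (coeff H 0)")
    case False
    have e0: "vle (\<pi> * coeff H 0) e" using not_vle[OF False] .
    have "near 1 (sum (coeff H) {..degree H}) (coeff H 0)"
      by (rule dominant_near) (use ej vle_trans[OF e0] in auto)
    moreover have "sum (coeff H) {..degree H} = poly H 1" by (simp add: poly_altdef)
    ultimately have s: "vle (poly H 1) (coeff H 0)" using near_same[of 1] by (simp add: same_def)
    have "vle (coeff H 0) (coeff H j)" for j
    proof (cases "j = 0")
      case False
      then have "vle (\<pi> * coeff H 0) (coeff H j)" using vle_trans[OF e0 ej] by simp
      then show ?thesis using vle_of_mult[of "coeff H 0" \<pi>] of_nat_V by (simp add: mult.commute)
    qed simp
    then have "cont (poly H 1) (smult (\<pi> ^ 0) H)" using vle_trans[OF s] by (simp add: cont_def)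
    then show ?thesis using cen c by blast
  next
    case True
    then have eH: "cont e H" using ej by (auto simp: cont_def) (metis gr0I)
    show ?thesis
    \<comment> \<open>Now e has the Gauss valuation. If the value at t exceeds it by at most 2 N +
      1, c is a center with this error; otherwise the hypothesis of \<open>newton\<close>
      holds.\<close>
    proof (cases "vle (poly H 1) (\<pi> ^ (2 * N + 1) * e)")
      case True
      have "cont (\<pi> ^ (2 * N + 1) * e) (smult (\<pi> ^ (2 * N + 1)) H)" by (rule cont_smult_mult[OF eH])
      then have "cont (poly H 1) (smult (\<pi> ^ (2 * N + 1)) H)"
        using True vle_trans unfolding cont_def by blast
      then show ?thesis using cen c by blast
    next
      case nv: False
      then have e0: "e \<noteq> 0" by auto
      have "vle (\<pi> ^ (2 * N + 1) * e) (poly H 1)" using nv vle_total by blast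
      then have v: "vle (\<pi> ^ (2 * N + 1 + 0) * e) (poly H 1)" by simp
      have d: "vle (poly (pderiv H) 1) (\<pi> ^ N * e)" unfolding e_def by (rule N[OF i0])
      obtain x where x: "x \<in> V" "poly H x = 0" "vle (\<pi> ^ (N + 1)) (x - 1)"
        using newton[OF eH e0 d v] by auto
      define b where "b = c + z * x"
      have "poly g b = 0" using x(2) by (simp add: H_def poly_pcompose b_def mult.commute)
      moreover have "g \<noteq> 0" using e0 by (auto simp: e_def H_def)
      ultimately have bF: "b \<in> F" using Suc.prems unfolding roots_in_def by blast
      have "pcompose H [:x, 1 - x:] = pcompose g [:b, t - b:]"
        by (simp add: H_def pcompose_assoc[symmetric] pcompose_linear_linear b_def z_def algebra_simps)
      then have "center g b (t - b) 0"
        using center_at_root[OF eH e0 d x] H1 by (simp add: center_def)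
      then show ?thesis using bF by blast
    qed
  qed
qed

end

section \<open>Approximation in relatively algebraically closed subfields\<close>

text \<open>Equality of classes modulo nonzero N-th powers. Zero forms a class of its own, so the
  relation also records vanishing.\<close>

definition psim :: "nat \<Rightarrow> 'k::field \<Rightarrow> 'k \<Rightarrow> bool" where
  "psim N x y \<longleftrightarrow> (\<exists>r. r \<noteq> 0 \<and> x = r ^ N * y)"

lemma psim_refl [simp]: "psim N x x"
  unfolding psim_def by (metis mult_1 power_one zero_neq_one)

lemma psim_trans: "psim N x y \<Longrightarrow> psim N y z \<Longrightarrow> psim N x z"
  unfolding psim_def by (metis mult.assoc mult_eq_0_iff power_mult_distrib)

lemma psim_mult_left: "psim N x y \<Longrightarrow> psim N (a * x) (a * y)"
  unfolding psim_def by (metis mult.left_commute)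

lemma psim_power: "psim N x y \<Longrightarrow> psim N (x ^ n) (y ^ n)"
  unfolding psim_def by (metis power_mult_distrib power_commutes power_mult mult.commute power_not_zero)

definition relclosed :: "'k::field set \<Rightarrow> bool" where
  "relclosed F \<longleftrightarrow> fieldset F \<and> (\<forall>n. roots_in n F)"

context vring
begin

text \<open>If two terms of index l and j differed in valuation by an integer, dividing them would
  give a power of z of exponent at most the degree the valuation of an element of F. Hence the
  smallest term wins by more than every integer.\<close>

lemma dominant_term:
  assumes F: "fieldset F" and B: "polys F B" "B \<noteq> 0" and z: "z \<noteq> 0"
    and n: "\<And>m b. 0 < m \<Longrightarrow> m \<le> degree B \<Longrightarrow> b \<in> F \<Longrightarrow> \<not> same (z ^ m) b"
  shows "\<exists>j\<le>degree B. coeff B j \<noteq> 0 \<and>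
    (\<forall>l n. l \<noteq> j \<longrightarrow> vle (\<pi> ^ n * (coeff B j * z ^ j)) (coeff B l * z ^ l))"
proof -
  define I where "I = {l. l \<le> degree B \<and> coeff B l \<noteq> 0}"
  have "degree B \<in> I" "finite I" using B by (auto simp: I_def)
  then obtain j where j: "j \<in> I" "\<And>l. l \<in> I \<Longrightarrow> vle (coeff B j * z ^ j) (coeff B l * z ^ l)"
    using vle_min[of I "\<lambda>l. coeff B l * z ^ l"] by blast
  have bF: "coeff B i \<in> F" for i using B by (simp add: polys_def)
  have "vle (\<pi> ^ n * (coeff B j * z ^ j)) (coeff B l * z ^ l)" if lj: "l \<noteq> j" for l n
  proof (cases "coeff B l = 0")
    case False
    then have l: "l \<in> I" using le_degree by (simp add: I_def)
    show ?thesis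
    proof (rule ccontr)
      assume "\<not> ?thesis"
      then obtain i where i: "same (coeff B l * z ^ l) (\<pi> ^ i * (coeff B j * z ^ j))"
        using same_pi_power[OF j(2)[OF l]] by blast
      show False
      proof (cases "l < j")
        case True
        have "same (coeff B l * z ^ l * inverse (\<pi> ^ i * coeff B j * z ^ l))
           (\<pi> ^ i * (coeff B j * z ^ j) * inverse (\<pi> ^ i * coeff B j * z ^ l))"
          by (rule same_mult[OF i]) simp
        moreover have "\<pi> ^ i * (coeff B j * z ^ j) * inverse (\<pi> ^ i * coeff B j * z ^ l) = z ^ (j - l)"
          using j(1) z pi_nonzero True by (simp add: I_def power_diff field_simps)
        moreover have "coeff B l * z ^ l * inverse (\<pi> ^ i * coeff B j * z ^ l) = coeff B l / (\<pi> ^ i * coeff B j)"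
          using z by (simp add: divide_inverse)
        ultimately have "same (z ^ (j - l)) (coeff B l / (\<pi> ^ i * coeff B j))" by (metis same_sym)
        moreover have "coeff B l / (\<pi> ^ i * coeff B j) \<in> F" using F bF by (simp add: fieldset_closed)
        moreover have "0 < j - l" "j - l \<le> degree B" using j(1) True by (auto simp: I_def)
        ultimately show False using n by blast
      next
        case False
        have "same (coeff B l * z ^ l * inverse (coeff B l * z ^ j))
           (\<pi> ^ i * (coeff B j * z ^ j) * inverse (coeff B l * z ^ j))"
          by (rule same_mult[OF i]) simp
        moreover have "coeff B l * z ^ l * inverse (coeff B l * z ^ j) = z ^ (l - j)"
          using l z False by (simp add: I_def power_diff divide_inverse)
        moreover have "\<pi> ^ i * (coeff B j * z ^ j) * inverse (coeff B l * z ^ j) = \<pi> ^ i * coeff B j / coeff B l"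
          using z by (simp add: divide_inverse)
        ultimately have "same (z ^ (l - j)) (\<pi> ^ i * coeff B j / coeff B l)" by metis
        moreover have "\<pi> ^ i * coeff B j / coeff B l \<in> F" using F bF by (simp add: fieldset_closed)
        moreover have "0 < l - j" "l - j \<le> degree B" using l lj False by (auto simp: I_def)
        ultimately show False using n by blast
      qed
    qed
  qed simp
  then show ?thesis using j(1) by (auto simp: I_def)
qed

end

context pclosed
begin

lemma psim_nat: "(x::'k) \<noteq> 0 \<Longrightarrow> 0 < N \<Longrightarrow> \<exists>l>0. psim N (of_nat l) x"
proof -
  assume "x \<noteq> 0" "0 < N"
  then obtain l r where l: "0 < l" "r \<noteq> 0" "x = of_nat l * r ^ N" using power_rep by blast
  then have "of_nat l = inverse r ^ N * x" by (simp add: power_inverse)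
  then show ?thesis using l unfolding psim_def by (metis nonzero_imp_inverse_nonzero)
qed

lemma near_psim: "0 < N \<Longrightarrow> \<exists>M>0. \<forall>x y. y \<noteq> 0 \<longrightarrow> near M x y \<longrightarrow> psim N x y"
  unfolding psim_def by (rule one_unit_pw)

text \<open>All constraints are raised to a common exponent \<open>m0\<close>, and A is the largest
  of the lower bounds. Up to a natural factor A is the (m0 N)-th power of some s in F, so a suitable
  natural multiple of s^N has m0-th power only finitely above A. It stays below the upper bounds
  because z^m0 lies infinitely above A.\<close>

lemma cut_realized_lower:
  assumes F: "relclosed F" and z: "z \<noteq> 0" and N: "0 < N" and fin: "finite L" "finite U" and ne: "L \<noteq> {}"
    and L: "\<And>a m. (a, m) \<in> L \<Longrightarrow> a \<in> F \<and> 0 < m \<and> (\<forall>n. vle (\<pi> ^ n * a) (z ^ m))"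
    and U: "\<And>b m. (b, m) \<in> U \<Longrightarrow> 0 < m \<and> (\<forall>n. vle (\<pi> ^ n * z ^ m) b)"
  shows "\<exists>z0\<in>F. psim N z0 z \<and> (\<forall>(a, m)\<in>L. vle a (z0 ^ m)) \<and> (\<forall>(b, m)\<in>U. vle (z0 ^ m) b)"
proof -
  have Fs: "fieldset F" using F by (simp add: relclosed_def)
  define m0 where "m0 = (\<Prod>(a, m)\<in>L \<union> U. m)"
  define k where "k m = m0 div m" for m
  have m0: "0 < m0" unfolding m0_def using L U by (intro prod_pos) fastforce
  have k: "0 < k m \<and> m * k m = m0" if "(a, m) \<in> L \<union> U" for a m
  proof -
    have "m dvd m0" unfolding m0_def using dvd_prodI[of "L \<union> U" "(a, m)" "\<lambda>(a, m). m"] fin that by simp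
    then show ?thesis using m0 by (auto simp: k_def)
  qed
  have nz: "a \<noteq> 0" if "(a, m) \<in> L" for a m using L[OF that] z by (auto dest!: spec[of _ 0])
  obtain a1 m1 where am: "(a1, m1) \<in> L" "\<And>a m. (a, m) \<in> L \<Longrightarrow> vle (a ^ k m) (a1 ^ k m1)"
  proof -
    \<comment> \<open>Inversion turns the minimum supplied by \<open>vle_min\<close> into a maximum;
      lower bounds are nonzero.\<close>
    obtain x where x: "x \<in> L" "\<And>y. y \<in> L \<Longrightarrow> vle ((\<lambda>(a, m). inverse (a ^ k m)) x) ((\<lambda>(a, m). inverse (a ^ k m)) y)"
      using vle_min[OF fin(1) ne, of "\<lambda>(a, m). inverse (a ^ k m)"] by blast
    then have "vle (a ^ k m) (fst x ^ k (snd x))" if "(a, m) \<in> L" for a m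
      using x(2)[OF that] nz[OF that] nz[of "fst x" "snd x"] by (simp add: case_prod_unfold vle_inverse)
    then show ?thesis using that[of "fst x" "snd x"] x(1) by simp
  qed
  define A where "A = a1 ^ k m1"
  have k1: "0 < k m1" "m1 * k m1 = m0" using k am by blast+
  have A0: "A \<noteq> 0" using nz[OF am(1)] by (simp add: A_def)
  have AF: "A \<in> F" using L[OF am(1)] Fs by (simp add: A_def fieldset_closed)
  have Az: "vle (\<pi> ^ n * A) (z ^ m0)" for n
  proof -
    have "vle ((\<pi> ^ n * a1) ^ k m1) ((z ^ m1) ^ k m1)" using L[OF am(1)] by (intro vle_power) blast
    moreover have "(\<pi> ^ n * a1) ^ k m1 = \<pi> ^ (n * k m1) * A"
      by (simp add: A_def power_mult_distrib power_mult)
    moreover have "(z ^ m1) ^ k m1 = z ^ m0" by (simp add: k1 flip: power_mult)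
    moreover have "vle (\<pi> ^ n * A) (\<pi> ^ (n * k m1) * A)" using k1 by (intro vle_mult vle_pi_power) auto
    ultimately show ?thesis using vle_trans by metis
  qed
  \<comment> \<open>The exponent m0 N makes s^N an N-th power, harmless for the power class, whose
    m0-th power is A up to \<mu>.\<close>
  obtain \<mu> s where \<mu>: "0 < \<mu>" "s \<noteq> 0" "A = of_nat \<mu> * s ^ (m0 * N)"
    using power_rep[OF A0, of "m0 * N"] m0 N by auto
  have mu0: "of_nat \<mu> \<noteq> (0::'k)" by (rule char0[OF \<mu>(1)])
  have "s ^ (m0 * N) = A / of_nat \<mu>" using \<mu> mu0 by simp
  then have "s ^ (m0 * N) \<in> F" using AF Fs by (simp add: fieldset_closed)
  then have sF: "s \<in> F" using roots_in_power[of "m0 * N" F "m0 * N" s] F m0 N by (simp add: relclosed_def)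
  obtain l where l: "l > 0" "psim N (of_nat l) z" using psim_nat[OF z N] by blast
  \<comment> \<open>The factor p^q outweighs the division by \<mu>, so that the bound A is still
    met; l fixes the class modulo N-th powers.\<close>
  obtain q where q: "vle (of_nat \<mu>) (\<pi> ^ q)" using nat_same_pi[OF \<mu>(1)] by (auto simp: same_def)
  obtain i where i: "vle (of_nat l ^ m0) (\<pi> ^ i)" using nat_same_pi[of "l ^ m0"] l by (auto simp: same_def)
  define z0 where "z0 = of_nat l * (s * \<pi> ^ q) ^ N"
  have z0F: "z0 \<in> F" using Fs sF by (simp add: z0_def fieldset_closed)
  have sim: "psim N z0 z"
  proof -
    have "psim N z0 (of_nat l)" unfolding psim_def z0_def using \<mu> pi_nonzero
      by (intro exI[of _ "s * \<pi> ^ q"]) (simp add: mult.commute)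
    then show ?thesis using l psim_trans by blast
  qed
  have eq: "of_nat \<mu> * z0 ^ m0 = A * (of_nat l ^ m0 * \<pi> ^ (q * N * m0))"
    by (simp add: z0_def \<mu>(3) power_mult_distrib mult_ac flip: power_mult)
  have "vle (A * of_nat \<mu>) (of_nat \<mu> * z0 ^ m0)"
  proof -
    have "vle (\<pi> ^ q) (\<pi> ^ (q * N * m0))" using N m0 by (intro vle_pi_power) auto
    then have "vle (of_nat \<mu>) (\<pi> ^ (q * N * m0))" using q vle_trans by blast
    then have "vle (of_nat \<mu>) (of_nat l ^ m0 * \<pi> ^ (q * N * m0))" by (intro vle_mult_V power_V of_nat_V)
    then show ?thesis unfolding eq by (rule vle_mult_left)
  qed
  then have lower: "vle A (z0 ^ m0)" using vle_mult_cancel[OF mu0, of A "z0 ^ m0"] by (simp add: mult.commute)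
  have "vle (z0 ^ m0) (of_nat \<mu> * z0 ^ m0)" by (intro vle_mult_V of_nat_V) simp
  moreover have "vle (of_nat \<mu> * z0 ^ m0) (A * (\<pi> ^ i * \<pi> ^ (q * N * m0)))"
    unfolding eq by (intro vle_mult i) auto
  ultimately have "vle (z0 ^ m0) (A * (\<pi> ^ i * \<pi> ^ (q * N * m0)))" by (rule vle_trans)
  then have "vle (z0 ^ m0) (\<pi> ^ (i + q * N * m0) * A)" by (simp add: power_add mult_ac)
  then have upper: "vle (z0 ^ m0) (z ^ m0)" using Az vle_trans by blast
  have "vle a (z0 ^ m)" if am': "(a, m) \<in> L" for a m
  proof -
    have km: "0 < k m" "m * k m = m0" using k am' by blast+
    have "vle (a ^ k m) (z0 ^ m0)" using vle_trans[OF am(2)[OF am'] lower[unfolded A_def]] .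
    then have "vle (a ^ k m) ((z0 ^ m) ^ k m)" by (simp add: km flip: power_mult)
    then show ?thesis using vle_power_iff km by blast
  qed
  moreover have "vle (z0 ^ m) b" if bm: "(b, m) \<in> U" for b m
  proof -
    have km: "0 < k m" "m * k m = m0" using k bm by blast+
    have "vle (z ^ m) b" using U[OF bm] by (auto dest!: spec[of _ 0])
    moreover have "vle ((z0 ^ m) ^ k m) ((z ^ m) ^ k m)" using upper by (simp add: km flip: power_mult)
    ultimately show ?thesis using vle_power_iff km vle_trans by blast
  qed
  ultimately show ?thesis using z0F sim by blast
qed

text \<open>Without lower bounds, inverting z turns the upper bounds into lower ones. The bounds b =
  0 are set aside first: they impose nothing and have no inverse.\<close>

lemma cut_realized:
  assumes F: "relclosed F" and z: "z \<noteq> 0" and N: "0 < N" and fin: "finite L" "finite U"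
    and L: "\<And>a m. (a, m) \<in> L \<Longrightarrow> a \<in> F \<and> 0 < m \<and> (\<forall>n. vle (\<pi> ^ n * a) (z ^ m))"
    and U: "\<And>b m. (b, m) \<in> U \<Longrightarrow> b \<in> F \<and> 0 < m \<and> (\<forall>n. vle (\<pi> ^ n * z ^ m) b)"
  shows "\<exists>z0\<in>F. psim N z0 z \<and> (\<forall>(a, m)\<in>L. vle a (z0 ^ m)) \<and> (\<forall>(b, m)\<in>U. vle (z0 ^ m) b)"
proof (cases "L = {}")
  case False
  show ?thesis
    by (rule cut_realized_lower[OF F z N fin False]) (use L U in blast)+
next
  case L0: True
  have Fs: "fieldset F" using F by (simp add: relclosed_def)
  define U' where "U' = {x \<in> U. fst x \<noteq> 0}"
  show ?thesis
  proof (cases "U' = {}")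
    case True
    obtain l where l: "l > 0" "psim N (of_nat l) z" using psim_nat[OF z N] by blast
    have "vle (of_nat l ^ m) b" if "(b, m) \<in> U" for b m
    proof -
      have "b = 0" using True that by (auto simp: U'_def)
      then show ?thesis by simp
    qed
    then show ?thesis using l L0 Fs by (intro bexI[of _ "of_nat l"]) (auto simp: fieldset_closed)
  next
    case False
    define L' where "L' = (\<lambda>(b, m). (inverse b, m)) ` U'"
    have "\<exists>z0\<in>F. psim N z0 (inverse z) \<and> (\<forall>(a, m)\<in>L'. vle a (z0 ^ m)) \<and> (\<forall>(b, m)\<in>{}. vle (z0 ^ m) b)"
    proof (rule cut_realized_lower[OF F _ N])
      show "finite L'" "L' \<noteq> {}" using fin False by (auto simp: L'_def U'_def)
      fix a m assume "(a, m) \<in> L'"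
      then obtain b where b: "(b, m) \<in> U" "b \<noteq> 0" "a = inverse b" by (auto simp: L'_def U'_def)
      have "vle (\<pi> ^ n * a) (inverse z ^ m)" for n
      proof -
        have "vle (\<pi> ^ n * z ^ m * (inverse b * inverse z ^ m)) (b * (inverse b * inverse z ^ m))"
          by (rule vle_mult) (use U[OF b(1)] in auto)
        moreover have "\<pi> ^ n * z ^ m * (inverse b * inverse z ^ m) = \<pi> ^ n * a"
          "b * (inverse b * inverse z ^ m) = inverse z ^ m"
          using b z by (auto simp: field_simps)
        ultimately show ?thesis by simp
      qed
      then show "a \<in> F \<and> 0 < m \<and> (\<forall>n. vle (\<pi> ^ n * a) (inverse z ^ m))"
        using U[OF b(1)] b Fs by (simp add: fieldset_closed)
    qed (use z in auto)
    then obtain y where y: "y \<in> F" "psim N y (inverse z)" "\<And>a m. (a, m) \<in> L' \<Longrightarrow> vle a (y ^ m)" by blast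
    obtain r where r: "r \<noteq> 0" "y = r ^ N * inverse z" using y(2) by (auto simp: psim_def)
    have y0: "y \<noteq> 0" using r z by simp
    have "psim N (inverse y) z" unfolding psim_def using r by (intro exI[of _ "inverse r"]) (simp add: power_inverse)
    moreover have "vle (inverse y ^ m) b" if "(b, m) \<in> U" for b m
    proof (cases "b = 0")
      case False
      then have "vle (inverse b) (y ^ m)" using y(3) that by (force simp: L'_def U'_def)
      then show ?thesis using vle_inverse[of "inverse b" "y ^ m"] False y0 by (simp add: power_inverse)
    qed simp
    ultimately show ?thesis using y(1) Fs L0 by (intro bexI[of _ "inverse y"]) (auto simp: fieldset_closed)
  qed
qed

text \<open>Of two centers the one nearer to t serves both, by \<open>center_refine\<close>.\<close>

lemma common_center:
  fixes F :: "'k set"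
  assumes F: "relclosed F" and G: "finite G" "\<And>g. g \<in> G \<Longrightarrow> polys F g"
  shows "\<exists>c\<in>F. \<exists>M. \<forall>g\<in>G. center g c (t - c) M"
  using G
proof (induction G rule: finite_induct)
  case empty
  then show ?case using F fieldset_closed(2) by (auto simp: relclosed_def)
next
  case (insert g G)
  then obtain c M where c: "c \<in> F" "\<forall>g\<in>G. center g c (t - c) M" by auto
  obtain c' M' where c': "c' \<in> F" "center g c' (t - c') M'"
    using center_exists[of F "degree g" g t] F insert.prems by (auto simp: relclosed_def)
  show ?case
  proof (cases "vle (t - c) (t - c')")
    case True
    then have "\<forall>h\<in>G. center h c' (t - c') (max M M')"
      using c(2) center_refine[OF _ _ True] center_mono by (metis add_diff_cancel_left' add_diff_eq max.cobounded1)
    then show ?thesis using c' center_mono[OF c'(2)] by (metis insertE max.cobounded2)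
  next
    case False
    then have "vle (t - c') (t - c)" using vle_total by blast
    then have "center g c (t - c) (max M M')"
      using c'(2) center_refine center_mono by (metis add_diff_cancel_left' add_diff_eq max.cobounded2)
    then show ?thesis using c center_mono by (metis insertE max.cobounded1)
  qed
qed

text \<open>Take a common center c and z = t - c. If z has the valuation of an element of F,
  approximate it closely in F and use the center to bound the change of each g. Otherwise no
  positive power of z has a valuation from F, each g has a dominant term at z, and
  \<open>cut_realized\<close> yields a z0 in F where the same terms dominate and whose class is that
  of z.\<close>

theorem relclosed_approx:
  fixes F :: "'k set"
  assumes F: "relclosed F" and G: "finite G" "\<And>g. g \<in> G \<Longrightarrow> polys F g" and N: "0 < N" and t: "t \<notin> F"
  shows "\<exists>t0\<in>F. \<forall>g\<in>G. psim N (poly g t0) (poly g t)"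
proof -
  have Fs: "fieldset F" using F by (simp add: relclosed_def)
  obtain c M where c: "c \<in> F" "\<And>g. g \<in> G \<Longrightarrow> center g c (t - c) M"
    using common_center[OF F G] by blast
  define z where "z = t - c"
  have tz: "t = c + z" by (simp add: z_def)
  have z0: "z \<noteq> 0" using t c by (auto simp: z_def)
  obtain L where L: "L > 0" "\<And>x y. y \<noteq> 0 \<Longrightarrow> near L x y \<Longrightarrow> psim N x y" using near_psim[OF N] by blast
  have gt0: "poly g t \<noteq> 0" if "g \<in> G" "g \<noteq> 0" for g
    using F that G(2)[OF that(1)] t unfolding relclosed_def roots_in_def by blast
  show ?thesis
  proof (cases "\<exists>s\<in>F. s \<noteq> 0 \<and> same z s")
    case True
    then obtain s where s: "s \<in> F" "s \<noteq> 0" "near (M + L) z s" using same_V_near[OF Fs] by blast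
    have "near (M + L) s z" using near_sym[OF s(3)] L by simp
    then have "near (M + L) (s / z) 1" using near_cancel[OF z0, of "M + L" "s / z" 1] z0 by simp
    then have sz: "vle (\<pi> ^ (M + L)) (s / z - 1)" "s / z \<in> V"
      using near_1_V L by (auto simp: near_1)
    have "psim N (poly g (c + s)) (poly g t)" if "g \<in> G" for g
    proof (cases "g = 0")
      case False
      have e: "poly (pcompose g [:c, z:]) 1 = poly g t" "poly (pcompose g [:c, z:]) (s / z) = poly g (c + s)"
        using z0 by (auto simp: poly_pcompose tz)
      have "near L (poly g (c + s)) (poly g t)"
        using poly_near[of "pcompose g [:c, z:]" 1 M "s / z" L] c(2)[OF that] sz one_V
        unfolding center_def e by (simp add: tz)
      then show ?thesis using L gt0 that False by blast
    qed simp
    then show ?thesis using s c Fs by (intro bexI[of _ "c + s"]) (auto simp: fieldset_closed)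
  next
    case nos: False
    have no: "\<not> same (z ^ m) b" if "0 < m" "b \<in> F" for m b
      using same_in_field[OF Fs, of m m b z] F nos that z0 by (auto simp: relclosed_def)
    define B where "B g = pcompose g [:c, 1:]" for g
    have B: "polys F (B g)" if "g \<in> G" for g
      unfolding B_def using G(2)[OF that] c Fs by (intro polys_pcompose) (auto simp: fieldset_closed)
    have Bp: "poly (B g) x = poly g (c + x)" for g x by (simp add: B_def poly_pcompose)
    have B0: "B g \<noteq> 0" if "g \<in> G" "g \<noteq> 0" for g
      using gt0[OF that] Bp[of g z] by (auto simp: tz)
    have "\<forall>g\<in>G - {0}. \<exists>j\<le>degree (B g). coeff (B g) j \<noteq> 0 \<and>
       (\<forall>l n. l \<noteq> j \<longrightarrow> vle (\<pi> ^ n * (coeff (B g) j * z ^ j)) (coeff (B g) l * z ^ l))"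
      using dominant_term[OF Fs B B0 z0 no] by auto
    then obtain J where J: "\<And>g. g \<in> G - {0} \<Longrightarrow> J g \<le> degree (B g)"
      "\<And>g. g \<in> G - {0} \<Longrightarrow> coeff (B g) (J g) \<noteq> 0"
      "\<And>g l n. g \<in> G - {0} \<Longrightarrow> l \<noteq> J g \<Longrightarrow>
         vle (\<pi> ^ n * (coeff (B g) (J g) * z ^ J g)) (coeff (B g) l * z ^ l)"
      by metis
    define S where "S = (SIGMA g:G - {0}. {..degree (B g)})"
    have finS: "finite S" using G by (simp add: S_def)
    \<comment> \<open>Both sets express that term \<open>J g\<close> beats term l by a factor p^L at
      the new point, solved for a positive power of that point: lower bounds for l >
      \<open>J g\<close>, upper bounds for l < \<open>J g\<close>.\<close>
    define Lo where "Lo = (\<lambda>(g, l). (\<pi> ^ L * coeff (B g) (J g) / coeff (B g) l, l - J g)) `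
       {(g, l) \<in> S. J g < l \<and> coeff (B g) l \<noteq> 0}"
    define Up where "Up = (\<lambda>(g, l). (coeff (B g) l / (\<pi> ^ L * coeff (B g) (J g)), J g - l)) `
       {(g, l) \<in> S. l < J g}"
    have cF: "coeff (B g) l \<in> F" if "g \<in> G" for g l using B[OF that] by (simp add: polys_def)
    have "\<exists>z0\<in>F. psim N z0 z \<and> (\<forall>(a, m)\<in>Lo. vle a (z0 ^ m)) \<and> (\<forall>(b, m)\<in>Up. vle (z0 ^ m) b)"
    proof (rule cut_realized[OF F z0 N])
      show "finite Lo" "finite Up" using finS by (auto simp: Lo_def Up_def intro: finite_subset)
    next
      fix a m assume "(a, m) \<in> Lo"
      then obtain g l where gl: "g \<in> G - {0}" "J g < l" "coeff (B g) l \<noteq> 0"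
        "a = \<pi> ^ L * coeff (B g) (J g) / coeff (B g) l" "m = l - J g"
        by (auto simp: Lo_def S_def)
      have "vle (\<pi> ^ n * a) (z ^ m)" for n
      proof -
        have "vle (\<pi> ^ (n + L) * (coeff (B g) (J g) * z ^ J g)) (coeff (B g) l * z ^ l)"
          using J(3) gl by simp
        moreover have "\<pi> ^ (n + L) * (coeff (B g) (J g) * z ^ J g) = (coeff (B g) l * z ^ J g) * (\<pi> ^ n * a)"
          using gl by (simp add: power_add)
        moreover have "coeff (B g) l * z ^ l = (coeff (B g) l * z ^ J g) * z ^ m"
          using gl by (simp flip: power_add)
        ultimately have "vle ((coeff (B g) l * z ^ J g) * (\<pi> ^ n * a)) ((coeff (B g) l * z ^ J g) * z ^ m)"
          by metis
        moreover have "coeff (B g) l * z ^ J g \<noteq> 0" using gl z0 by simp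
        ultimately show ?thesis using vle_mult_cancel by blast
      qed
      then show "a \<in> F \<and> 0 < m \<and> (\<forall>n. vle (\<pi> ^ n * a) (z ^ m))"
        using gl cF Fs by (auto intro!: fieldset_closed)
    next
      fix b m assume "(b, m) \<in> Up"
      then obtain g l where gl: "g \<in> G - {0}" "l < J g"
        "b = coeff (B g) l / (\<pi> ^ L * coeff (B g) (J g))" "m = J g - l"
        by (auto simp: Up_def S_def)
      have nz: "\<pi> ^ L * coeff (B g) (J g) * z ^ l \<noteq> 0" using J(2) gl z0 pi_nonzero by simp
      have "vle (\<pi> ^ n * z ^ m) b" for n
      proof -
        have "vle (\<pi> ^ (n + L) * (coeff (B g) (J g) * z ^ J g)) (coeff (B g) l * z ^ l)"
          using J(3) gl by simp
        moreover have "z ^ J g = z ^ l * z ^ m" using gl by (simp flip: power_add)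
        then have "\<pi> ^ (n + L) * (coeff (B g) (J g) * z ^ J g) = (\<pi> ^ L * coeff (B g) (J g) * z ^ l) * (\<pi> ^ n * z ^ m)"
          by (simp add: power_add)
        moreover have "coeff (B g) l * z ^ l = (\<pi> ^ L * coeff (B g) (J g) * z ^ l) * b"
          using J(2)[OF gl(1)] pi_nonzero z0 by (simp add: gl(3))
        ultimately show ?thesis using vle_mult_cancel[OF nz] by simp
      qed
      then show "b \<in> F \<and> 0 < m \<and> (\<forall>n. vle (\<pi> ^ n * z ^ m) b)"
        using gl cF Fs by (auto intro!: fieldset_closed)
    qed
    then obtain y where y: "y \<in> F" "psim N y z" "\<And>a m. (a, m) \<in> Lo \<Longrightarrow> vle a (y ^ m)"
      "\<And>b m. (b, m) \<in> Up \<Longrightarrow> vle (y ^ m) b" by blast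
    have y0: "y \<noteq> 0" using y(2) z0 by (auto simp: psim_def)
    have "psim N (poly g (c + y)) (poly g t)" if "g \<in> G" for g
    proof (cases "g = 0")
      case False
      with that have g: "g \<in> G - {0}" by simp
      let ?b = "coeff (B g)" and ?j = "J g"
      have "vle (\<pi> ^ L * (?b ?j * y ^ ?j)) (?b l * y ^ l)" if l: "l \<le> degree (B g)" "l \<noteq> ?j" for l
      proof (cases "l < ?j")
        case True
        then have "(?b l / (\<pi> ^ L * ?b ?j), ?j - l) \<in> Up" using g l by (force simp: Up_def S_def)
        then have "vle (y ^ (?j - l)) (?b l / (\<pi> ^ L * ?b ?j))" by (rule y(4))
        then have "vle (\<pi> ^ L * ?b ?j * y ^ l * y ^ (?j - l)) (\<pi> ^ L * ?b ?j * y ^ l * (?b l / (\<pi> ^ L * ?b ?j)))"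
          by (rule vle_mult_left)
        moreover have "y ^ ?j = y ^ l * y ^ (?j - l)" using True by (simp flip: power_add)
        ultimately show ?thesis using J(2)[OF g] pi_nonzero by (simp add: mult_ac)
      next
        case nl: False
        show ?thesis
        proof (cases "?b l = 0")
          case False
          then have "(\<pi> ^ L * ?b ?j / ?b l, l - ?j) \<in> Lo" using g l nl by (force simp: Lo_def S_def)
          then have "vle (\<pi> ^ L * ?b ?j / ?b l) (y ^ (l - ?j))" by (rule y(3))
          then have "vle (?b l * y ^ ?j * (\<pi> ^ L * ?b ?j / ?b l)) (?b l * y ^ ?j * y ^ (l - ?j))"
            by (rule vle_mult_left)
          moreover have "y ^ l = y ^ ?j * y ^ (l - ?j)" using nl by (simp flip: power_add)
          ultimately show ?thesis using False by (simp add: mult_ac)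
        qed simp
      qed
      then have "near L (poly (B g) y) (?b ?j * y ^ ?j)"
        unfolding poly_altdef using J(1)[OF g] by (intro dominant_near) auto
      then have 1: "psim N (poly g (c + y)) (?b ?j * y ^ ?j)"
        using L(2) J(2)[OF g] y0 by (simp add: Bp)
      have "near L (poly (B g) z) (?b ?j * z ^ ?j)"
        unfolding poly_altdef using J(1,3)[OF g] by (intro dominant_near) auto
      then have "near L (?b ?j * z ^ ?j) (poly g t)" using near_sym L(1) by (simp add: Bp tz)
      then have "psim N (?b ?j * z ^ ?j) (poly g t)" using L(2) gt0[OF that False] by blast
      moreover have "psim N (?b ?j * y ^ ?j) (?b ?j * z ^ ?j)" using y(2) by (intro psim_mult_left psim_power)
      ultimately show ?thesis using 1 psim_trans by blast
    qed simp
    then show ?thesis using y c Fs by (intro bexI[of _ "c + y"]) (auto simp: fieldset_closed)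
  qed
qed

end

section \<open>Partial maps preserving powers\<close>

text \<open>If every candidate failed at some level, all would fail at the largest of these levels.
  With S the roots of a polynomial, this selects one root that works for all precisions without a
  limit argument.\<close>

lemma finite_descending_choice:
  assumes "finite S" "\<And>n::nat. \<exists>x\<in>S. A n x" "\<And>m n x. A n x \<Longrightarrow> m \<le> n \<Longrightarrow> A m x"
  shows "\<exists>x\<in>S. \<forall>n. A n x"
proof (rule ccontr)
  assume "\<not> ?thesis"
  then obtain f where f: "\<And>x. x \<in> S \<Longrightarrow> \<not> A (f x) x" by metis
  obtain x where x: "x \<in> S" "A (Max (f ` S)) x" using assms(2) by blast
  then have "A (f x) x" using assms(1,3) by simp
  then show False using f x by blast
qed

lemma pw_divide:
  fixes a b :: "'k::field"
  assumes "b \<noteq> 0" "0 < N" shows "pw N (a / b) \<longleftrightarrow> pw N (a * b ^ (N - 1))"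
proof -
  have "a * b ^ (N - 1) = b ^ N * (a / b)" using assms by (cases N) auto
  then show ?thesis using pw_power_mult[OF assms(1)] by metis
qed

text \<open>Partial field isomorphisms that preserve powers, given by their graphs.\<close>
definition pmap :: "('k::field \<times> 'k) set \<Rightarrow> bool" where
  "pmap R \<longleftrightarrow> (1, 1) \<in> R
    \<and> (\<forall>x x' y y'. (x, x') \<in> R \<longrightarrow> (y, y') \<in> R \<longrightarrow> (x - y, x' - y') \<in> R \<and> (x * y, x' * y') \<in> R)
    \<and> (\<forall>x x'. (x, x') \<in> R \<longrightarrow> (inverse x, inverse x') \<in> R \<and> (x = 0 \<longleftrightarrow> x' = 0)
          \<and> (\<forall>N>0. pw N x \<longleftrightarrow> pw N x'))"

lemma pmap_zero_iff: "pmap R \<Longrightarrow> (x, x') \<in> R \<Longrightarrow> x = 0 \<longleftrightarrow> x' = 0"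
  and pmap_pw: "pmap R \<Longrightarrow> (x, x') \<in> R \<Longrightarrow> 0 < N \<Longrightarrow> pw N x \<longleftrightarrow> pw N x'"
  unfolding pmap_def by blast+

lemma pmap_closed:
  assumes "pmap R"
  shows "(1, 1) \<in> R" "(0, 0) \<in> R"
    "(x, x') \<in> R \<Longrightarrow> (y, y') \<in> R \<Longrightarrow> (x - y, x' - y') \<in> R"
    "(x, x') \<in> R \<Longrightarrow> (y, y') \<in> R \<Longrightarrow> (x * y, x' * y') \<in> R"
    "(x, x') \<in> R \<Longrightarrow> (inverse x, inverse x') \<in> R"
    "(x, x') \<in> R \<Longrightarrow> (- x, - x') \<in> R"
    "(x, x') \<in> R \<Longrightarrow> (y, y') \<in> R \<Longrightarrow> (x + y, x' + y') \<in> R"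
    "(x, x') \<in> R \<Longrightarrow> (y, y') \<in> R \<Longrightarrow> (x / y, x' / y') \<in> R"
    "(x, x') \<in> R \<Longrightarrow> (x ^ n, x' ^ n) \<in> R" "(of_nat m, of_nat m) \<in> R"
proof -
  have d: "(x - y, x' - y') \<in> R" and m: "(x * y, x' * y') \<in> R" and i: "(inverse x, inverse x') \<in> R"
    if "(x, x') \<in> R" "(y, y') \<in> R" for x y x' y'
    using assms that by (auto simp: pmap_def)
  show one: "(1, 1) \<in> R" using assms by (auto simp: pmap_def)
  show z: "(0, 0) \<in> R" using d[OF one one] by simp
  have u: "(- x, - x') \<in> R" if "(x, x') \<in> R" for x x' using d[OF z that] by simp
  have a: "(x + y, x' + y') \<in> R" if "(x, x') \<in> R" "(y, y') \<in> R" for x y x' y'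
    using d[OF that(1) u[OF that(2)]] by simp
  show "(of_nat m, of_nat m) \<in> R" by (induction m) (auto intro: one z a)
  show "(x, x') \<in> R \<Longrightarrow> (x ^ n, x' ^ n) \<in> R" by (induction n) (auto intro: one m)
  show "(x, x') \<in> R \<Longrightarrow> (y, y') \<in> R \<Longrightarrow> (x / y, x' / y') \<in> R"
    using m[OF _ i] by (simp add: field_class.field_divide_inverse)
  show "(x, x') \<in> R \<Longrightarrow> (- x, - x') \<in> R"
    "(x, x') \<in> R \<Longrightarrow> (y, y') \<in> R \<Longrightarrow> (x + y, x' + y') \<in> R" by (auto intro: u a)
qed (use assms in \<open>auto simp: pmap_def\<close>)

lemma pmap_Domain: "pmap R \<Longrightarrow> fieldset (Domain R)"
  unfolding fieldset_def by (meson Domain.simps pmap_closed)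

text \<open>It suffices to treat a ring: a / b differs from a b^(N-1) by an N-th power, so power
  conditions on fractions are conditions on S. The zero condition, applied to differences, makes the
  graph functional and injective.\<close>

lemma pmap_fractions:
  fixes S :: "('k::field \<times> 'k) set"
  assumes one: "(1, 1) \<in> S"
    and diff: "\<And>x x' y y'. (x, x') \<in> S \<Longrightarrow> (y, y') \<in> S \<Longrightarrow> (x - y, x' - y') \<in> S"
    and mult: "\<And>x x' y y'. (x, x') \<in> S \<Longrightarrow> (y, y') \<in> S \<Longrightarrow> (x * y, x' * y') \<in> S"
    and zero: "\<And>x x'. (x, x') \<in> S \<Longrightarrow> x = 0 \<longleftrightarrow> x' = 0"
    and pw: "\<And>x x' N. (x, x') \<in> S \<Longrightarrow> 0 < N \<Longrightarrow> pw N x \<longleftrightarrow> pw N x'"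
  shows "\<exists>R. pmap R \<and> S \<subseteq> R"
proof -
  define R where "R = {(x / y, x' / y') | x x' y y'. (x, x') \<in> S \<and> (y, y') \<in> S \<and> y \<noteq> 0}"
  have I: "(a, b) \<in> R" if "(x, x') \<in> S" "(y, y') \<in> S" "y \<noteq> 0" "a = x / y" "b = x' / y'" for a b x x' y y'
    using that unfolding R_def by blast
  have E: "\<exists>x x' y y'. a = x / y \<and> b = x' / y' \<and> (x, x') \<in> S \<and> (y, y') \<in> S \<and> y \<noteq> 0 \<and> y' \<noteq> 0"
    if "(a, b) \<in> R" for a b
    using that zero unfolding R_def by blast
  have SR: "(a, b) \<in> R" if "(a, b) \<in> S" for a b
    by (rule I[OF that one]) auto
  have power: "(x ^ n, x' ^ n) \<in> S" if "(x, x') \<in> S" for x x' n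
    by (induction n) (auto intro: one mult that)
  have "pmap R"
    unfolding pmap_def
  proof (intro conjI allI impI)
    show "(1, 1) \<in> R" by (rule SR[OF one])
  next
    fix a a' b b' assume ab: "(a, a') \<in> R" "(b, b') \<in> R"
    obtain x x' y y' where 1: "a = x / y" "a' = x' / y'"
      "(x, x') \<in> S" "(y, y') \<in> S" "y \<noteq> 0" "y' \<noteq> 0" using E[OF ab(1)] by blast
    obtain u u' v v' where 2: "b = u / v" "b' = u' / v'"
      "(u, u') \<in> S" "(v, v') \<in> S" "v \<noteq> 0" "v' \<noteq> 0" using E[OF ab(2)] by blast
    note * = 1 2
    show "(a - b, a' - b') \<in> R"
      by (rule I[OF diff[OF mult[OF *(3,10)] mult[OF *(9,4)]] mult[OF *(4,10)]])
        (use * in \<open>auto simp: diff_frac_eq\<close>)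
    show "(a * b, a' * b') \<in> R"
      by (rule I[OF mult[OF *(3,9)] mult[OF *(4,10)]]) (use * in auto)
  next
    fix a a' assume a: "(a, a') \<in> R"
    obtain x x' y y' where *: "a = x / y" "a' = x' / y'" "(x, x') \<in> S" "(y, y') \<in> S" "y \<noteq> 0" "y' \<noteq> 0"
      using E[OF a] by blast
    show "a = 0 \<longleftrightarrow> a' = 0" using * zero by auto
    show "(inverse a, inverse a') \<in> R"
    proof (cases "x = 0")
      case True
      then show ?thesis using * zero[OF *(3)] SR[OF diff[OF one one]] by simp
    next
      case False
      then show ?thesis by (intro I[OF *(4,3)]) (use * in auto)
    qed
    fix N :: nat assume N: "0 < N"
    have "pw N a \<longleftrightarrow> pw N (x * y ^ (N - 1))" using * pw_divide[OF *(5) N] by simp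
    also have "\<dots> \<longleftrightarrow> pw N (x' * y' ^ (N - 1))" by (rule pw[OF mult[OF *(3) power[OF *(4)]] N])
    also have "\<dots> \<longleftrightarrow> pw N a'" using * pw_divide[OF *(6) N] by simp
    finally show "pw N a \<longleftrightarrow> pw N a'" .
  qed
  then show ?thesis using SR by auto
qed

section \<open>Polynomials with corresponding coefficients\<close>

definition rpoly :: "('k::field \<times> 'k) set \<Rightarrow> 'k poly \<Rightarrow> 'k poly \<Rightarrow> bool" where
  "rpoly R g h \<longleftrightarrow> (\<forall>i. (coeff g i, coeff h i) \<in> R)"

lemma rpoly_pCons: "rpoly R (pCons a g) (pCons b h) \<longleftrightarrow> (a, b) \<in> R \<and> rpoly R g h"
  unfolding rpoly_def by (auto simp: coeff_pCons split: nat.splits)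

lemma rpoly_polys: "rpoly R g h \<Longrightarrow> polys (Domain R) g"
  unfolding rpoly_def polys_def by blast

context
  fixes R :: "('k::field \<times> 'k) set"
  assumes R: "pmap R"
begin

lemma rpoly_0: "rpoly R 0 0"
  using R by (simp add: rpoly_def pmap_closed)

lemma rpoly_coeff_zero_iff: "rpoly R g h \<Longrightarrow> coeff g i = 0 \<longleftrightarrow> coeff h i = 0"
  unfolding rpoly_def using pmap_zero_iff[OF R] by blast

lemma rpoly_zero_iff: "rpoly R g h \<Longrightarrow> g = 0 \<longleftrightarrow> h = 0"
  using rpoly_coeff_zero_iff by (simp add: poly_eq_iff)

lemma rpoly_degree: "rpoly R g h \<Longrightarrow> degree g = degree h"
  using rpoly_coeff_zero_iff by (simp add: degree_def)

lemma rpoly_induct [consumes 1, case_names zero pCons]: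
  assumes "rpoly R g h" "P 0 0"
    "\<And>a b g h. (a, b) \<in> R \<Longrightarrow> rpoly R g h \<Longrightarrow> P g h \<Longrightarrow> P (pCons a g) (pCons b h)"
  shows "P g h"
  using assms(1)
proof (induction g arbitrary: h)
  case 0
  then show ?case using rpoly_zero_iff assms(2) by blast
next
  case (pCons a g)
  obtain b h' where "h = pCons b h'" by (metis pCons_cases)
  then show ?case using pCons assms(3) by (simp add: rpoly_pCons)
qed

lemma rpoly_add: "rpoly R g h \<Longrightarrow> rpoly R g' h' \<Longrightarrow> rpoly R (g + g') (h + h')"
  and rpoly_diff: "rpoly R g h \<Longrightarrow> rpoly R g' h' \<Longrightarrow> rpoly R (g - g') (h - h')"
  and rpoly_smult: "rpoly R g h \<Longrightarrow> (a, b) \<in> R \<Longrightarrow> rpoly R (smult a g) (smult b h)"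
  and rpoly_pderiv: "rpoly R g h \<Longrightarrow> rpoly R (pderiv g) (pderiv h)"
  by (auto simp: rpoly_def coeff_pderiv intro!: pmap_closed[OF R] simp del: of_nat_Suc)

lemma rpoly_mult: "rpoly R g h \<Longrightarrow> rpoly R g' h' \<Longrightarrow> rpoly R (g * g') (h * h')"
  by (induction rule: rpoly_induct)
    (auto simp: rpoly_0 rpoly_pCons pmap_closed[OF R] intro!: rpoly_add rpoly_smult)

lemma rpoly_one: "rpoly R 1 1"
  unfolding one_pCons by (simp add: rpoly_pCons rpoly_0 pmap_closed[OF R])

lemma rpoly_pcompose:
  assumes "rpoly R g h" "(c, c') \<in> R" "(s, s') \<in> R"
  shows "rpoly R (pcompose g [:c, s:]) (pcompose h [:c', s':])"
  using assms(1)
  by (induction rule: rpoly_induct)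
    (auto simp: rpoly_0 pcompose_pCons rpoly_pCons assms pmap_closed[OF R] intro!: rpoly_add rpoly_smult)

lemma rpoly_poly: "rpoly R g h \<Longrightarrow> (x, x') \<in> R \<Longrightarrow> (poly g x, poly h x') \<in> R"
  by (induction rule: rpoly_induct) (auto intro!: pmap_closed[OF R])

lemma rpoly_exists: "polys (Domain R) g \<Longrightarrow> \<exists>h. rpoly R g h"
proof (induction g)
  case 0
  then show ?case using rpoly_0 by blast
next
  case (pCons a g)
  then obtain b h where "(a, b) \<in> R" "rpoly R g h"
    by (auto simp: polys_pCons[OF pmap_Domain[OF R]])
  then show ?case by (metis rpoly_pCons)
qed

lemma pmap_extend:
  assumes y: "\<And>g h. rpoly R g h \<Longrightarrow> poly g y = 0 \<longleftrightarrow> poly h y' = 0"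
    and pw: "\<And>g h N. rpoly R g h \<Longrightarrow> 0 < N \<Longrightarrow> pw N (poly g y) \<longleftrightarrow> pw N (poly h y')"
  shows "\<exists>R'. pmap R' \<and> R \<subseteq> R' \<and> (y, y') \<in> R'"
proof -
  define S where "S = {(poly g y, poly h y') | g h. rpoly R g h}"
  have I: "(a, b) \<in> S" if "rpoly R g h" "a = poly g y" "b = poly h y'" for a b g h
    using that unfolding S_def by blast
  have E: "\<exists>g h. a = poly g y \<and> b = poly h y' \<and> rpoly R g h" if "(a, b) \<in> S" for a b
    using that unfolding S_def by blast
  have "\<exists>R'. pmap R' \<and> S \<subseteq> R'"
  proof (rule pmap_fractions)
    show "(1, 1) \<in> S" by (rule I[OF rpoly_one]) auto
    show "(a - b, a' - b') \<in> S" "(a * b, a' * b') \<in> S" if ab: "(a, a') \<in> S" "(b, b') \<in> S" for a a' b b'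
    proof -
      obtain g h where "a = poly g y" "a' = poly h y'" "rpoly R g h" using E[OF ab(1)] by blast
      moreover obtain g1 h1 where "b = poly g1 y" "b' = poly h1 y'" "rpoly R g1 h1" using E[OF ab(2)] by blast
      ultimately show "(a - b, a' - b') \<in> S" "(a * b, a' * b') \<in> S"
        using I[OF rpoly_diff, of g h g1 h1] I[OF rpoly_mult, of g h g1 h1] by simp_all
    qed
    fix a a' assume "(a, a') \<in> S"
    then obtain g h where g: "a = poly g y" "a' = poly h y'" "rpoly R g h" using E by blast
    show "a = 0 \<longleftrightarrow> a' = 0" unfolding g(1,2) by (rule y[OF g(3)])
    show "pw N a \<longleftrightarrow> pw N a'" if "0 < N" for N unfolding g(1,2) by (rule pw[OF g(3) that])
  qed
  then obtain R' where R': "pmap R'" "S \<subseteq> R'" by blast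
  have "R \<subseteq> S"
  proof (rule subrelI)
    fix a b assume "(a, b) \<in> R"
    then show "(a, b) \<in> S" by (intro I[of "[:a:]" "[:b:]"]) (auto simp: rpoly_pCons rpoly_0)
  qed
  moreover have "(y, y') \<in> S"
    by (rule I[of "[:0, 1:]" "[:0, 1:]"]) (auto simp: rpoly_pCons rpoly_0 pmap_closed[OF R])
  ultimately show ?thesis using R' by blast
qed

text \<open>Division with remainder carried out on both sides at once, in Horner's form: after each
  shift a multiple of g cancels the coefficient of degree d. Thus the two remainders
  correspond.\<close>

lemma rpoly_reduce:
  assumes g: "rpoly R g g'" "poly g y = 0" "poly g' y' = 0" and d: "degree g = d" "0 < d"
    and q: "rpoly R q q'"
  shows "\<exists>r r'. rpoly R r r' \<and> degree r < d \<and> poly q y = poly r y \<and> poly q' y' = poly r' y'"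
  using q
proof (induction rule: rpoly_induct)
  case zero
  then show ?case using rpoly_0 d by (intro exI[of _ 0]) auto
next
  case (pCons a b q q')
  then obtain r r' where r: "rpoly R r r'" "degree r < d" "poly q y = poly r y" "poly q' y' = poly r' y'"
    by blast
  define t where "t = coeff (pCons a r) d / coeff g d"
  define t' where "t' = coeff (pCons b r') d / coeff g' d"
  have ab: "rpoly R (pCons a r) (pCons b r')" using pCons r by (simp add: rpoly_pCons)
  have t: "(t, t') \<in> R"
    unfolding t_def t'_def using ab g(1) by (intro pmap_closed(8)[OF R]) (auto simp: rpoly_def)
  have rp: "rpoly R (pCons a r - smult t g) (pCons b r' - smult t' g')"
    by (intro rpoly_diff rpoly_smult ab g t)
  have lc: "coeff g d \<noteq> 0" using d leading_coeff_0_iff[of g] by auto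
  have "degree (pCons a r - smult t g) \<le> d"
    using r(2) d by (intro degree_diff_le) (auto simp: degree_pCons_eq_if)
  moreover have "coeff (pCons a r - smult t g) d = 0" using lc by (simp add: t_def)
  ultimately have "degree (pCons a r - smult t g) < d"
    using eq_zero_or_degree_less d(2) by (metis degree_0)
  then show ?case using rp r g
    by (intro exI[of _ "pCons a r - smult t g"] exI[of _ "pCons b r' - smult t' g'"]) simp
qed

text \<open>By \<open>rpoly_reduce\<close> only remainders of degree below d matter. Their
  nonvanishing at y and y' takes the place of irreducibility of g.\<close>

lemma pmap_extend_algebraic:
  assumes g: "rpoly R g g'" "poly g y = 0" "poly g' y' = 0" and d: "degree g = d" "0 < d"
    and q: "\<And>q q'. rpoly R q q' \<Longrightarrow> q \<noteq> 0 \<Longrightarrow> degree q < d \<Longrightarrow> poly q y \<noteq> 0 \<and> poly q' y' \<noteq> 0 \<and>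
       (\<forall>N>0. pw N (poly q y) \<longleftrightarrow> pw N (poly q' y'))"
  shows "\<exists>R'. pmap R' \<and> R \<subseteq> R' \<and> (y, y') \<in> R'"
proof (rule pmap_extend)
  fix h h' assume "rpoly R h h'"
  then obtain r r' where r: "rpoly R r r'" "degree r < d" "poly h y = poly r y" "poly h' y' = poly r' y'"
    using rpoly_reduce[OF g d] by blast
  show "poly h y = 0 \<longleftrightarrow> poly h' y' = 0" "\<And>N. 0 < N \<Longrightarrow> pw N (poly h y) \<longleftrightarrow> pw N (poly h' y')"
    using q[OF r(1) _ r(2)] rpoly_zero_iff[OF r(1)] r(3,4) by (cases "r = 0"; simp)+
qed

end

section \<open>Valuations and approximation under power-preserving maps\<close>

context pclosed
begin

text \<open>For x in V the correction p^3 x^4 is divisible by 4 p, also when p = 2, so Hensel's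
  lemma gives a square root. Otherwise p^3 x^4 dominates 1 and has valuation 3 + 4 v x, which is
  odd.\<close>

lemma V_iff_square: "x \<in> V \<longleftrightarrow> pw 2 (1 + \<pi> ^ 3 * x ^ 4)"
proof
  assume x: "x \<in> V"
  have two: "vle (of_nat 2) \<pi>"
  proof (cases "p = 2")
    case False
    then have "\<not> p dvd 2" using primes_dvd_imp_eq[OF prime_p two_is_prime_nat] by blast
    then have "vle (of_nat 2) 1" by (rule coprime_unit)
    then show ?thesis using vle_mult_right[of "of_nat 2" 1 \<pi>] of_nat_V by simp
  qed simp
  have "vle (\<pi> * of_nat 2 ^ 2) (\<pi> * \<pi> ^ 2)" by (intro vle_mult_left vle_power two)
  then have "vle (\<pi> * of_nat 2 ^ 2) (\<pi> * \<pi> ^ 2 * x ^ 4)"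
    by (rule vle_mult_right) (intro power_V x)
  also have "\<pi> * \<pi> ^ 2 * x ^ 4 = (1 + \<pi> ^ 3 * x ^ 4) - 1" by (simp add: power2_eq_square power3_eq_cube mult.assoc)
  finally show "pw 2 (1 + \<pi> ^ 3 * x ^ 4)" using power_root[of 2] by (simp add: pw_def)
next
  assume "pw 2 (1 + \<pi> ^ 3 * x ^ 4)"
  then obtain z where z: "z ^ 2 = 1 + \<pi> ^ 3 * x ^ 4" by (auto simp: pw_def)
  show "x \<in> V"
  proof (rule ccontr)
    assume nx: "x \<notin> V"
    define y where "y = inverse x"
    have x0: "x \<noteq> 0" using nx zero_V by blast
    have yV: "y \<in> V" using inverse_V nx by (simp add: y_def)
    have "\<not> vle y 1" using nx x0 by (simp add: vle_iff y_def divide_inverse)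
    then have "vle \<pi> y" using unit_or_pi[OF yV] by blast
    then have y4: "vle (\<pi> ^ 4) (y ^ 4)" by (rule vle_power)
    \<comment> \<open>Multiplying by y^4 clears the denominators: the square of w would then have
      valuation exactly 3, between those of p^2 and p^4.\<close>
    define w where "w = y ^ 2 * z"
    have "w ^ 2 = y ^ 4 * z ^ 2" by (simp add: w_def power_mult_distrib)
    also have "\<dots> = y ^ 4 + \<pi> ^ 3" using x0 by (simp add: z y_def algebra_simps power_inverse)
    finally have w: "w ^ 2 = y ^ 4 + \<pi> ^ 3" .
    have "near 1 (w ^ 2) (\<pi> ^ 3)" using y4 unfolding near_def w by (simp flip: power_Suc)
    then have s: "same (w ^ 2) (\<pi> ^ 3)" by (rule near_same) simp
    show False
    proof (cases "vle (\<pi> ^ 2) w")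
      case True
      then have "vle ((\<pi> ^ 2) ^ 2) (w ^ 2)" by (rule vle_power)
      then have "vle (\<pi> ^ 4) (\<pi> ^ 3)" using s vle_trans by (auto simp: same_def simp flip: power_mult)
      then show False by (simp add: vle_pi_power_iff)
    next
      case False
      then have "vle (\<pi> * w) (\<pi> * \<pi>)" using not_vle by (simp add: power2_eq_square)
      then have "vle w \<pi>" using pi_nonzero by (simp add: vle_mult_cancel)
      then have "vle (w ^ 2) (\<pi> ^ 2)" by (rule vle_power)
      then have "vle (\<pi> ^ 3) (\<pi> ^ 2)" using s vle_trans by (auto simp: same_def)
      then show False by (simp add: vle_pi_power_iff)
    qed
  qed
qed

text \<open>By \<open>V_iff_square\<close>, membership in V is a power condition on an expression in
  x.\<close>

lemma pmap_V:
  assumes "pmap R" "(x, x') \<in> R" shows "x \<in> V \<longleftrightarrow> x' \<in> V"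
  unfolding V_iff_square using assms
  by (intro pmap_pw[OF assms(1)] pmap_closed[OF assms(1)])
    (auto intro!: pmap_closed[OF assms(1)] simp: assms)

lemma pmap_vle:
  assumes R: "pmap R" and x: "(x, x') \<in> R" "(y, y') \<in> R" shows "vle x y \<longleftrightarrow> vle x' y'"
proof (cases "x = 0")
  case True
  then show ?thesis using pmap_zero_iff[OF R x(1)] pmap_zero_iff[OF R x(2)] by simp
next
  case False
  then have "x' \<noteq> 0" using pmap_zero_iff[OF R x(1)] by simp
  then show ?thesis using False pmap_V[OF R pmap_closed(8)[OF R x(2,1)]] by (simp add: vle_iff)
qed

lemma pmap_cont:
  assumes R: "pmap R" and x: "(a, a') \<in> R" "rpoly R g g'" shows "cont a g \<longleftrightarrow> cont a' g'"
  using x pmap_vle[OF R x(1)] unfolding cont_def rpoly_def by blast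

text \<open>One Newton step, where precision N + L makes the quadratic Taylor term negligible. The
  right-hand side is an expression in r alone, so it has a counterpart under a partial isomorphism
  even when the root u does not.\<close>

lemma newton_approx:
  assumes G: "cont e G" "e \<noteq> 0" and u: "poly G u = 0" "u \<in> V" "r \<in> V"
    and ur: "vle (\<pi> ^ (N + L)) (u - r)" and d: "vle (poly (pderiv G) r) (\<pi> ^ N * e)" and L: "0 < L"
  shows "near L (u - r) (- poly G r / poly (pderiv G) r)"
proof -
  let ?d = "poly (pderiv G) r"
  obtain w where w: "vle e w" "poly G u = poly G r + (u - r) * ?d + (u - r)^2 * w"
    using taylor2_poly[OF G(1) u(2,3)] by blast
  have d0: "?d \<noteq> 0" using d G(2) pi_nonzero by auto
  have "vle (\<pi> ^ L * ?d) (\<pi> ^ L * (\<pi> ^ N * e))" by (rule vle_mult_left[OF d])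
  moreover have "vle (\<pi> ^ (N + L) * e) ((u - r) * w)" by (rule vle_mult[OF ur w(1)])
  ultimately have "vle (\<pi> ^ L * ?d) ((u - r) * w)" using vle_trans by (simp add: power_add mult_ac)
  then have "near L (?d + (u - r) * w) ?d" by (simp add: near_def)
  then have "near L ((u - r) / ?d * (?d + (u - r) * w)) ((u - r) / ?d * ?d)" by (rule near_mult_left)
  moreover have "(u - r) / ?d * (?d + (u - r) * w) = - poly G r / ?d"
    using w(2) u(1) d0 by (simp add: field_simps power2_eq_square eq_neg_iff_add_eq_0)
  ultimately have "near L (- poly G r / ?d) (u - r)" using d0 by simp
  then show ?thesis using near_sym L by blast
qed

text \<open>Near a center c of q, replacing y - c by a close s in F hardly changes q y. The center
  inequality can be restated with elements of F only, hence transfers to q', where it shows that q'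
  y' is close to the image of the approximation.\<close>

lemma approx_eval:
  assumes R: "pmap R" and F: "F = Domain R" "roots_in n F" and y: "y \<notin> F"
    and approx: "\<And>a a' L. (a, a') \<in> R \<Longrightarrow> \<exists>s s'. (s, s') \<in> R \<and> near L (y - a) s \<and> near L (y' - a') s'"
    and q: "rpoly R q q'" "q \<noteq> 0" "degree q \<le> n"
  shows "poly q y \<noteq> 0 \<and> poly q' y' \<noteq> 0 \<and> (\<forall>N>0. pw N (poly q y) \<longleftrightarrow> pw N (poly q' y'))"
proof -
  have Fs: "fieldset F" using pmap_Domain[OF R] F by simp
  have qF: "polys F q" using rpoly_polys[OF q(1)] F by simp
  have qy: "poly q y \<noteq> 0" using F(2) q qF y unfolding roots_in_def by blast
  obtain c M where c: "c \<in> F" "center q c (y - c) M" using center_exists[OF Fs F(2) qF q(3)] by blast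
  then obtain c' where cc: "(c, c') \<in> R" using F by blast
  have *: "\<exists>Q0 Q0'. (Q0, Q0') \<in> R \<and> near (Suc L) Q0 (poly q y) \<and> near (Suc L) (poly q' y') Q0'" for L
  proof -
    define z where "z = y - c"
    have z0: "z \<noteq> 0" using y c by (auto simp: z_def)
    obtain s s' where s: "(s, s') \<in> R" "near (M + Suc L) z s" "near (M + Suc L) (y' - c') s'"
      using approx[OF cc, of "M + Suc L"] z_def by blast
    have s0: "s \<noteq> 0" using near_0_iff[OF s(2)] z0 by simp
    then have s0': "s' \<noteq> 0" using pmap_zero_iff[OF R s(1)] by simp
    define w w' where "w = z / s" and "w' = (y' - c') / s'"
    have w: "near (M + Suc L) w 1" "near (M + Suc L) w' 1"
      using near_cancel[OF s0, of _ w 1] near_cancel[OF s0', of _ w' 1] s s0 s0' by (auto simp: w_def w'_def)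
    then have wV: "w \<in> V" "w' \<in> V" using near_1_V by auto
    define Q Q' where "Q = pcompose q [:c, s:]" and "Q' = pcompose q' [:c', s':]"
    have RQ: "rpoly R Q Q'" unfolding Q_def Q'_def by (rule rpoly_pcompose[OF R q(1) cc s(1)])
    have Qy: "poly Q w = poly q y" "poly Q' w' = poly q' y'"
      using s0 s0' by (auto simp: Q_def Q'_def w_def w'_def z_def poly_pcompose)
    have "Q = pcompose (pcompose q [:c, z:]) [:0, s / z:]"
      using z0 by (simp add: Q_def pcompose_assoc[symmetric] pcompose_linear_linear)
    then have QQ: "smult (\<pi> ^ M) Q = pcompose (smult (\<pi> ^ M) (pcompose q [:c, z:])) [:0, s / z:]"
      by (simp add: pcompose_smult)
    have "same z s" using near_same[OF s(2)] by simp
    then have "s / z \<in> V" using z0 by (simp add: same_def vle_iff)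
    then have "cont (poly q y) (smult (\<pi> ^ M) Q)"
      using c(2) unfolding QQ center_def z_def by (intro cont_pcompose zero_V) auto
    then have 1: "near (Suc L) (poly Q 1) (poly q y)"
      using poly_near[of Q w M 1 "Suc L"] Qy wV one_V w vle_diff_commute by (simp add: near_1)
    then have "same (poly Q 1) (poly q y)" using near_same by blast
    \<comment> \<open>The value at y is exchanged for the nearby value of Q at 1, which lies in the
      domain of R; only then can \<open>pmap_cont\<close> be applied.\<close>
    then have "cont (poly Q 1) (smult (\<pi> ^ M) Q)"
      using \<open>cont (poly q y) _\<close> vle_trans unfolding cont_def same_def by blast
    moreover have Q1: "(poly Q 1, poly Q' 1) \<in> R" by (rule rpoly_poly[OF R RQ pmap_closed(1)[OF R]])
    moreover have "rpoly R (smult (\<pi> ^ M) Q) (smult (\<pi> ^ M) Q')"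
      by (intro rpoly_smult[OF R RQ] pmap_closed[OF R])
    ultimately have "cont (poly Q' 1) (smult (\<pi> ^ M) Q')" using pmap_cont[OF R] by blast
    then have "near (Suc L) (poly q' y') (poly Q' 1)"
      using poly_near[of Q' 1 M w' "Suc L"] Qy wV one_V w by (simp add: near_1)
    then show ?thesis using 1 Q1 by blast
  qed
  obtain Q0 Q0' where Q0: "(Q0, Q0') \<in> R" "near (Suc 0) Q0 (poly q y)" "near (Suc 0) (poly q' y') Q0'"
    using *[of 0] by blast
  have "poly q' y' \<noteq> 0"
    using near_0_iff[OF Q0(2)] near_0_iff[OF Q0(3)] qy pmap_zero_iff[OF R Q0(1)] by simp
  moreover have "pw N (poly q y) \<longleftrightarrow> pw N (poly q' y')" if N: "0 < N" for N
  proof -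
    obtain L where L: "L > 0" "\<And>x y. near L x y \<Longrightarrow> pw N x \<longleftrightarrow> pw N y" using near_pw[OF N] by blast
    obtain Q0 Q0' where "(Q0, Q0') \<in> R" "near (Suc L) Q0 (poly q y)" "near (Suc L) (poly q' y') Q0'"
      using *[of L] by blast
    then show ?thesis using L(2) near_mono pmap_pw[OF R] N by (meson le_SucI order_refl)
  qed
  ultimately show ?thesis using qy by blast
qed

text \<open>H is scaled by y - c and has coefficients outside F; G is scaled by an approximation s
  in F. Let e be a smallest coefficient of G of positive degree. As u is a root of G, the constant
  coefficient is bounded by e as well. The derivative bound passes from H at 1 to G at u and then to
  1, because u is within p^(N + 1) of 1.\<close>

lemma localize_root:
  assumes g: "poly g y = 0" "g \<noteq> 0" and H: "H = pcompose g [:c, y - c:]"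
    and N: "\<And>j. j > 0 \<Longrightarrow> vle (poly (pderiv H) 1) (\<pi> ^ N * coeff H j)"
    and s: "near (Suc N) (y - c) s" "s \<noteq> 0" and G: "G = pcompose g [:c, s:]"
  shows "\<exists>i. coeff G i \<noteq> 0 \<and> cont (coeff G i) G \<and> vle (poly (pderiv G) 1) (\<pi> ^ N * coeff G i)"
proof -
  define u where "u = (y - c) / s"
  have u: "near (Suc N) u 1" using near_cancel[OF s(2), of _ u 1] s by (simp add: u_def)
  then have uV: "u \<in> V" using near_1_V by simp
  have u1: "vle u 1" using near_same[OF u] by (simp add: same_def)
  have Gu: "poly G u = 0" using g s by (simp add: G poly_pcompose u_def)
  have HG: "H = pcompose G [:0, u:]"
    using s by (simp add: H G pcompose_assoc[symmetric] pcompose_linear_linear u_def)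
  have G0: "G \<noteq> 0"
  proof
    assume "G = 0"
    have "g = pcompose G [:- c / s, 1 / s:]"
      using s by (simp add: G pcompose_assoc[symmetric] pcompose_linear_linear)
    then show False using g \<open>G = 0\<close> by simp
  qed
  define I where "I = {1..Suc (degree G)}"
  obtain i where i: "i \<in> I" "\<And>j. j \<in> I \<Longrightarrow> vle (coeff G i) (coeff G j)"
    using vle_min[of I "coeff G"] by (auto simp: I_def)
  define e where "e = coeff G i"
  have ej: "vle e (coeff G j)" if "j > 0" for j
    using i(2)[of j] that by (cases "j \<le> Suc (degree G)") (auto simp: e_def I_def coeff_eq_0)
  have "poly G u = coeff G 0 + (\<Sum>j=1..degree G. coeff G j * u ^ j)"
    by (simp add: poly_altdef atMost_atLeast0 sum.atLeast_Suc_atMost)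
  then have "coeff G 0 = - (\<Sum>j=1..degree G. coeff G j * u ^ j)"
    using Gu by (simp add: eq_neg_iff_add_eq_0)
  moreover have "vle e (\<Sum>j=1..degree G. coeff G j * u ^ j)"
    by (intro vle_sum vle_mult_right power_V uV ej) auto
  ultimately have "vle e (coeff G 0)" by simp
  then have eG: "cont e G" using ej unfolding cont_def by (metis gr0I)
  then have e0: "e \<noteq> 0" using G0 by (auto simp: cont_def poly_eq_iff)
  have "pderiv H = smult u (pcompose (pderiv G) [:0, u:])"
    by (simp add: HG pderiv_pcompose pderiv_pCons)
  then have "poly (pderiv H) 1 = u * poly (pderiv G) u" by (simp add: poly_pcompose)
  then have "vle (poly (pderiv G) u) (poly (pderiv H) 1)" using uV by (simp add: vle_mult_V)
  moreover have "vle (poly (pderiv H) 1) (\<pi> ^ N * coeff H i)" using N i(1) by (simp add: I_def)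
  moreover have "vle (\<pi> ^ N * coeff H i) (\<pi> ^ N * e)"
  proof -
    have "vle (u ^ i * coeff G i) (1 ^ i * coeff G i)" by (intro vle_mult vle_power u1) simp
    then show ?thesis by (simp add: HG coeff_pcompose_linear e_def vle_mult_left)
  qed
  ultimately have d: "vle (poly (pderiv G) u) (\<pi> ^ N * e)" using vle_trans by blast
  have "vle (e * (1 - u)) (poly (pderiv G) 1 - poly (pderiv G) u)"
    by (rule poly_diff_vle[OF cont_pderiv[OF eG] one_V uV])
  moreover have "vle (\<pi> * (\<pi> ^ N * e)) (e * (1 - u))"
    using vle_mult_left[OF u[unfolded near_1], of e] vle_diff_commute vle_minus_iff[of _ "e * (1 - u)"]
    by (simp add: mult_ac right_diff_distrib)
  ultimately have "vle (poly (pderiv G) 1) (\<pi> ^ N * e)"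
    using vle_perturb[OF d] vle_trans e0 pi_nonzero by (metis mult_eq_0_iff power_not_zero)
  then show ?thesis using eG e0 unfolding e_def by blast
qed

end

section \<open>Algebraic extensions of power-preserving maps\<close>

context pclosed
begin

text \<open>The image \<open>y'\<close> of \<open>y\<close> is found by Hensel's lemma; passing to a single root \<open>y'\<close> that works for all
  precisions makes the valuations of \<open>y - a\<close> and \<open>y' - a'\<close> correspond for every \<open>a \<in> F\<close>.\<close>
lemma extend_unramified:
  assumes R: "pmap R" and F: "F = Domain R" "roots_in n F" and g: "rpoly R g g'" "g \<noteq> 0" "degree g = Suc n"
    and y: "poly g y = 0" "y \<notin> F" and c: "(c, c') \<in> R" and H: "H = pcompose g [:c, y - c:]"
    and N: "\<And>j. j > 0 \<Longrightarrow> vle (poly (pderiv H) 1) (\<pi> ^ N * coeff H j)"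
    and s0: "s0 \<in> F" "s0 \<noteq> 0" "same (y - c) s0"
  shows "\<exists>R' y'. pmap R' \<and> R \<subseteq> R' \<and> (y, y') \<in> R'"
proof -
  have Fs: "fieldset F" using pmap_Domain[OF R] F by simp
  define S where "S = {x. poly g' x = 0}"
  have g': "g' \<noteq> 0" using rpoly_zero_iff[OF R g(1)] g by simp
  have "\<exists>y'\<in>S. \<forall>L. \<exists>s s'. (s, s') \<in> R \<and> s \<noteq> 0 \<and> near L (y - c) s \<and> near L (y' - c') s'"
  proof (rule finite_descending_choice)
    show "finite S" unfolding S_def using g' by (rule poly_roots_finite)
  next
    fix m n x
    assume "\<exists>s s'. (s, s') \<in> R \<and> s \<noteq> 0 \<and> near n (y - c) s \<and> near n (x - c') s'" "m \<le> n"
    then show "\<exists>s s'. (s, s') \<in> R \<and> s \<noteq> 0 \<and> near m (y - c) s \<and> near m (x - c') s'"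
      using near_mono by blast
  next
    fix L
    \<comment> \<open>The precision that \<open>newton\<close> asks for with derivative error N, so
      that the root u' lies within p^L of 1.\<close>
    define M where "M = 2 * N + 1 + L"
    obtain s where s: "s \<in> F" "s \<noteq> 0" "near M (y - c) s"
      using same_V_near[OF Fs s0(1,3,2)] by blast
    then obtain s' where ss: "(s, s') \<in> R" using F by blast
    define G G' where "G = pcompose g [:c, s:]" and "G' = pcompose g' [:c', s':]"
    have RG: "rpoly R G G'" unfolding G_def G'_def by (rule rpoly_pcompose[OF R g(1) c ss])
    have "near (Suc N) (y - c) s" using s(3) by (rule near_mono) (simp add: M_def)
    from localize_root[OF y(1) g(2) H N this s(2) G_def]
    obtain i where i: "coeff G i \<noteq> 0" "cont (coeff G i) G" "vle (poly (pderiv G) 1) (\<pi> ^ N * coeff G i)"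
      by blast
    define e e' where "e = coeff G i" and "e' = coeff G' i"
    have Re: "(e, e') \<in> R" using RG by (simp add: rpoly_def e_def e'_def)
    define u where "u = (y - c) / s"
    have u: "near M u 1" using near_cancel[OF s(2), of _ u 1] s by (simp add: u_def)
    then have uV: "u \<in> V" using near_1_V by (simp add: M_def)
    have "poly G u = 0" using y s by (simp add: G_def poly_pcompose u_def)
    then have "vle (e * (u - 1)) (poly G 1)"
      using poly_diff_vle[OF i(2) uV one_V] by (simp add: e_def)
    moreover have "vle (e * \<pi> ^ M) (e * (u - 1))" using u by (simp add: near_1 vle_mult_left)
    ultimately have "vle (e * \<pi> ^ M) (poly G 1)" by (rule vle_trans[rotated])
    then have "vle (\<pi> ^ M * e) (poly G 1)" by (simp only: mult.commute)
    then have G1: "vle (\<pi> ^ M * e') (poly G' 1)"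
      using pmap_vle[OF R] Re rpoly_poly[OF R RG] pmap_closed[OF R] by (meson)
    have "vle (poly (pderiv G') 1) (\<pi> ^ N * e')"
      using pmap_vle[OF R] i(3) Re rpoly_poly[OF R rpoly_pderiv[OF R RG]] pmap_closed[OF R]
      unfolding e_def by meson
    moreover have "cont e' G'" using pmap_cont[OF R Re RG] i(2) by (simp add: e_def)
    moreover have "e' \<noteq> 0" using pmap_zero_iff[OF R Re] i(1) by (simp add: e_def)
    ultimately obtain u' where u': "poly G' u' = 0" "vle (\<pi> ^ (N + 1 + L)) (u' - 1)"
      using newton[of e' G' N L] G1 unfolding M_def by blast
    have "near (N + 1 + L) u' 1" using u' by (simp add: near_1)
    then have "near (N + 1 + L) (s' * u') s'" using near_mult_left[of _ u' 1 s'] by simp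
    then have "near L (c' + s' * u' - c') s'" using near_mono by simp
    moreover have "near L (y - c) s" using s(3) by (rule near_mono) (simp add: M_def)
    moreover have "c' + s' * u' \<in> S" using u' by (simp add: S_def G'_def poly_pcompose mult.commute)
    ultimately show "\<exists>y'\<in>S. \<exists>s s'. (s, s') \<in> R \<and> s \<noteq> 0 \<and> near L (y - c) s \<and> near L (y' - c') s'"
      using ss s(2) by blast
  qed
  then obtain y' where y': "poly g' y' = 0"
    "\<And>L. \<exists>s s'. (s, s') \<in> R \<and> s \<noteq> 0 \<and> near L (y - c) s \<and> near L (y' - c') s'"
    unfolding S_def by blast
  have approx: "\<exists>s s'. (s, s') \<in> R \<and> near L (y - a) s \<and> near L (y' - a') s'" if a: "(a, a') \<in> R" for a a' L
  proof -
    \<comment> \<open>K covers both N + \<open>Suc L\<close>, the precision of a Newton step, and N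
      + 1, which carries the derivative bound from 1 to r.\<close>
    define K where "K = N + 1 + Suc L"
    obtain s s' where s: "(s, s') \<in> R" "s \<noteq> 0" "near (K + Suc L) (y - c) s" "near (K + Suc L) (y' - c') s'"
      using y'(2) by blast
    have s0': "s' \<noteq> 0" using pmap_zero_iff[OF R s(1)] s by simp
    define G G' where "G = pcompose g [:c, s:]" and "G' = pcompose g' [:c', s':]"
    have RG: "rpoly R G G'" unfolding G_def G'_def by (rule rpoly_pcompose[OF R g(1) c s(1)])
    have "near (Suc N) (y - c) s" using s(3) by (rule near_mono) (simp add: K_def)
    from localize_root[OF y(1) g(2) H N this s(2) G_def]
    obtain i where i: "coeff G i \<noteq> 0" "cont (coeff G i) G" "vle (poly (pderiv G) 1) (\<pi> ^ N * coeff G i)"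
      by blast
    define e e' where "e = coeff G i" and "e' = coeff G' i"
    have Re: "(e, e') \<in> R" using RG by (simp add: rpoly_def e_def e'_def)
    define u u' where "u = (y - c) / s" and "u' = (y' - c') / s'"
    have u: "near (K + Suc L) u 1" "near (K + Suc L) u' 1"
      using near_cancel[OF s(2), of _ u 1] near_cancel[OF s0', of _ u' 1] s s0' by (auto simp: u_def u'_def)
    then have uV: "u \<in> V" "u' \<in> V" using near_1_V by auto
    have Gu: "poly G u = 0" "poly G' u' = 0"
      using y y' s s0' by (auto simp: G_def G'_def poly_pcompose u_def u'_def)
    define r r' where "r = (a - c) / s" and "r' = (a' - c') / s'"
    have Rr: "(r, r') \<in> R" unfolding r_def r'_def by (intro pmap_closed[OF R] a c s)
    have ya: "y - a = s * (u - r)" "y' - a' = s' * (u' - r')"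
      using s s0' by (auto simp: u_def r_def u'_def r'_def field_simps)
    have Rpi: "(\<pi> ^ k, \<pi> ^ k) \<in> R" for k by (intro pmap_closed[OF R])
    have R1: "(1, 1) \<in> R" by (rule pmap_closed[OF R])
    \<comment> \<open>In units of s the roots are u and u', both very close to 1, and a becomes r.
      If r is not close to 1, then 1 - r approximates u - r; if it is, a Newton step from r does.
      Both approximations are expressions over F, and the case distinction itself transfers along
      R.\<close>
    show ?thesis
    proof (cases "vle (\<pi> ^ K) (r - 1)")
      case False
      have "\<not> vle (\<pi> ^ K) (r' - 1)"
        using False pmap_vle[OF R Rpi pmap_closed(3)[OF R Rr R1], of K] by simp
      have *: "near L (s * (u - r)) (s * (1 - r))" if "\<not> vle (\<pi> ^ K) (r - 1)" "near (K + Suc L) u 1" for s u r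
      proof -
        have "vle (r - 1) (\<pi> ^ K)" using that vle_total by blast
        then have "vle (1 - r) (\<pi> ^ K)" using vle_minus_iff2[of "r - 1"] by simp
        then have "vle (\<pi> ^ Suc L * (1 - r)) (\<pi> ^ Suc L * \<pi> ^ K)" by (rule vle_mult_left)
        moreover have "vle (\<pi> ^ Suc L * \<pi> ^ K) (u - 1)"
          using that(2) unfolding near_1 by (simp only: power_add mult.commute)
        ultimately have "vle (\<pi> ^ Suc L * (1 - r)) (u - 1)" by (rule vle_trans)
        then have "near (Suc L) (u - r) (1 - r)" by (simp add: near_def)
        then show ?thesis using near_mono near_mult_left by (meson le_SucI order_refl)
      qed
      have "(s * (1 - r), s' * (1 - r')) \<in> R" by (intro pmap_closed[OF R] s Rr)
      then show ?thesis using *[OF False u(1)] *[OF \<open>\<not> vle (\<pi> ^ K) (r' - 1)\<close> u(2)] ya by metis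
    next
      case True
      have True': "vle (\<pi> ^ K) (r' - 1)"
        using True pmap_vle[OF R Rpi pmap_closed(3)[OF R Rr R1], of K] by simp
      have *: "near L (s * (u - r)) (s * (- poly G r / poly (pderiv G) r))"
        if G: "cont e G" "e \<noteq> 0" "vle (poly (pderiv G) 1) (\<pi> ^ N * e)" "poly G u = 0"
          and r: "vle (\<pi> ^ K) (r - 1)" and u: "near (K + Suc L) u 1" for s u r G e
      proof -
        have "near K r 1" using r by (simp add: near_1)
        then have rV: "r \<in> V" using near_1_V by (simp add: K_def)
        have uV: "u \<in> V" using u near_1_V by simp
        have "vle (\<pi> ^ K) (u - 1)" using near_mono[OF u, of K] by (simp add: near_1)
        then have "vle (\<pi> ^ K) (u - r)" using r vle_diff[of "\<pi> ^ K" "u - 1" "r - 1"] by simp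
        moreover have "vle (\<pi> ^ (N + Suc L)) (\<pi> ^ K)" by (rule vle_pi_power) (simp add: K_def)
        ultimately have ur: "vle (\<pi> ^ (N + Suc L)) (u - r)" using vle_trans by blast
        have "vle (\<pi> ^ Suc N) (\<pi> ^ K)" by (rule vle_pi_power) (simp add: K_def)
        then have "vle (\<pi> ^ Suc N) (r - 1)" using r vle_trans by blast
        then have "vle (e * \<pi> ^ Suc N) (e * (r - 1))" by (rule vle_mult_left)
        from vle_trans[OF this poly_diff_vle[OF cont_pderiv[OF G(1)] rV one_V]]
        have "vle (\<pi> * (\<pi> ^ N * e)) (poly (pderiv G) r - poly (pderiv G) 1)" by (simp add: mult_ac)
        then have "vle (poly (pderiv G) r) (\<pi> ^ N * e)"
          using vle_perturb[OF G(3)] G(2) pi_nonzero by simp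
        from newton_approx[OF G(1,2,4) uV rV ur this]
        have "near (Suc L) (u - r) (- poly G r / poly (pderiv G) r)" by simp
        then show ?thesis using near_mono near_mult_left by (meson le_SucI order_refl)
      qed
      have Rd: "(s * (- poly G r / poly (pderiv G) r), s' * (- poly G' r' / poly (pderiv G') r')) \<in> R"
        by (intro pmap_closed[OF R] s rpoly_poly[OF R] rpoly_pderiv[OF R] RG Rr)
      have d: "vle (poly (pderiv G) 1) (\<pi> ^ N * e)" using i by (simp add: e_def)
      moreover have "(poly (pderiv G) 1, poly (pderiv G') 1) \<in> R"
        by (intro rpoly_poly[OF R] rpoly_pderiv[OF R] RG R1)
      moreover have "(\<pi> ^ N * e, \<pi> ^ N * e') \<in> R" by (intro pmap_closed[OF R] Re)
      ultimately have d': "vle (poly (pderiv G') 1) (\<pi> ^ N * e')" using pmap_vle[OF R] by blast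
      have "cont e' G'" using pmap_cont[OF R Re RG] i(2) by (simp add: e_def)
      moreover have "e' \<noteq> 0" using pmap_zero_iff[OF R Re] i(1) by (simp add: e_def)
      ultimately have "near L (y' - a') (s' * (- poly G' r' / poly (pderiv G') r'))"
        using *[OF _ _ d' Gu(2) True' u(2)] ya by simp
      moreover have "near L (y - a) (s * (- poly G r / poly (pderiv G) r))"
        using *[OF _ _ d Gu(1) True u(1)] ya i by (simp add: e_def)
      ultimately show ?thesis using Rd by blast
    qed
  qed
  have "\<exists>R'. pmap R' \<and> R \<subseteq> R' \<and> (y, y') \<in> R'"
    by (rule pmap_extend_algebraic[OF R g(1) y(1) y'(1) g(3)])
      (use approx_eval[OF R F y(2) approx] in auto)
  then show ?thesis by blast
qed

text \<open>The terms of a polynomial expression in \<open>w\<close> of degree below \<open>d\<close> have valuations that differ by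
  more than every integer, so one of them decides whether its value is a power.\<close>
lemma extend_radical:
  assumes R: "pmap R" and F: "F = Domain R" and d: "0 < d" and w: "w ^ d \<in> F" "w \<noteq> 0"
    and no: "\<And>m b. 0 < m \<Longrightarrow> m < d \<Longrightarrow> b \<in> F \<Longrightarrow> \<not> same (w ^ m) b"
  shows "\<exists>R' w'. pmap R' \<and> R \<subseteq> R' \<and> (w, w') \<in> R'"
proof -
  have Fs: "fieldset F" using pmap_Domain[OF R] F by simp
  obtain b' where b: "(w ^ d, b') \<in> R" using w F by blast
  define S where "S = {x. x ^ d = b'}"
  have b0': "b' \<noteq> 0" using pmap_zero_iff[OF R b] w by simp
  have Sp: "S = {x. poly (monom 1 d - [:b':]) x = 0}" by (auto simp: S_def poly_monom)
  have "coeff (monom 1 d - [:b':]) d = 1" using d by (simp add: coeff_pCons split: nat.splits)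
  then have nz: "monom 1 d - [:b':] \<noteq> 0" by (metis coeff_0 zero_neq_one)
  \<comment> \<open>The common l puts w and x in the same class modulo N-th powers for every N up to
    n. At level n the single exponent \<open>fact n\<close> covers all these N.\<close>
  have "\<exists>x\<in>S. \<forall>n. \<forall>N. 0 < N \<and> N \<le> n \<longrightarrow> (\<exists>l>0. pw N (w / of_nat l) \<and> pw N (x / of_nat l))"
  proof (rule finite_descending_choice)
    show "finite S" unfolding Sp using nz by (rule poly_roots_finite)
  next
    fix n
    obtain l r where l: "0 < l" "r \<noteq> 0" "w = of_nat l * r ^ fact n" using power_rep[OF w(2), of "fact n"] by auto
    have l0: "of_nat l \<noteq> (0::'k)" using char0 l by blast
    have "w ^ d = of_nat l ^ d * r ^ (d * fact n)"
      by (simp add: l(3) power_mult_distrib mult.commute flip: power_mult)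
    then have "w ^ d / of_nat l ^ d = r ^ (d * fact n)" using l0 by simp
    then have "pw (d * fact n) (w ^ d / of_nat l ^ d)" unfolding pw_def by metis
    moreover have "(w ^ d / of_nat l ^ d, b' / of_nat l ^ d) \<in> R" by (intro pmap_closed[OF R] b)
    ultimately have "pw (d * fact n) (b' / of_nat l ^ d)" using pmap_pw[OF R] d by simp
    then obtain t where t: "t ^ (d * fact n) = b' / of_nat l ^ d" by (auto simp: pw_def)
    define x where "x = of_nat l * t ^ fact n"
    have "x ^ d = of_nat l ^ d * t ^ (d * fact n)"
      by (simp add: x_def power_mult_distrib mult.commute flip: power_mult)
    then have "x \<in> S" using t l0 by (simp add: S_def)
    moreover have "pw N (w / of_nat l)" "pw N (x / of_nat l)" if "0 < N" "N \<le> n" for N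
    proof -
      have "N dvd fact n" using that by (simp add: dvd_fact)
      moreover have "pw (fact n) (w / of_nat l)" "pw (fact n) (x / of_nat l)"
        using l l0 by (auto simp: pw_def x_def)
      ultimately show "pw N (w / of_nat l)" "pw N (x / of_nat l)" using pw_dvd by blast+
    qed
    ultimately show "\<exists>x\<in>S. \<forall>N. 0 < N \<and> N \<le> n \<longrightarrow> (\<exists>l>0. pw N (w / of_nat l) \<and> pw N (x / of_nat l))"
      using l(1) by blast
  qed auto
  then obtain w' where w': "w' ^ d = b'"
    "\<And>N. 0 < N \<Longrightarrow> \<exists>l>0. pw N (w / of_nat l) \<and> pw N (w' / of_nat l)"
    unfolding S_def by blast
  have w0': "w' \<noteq> 0" using w' b0' d by auto
  define g g' where "g = monom 1 d - [:w ^ d:]" and "g' = monom 1 d - [:b':]"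
  have deg: "degree g = d"
  proof (rule antisym)
    show "degree g \<le> d" unfolding g_def by (intro degree_diff_le) (auto simp: degree_monom_eq)
    show "d \<le> degree g" using d by (intro le_degree) (simp add: g_def coeff_pCons split: nat.splits)
  qed
  have Rg: "rpoly R g g'"
    unfolding rpoly_def g_def g'_def using b d
    by (auto simp: coeff_pCons split: nat.splits intro!: pmap_closed[OF R])
  have "\<exists>R'. pmap R' \<and> R \<subseteq> R' \<and> (w, w') \<in> R'"
  proof (rule pmap_extend_algebraic[OF R Rg _ _ deg d])
    show "poly g w = 0" "poly g' w' = 0" using w' by (auto simp: g_def g'_def poly_monom)
    fix q q' assume q: "rpoly R q q'" "q \<noteq> 0" "degree q < d"
    have dq: "degree q' = degree q" using rpoly_degree[OF R q(1)] by simp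
    have Rq: "(coeff q i, coeff q' i) \<in> R" for i using q by (simp add: rpoly_def)
    have qF: "polys F q" using rpoly_polys[OF q(1)] F by simp
    have "\<exists>j\<le>degree q. coeff q j \<noteq> 0 \<and>
      (\<forall>l n. l \<noteq> j \<longrightarrow> vle (\<pi> ^ n * (coeff q j * w ^ j)) (coeff q l * w ^ l))"
      by (rule dominant_term[OF Fs qF q(2) w(2)]) (use no q in auto)
    then obtain j where j: "j \<le> degree q" "coeff q j \<noteq> 0"
      "\<And>l n. l \<noteq> j \<Longrightarrow> vle (\<pi> ^ n * (coeff q j * w ^ j)) (coeff q l * w ^ l)" by blast
    have j0': "coeff q' j \<noteq> 0" using pmap_zero_iff[OF R Rq] j by simp
    have j': "vle (\<pi> ^ n * (coeff q' j * w' ^ j)) (coeff q' l * w' ^ l)" if "l \<noteq> j" for l n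
    proof -
      \<comment> \<open>The monomials contain w, but their d-th powers lie in the domain of R.
        Comparing those powers suffices by \<open>vle_power_iff\<close>.\<close>
      have Rd: "((\<pi> ^ m * (coeff q i * w ^ i)) ^ d, (\<pi> ^ m * (coeff q' i * w' ^ i)) ^ d) \<in> R" for m i
      proof -
        have e: "(\<pi> ^ m * (a * x ^ i)) ^ d = (\<pi> ^ m) ^ d * (a ^ d * (x ^ d) ^ i)" for a x :: 'k
          by (simp add: power_mult_distrib mult.commute flip: power_mult)
        show ?thesis unfolding e w'(1) by (intro pmap_closed(4,9,10)[OF R] Rq b)
      qed
      have "vle ((\<pi> ^ n * (coeff q j * w ^ j)) ^ d) ((\<pi> ^ 0 * (coeff q l * w ^ l)) ^ d)"
        using j(3)[OF that] by (intro vle_power) simp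
      then have "vle ((\<pi> ^ n * (coeff q' j * w' ^ j)) ^ d) ((\<pi> ^ 0 * (coeff q' l * w' ^ l)) ^ d)"
        using pmap_vle[OF R Rd Rd] by blast
      then show ?thesis using vle_power_iff[OF d] by simp
    qed
    have n1: "near n (poly q w) (coeff q j * w ^ j)" for n
      unfolding poly_altdef using j by (intro dominant_near) auto
    have n2: "near n (poly q' w') (coeff q' j * w' ^ j)" for n
      unfolding poly_altdef using j j' by (intro dominant_near) (auto simp: dq)
    have "poly q w \<noteq> 0" "poly q' w' \<noteq> 0"
      using near_0_iff[OF n1[of 1]] near_0_iff[OF n2[of 1]] j j0' w w0' by auto
    moreover have "pw N (poly q w) \<longleftrightarrow> pw N (poly q' w')" if N: "0 < N" for N
    proof -
      obtain L where L: "\<And>x y. near L x y \<Longrightarrow> pw N x \<longleftrightarrow> pw N y" using near_pw[OF N] by blast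
      obtain l where l: "l > 0" "pw N (w / of_nat l)" "pw N (w' / of_nat l)" using w'(2)[OF N] by blast
      have l0: "of_nat l \<noteq> (0::'k)" using char0 l by blast
      have *: "pw N (a * x ^ j) \<longleftrightarrow> pw N (a * of_nat l ^ j)" if xl: "pw N (x / of_nat l)" "x \<noteq> 0" for x a :: 'k
      proof -
        obtain r where r: "r ^ N = x / of_nat l" using xl by (auto simp: pw_def)
        then have "r \<noteq> 0" using xl l0 N by (auto simp: zero_power)
        have "a * x ^ j = (r ^ j) ^ N * (a * of_nat l ^ j)"
        proof -
          have "x = r ^ N * of_nat l" using r l0 by simp
          then show ?thesis by (simp add: power_mult_distrib mult_ac flip: power_mult)
        qed
        then show ?thesis using pw_power_mult[of "r ^ j" N] \<open>r \<noteq> 0\<close> by (metis power_not_zero)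
      qed
      have "pw N (poly q w) \<longleftrightarrow> pw N (coeff q j * of_nat l ^ j)" using L[OF n1] *[OF l(2) w(2)] by simp
      also have "\<dots> \<longleftrightarrow> pw N (coeff q' j * of_nat l ^ j)"
        by (intro pmap_pw[OF R _ N] pmap_closed[OF R] Rq)
      also have "\<dots> \<longleftrightarrow> pw N (poly q' w')" using L[OF n2] *[OF l(3) w0'] by simp
      finally show ?thesis .
    qed
    ultimately show "poly q w \<noteq> 0 \<and> poly q' w' \<noteq> 0 \<and> (\<forall>N>0. pw N (poly q w) \<longleftrightarrow> pw N (poly q' w'))" by blast
  qed
  then show ?thesis by blast
qed

text \<open>Let d be the least degree of a missing root y, so that a center c for the derivative
  exists. If y - c has a valuation from F, y itself can be adjoined by
  \<open>extend_unramified\<close>. If not, a d-th root of an element of F is adjoined in its place;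
  any proper extension suffices for maximality.\<close>

lemma extend_algebraic:
  fixes R :: "('k \<times> 'k) set"
  assumes R: "pmap R" and nr: "\<not> relclosed (Domain R)"
  shows "\<exists>R' y y'. pmap R' \<and> R \<subseteq> R' \<and> (y, y') \<in> R' \<and> y \<notin> Domain R"
proof -
  define F where "F = Domain R"
  have Fs: "fieldset F" using pmap_Domain[OF R] by (simp add: F_def)
  obtain d0 where "\<not> roots_in d0 F" using nr Fs by (auto simp: relclosed_def F_def)
  define d where "d = (LEAST d. \<not> roots_in d F)"
  have d: "\<not> roots_in d F" "\<And>m. m < d \<Longrightarrow> roots_in m F"
    unfolding d_def using LeastI[of "\<lambda>d. \<not> roots_in d F", OF \<open>\<not> roots_in d0 F\<close>] not_less_Least by blast+
  obtain g y where g: "g \<noteq> 0" "polys F g" "degree g \<le> d" and y: "poly g y = 0" "y \<notin> F"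
    using d(1) unfolding roots_in_def by blast
  have dg: "degree g = d"
  proof (rule ccontr)
    assume "degree g \<noteq> d"
    then have "roots_in (degree g) F" using d(2) g by simp
    then show False using g y unfolding roots_in_def by blast
  qed
  have "degree g \<noteq> 0"
  proof
    assume "degree g = 0"
    then obtain a where "g = [:a:]" by (rule degree_eq_zeroE)
    then show False using g y by simp
  qed
  then obtain n where n: "d = Suc n" using dg not0_implies_Suc by blast
  have rn: "roots_in n F" using d(2) n by simp
  obtain g' where g': "rpoly R g g'" using rpoly_exists[OF R] g by (auto simp: F_def)
  have "degree (pderiv g) \<le> n" using dg n by (intro degree_le) (simp add: coeff_pderiv coeff_eq_0)
  then obtain c M where c: "c \<in> F" "center (pderiv g) c (y - c) M"
    using center_exists[OF Fs rn polys_pderiv[OF Fs g(2)]] by blast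
  define z where "z = y - c"
  have z0: "z \<noteq> 0" using c y by (auto simp: z_def)
  define H where "H = pcompose g [:c, y - c:]"
  obtain N where N: "\<And>j. j > 0 \<Longrightarrow> vle (poly (pderiv H) 1) (\<pi> ^ N * coeff H j)"
    using center_pderiv[OF c(2) H_def] by blast
  show ?thesis
  proof (cases "\<exists>s\<in>F. s \<noteq> 0 \<and> same (y - c) s")
    case True
    then obtain s where s: "s \<in> F" "s \<noteq> 0" "same (y - c) s" by blast
    obtain c' where "(c, c') \<in> R" using c by (auto simp: F_def)
    from extend_unramified[OF R F_def rn g' g(1) _ y this H_def N s] show ?thesis
      using dg n y by (auto simp: F_def)
  next
    case nos: False
    define B where "B = pcompose g [:c, 1:]"
    have Bz: "poly B z = 0" using y by (simp add: B_def z_def poly_pcompose)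
    have BF: "polys F B" unfolding B_def using g c Fs by (intro polys_pcompose) (auto simp: fieldset_closed)
    have "degree B = d" by (simp add: B_def degree_pcompose dg)
    have B0: "B \<noteq> 0" using \<open>degree B = d\<close> n by auto
    \<comment> \<open>Otherwise B would have a dominant term at z and could not vanish
      there.\<close>
    have "\<exists>m b. 0 < m \<and> m \<le> d \<and> b \<in> F \<and> same (z ^ m) b"
    proof (rule ccontr)
      assume no: "\<not> ?thesis"
      have "\<exists>j\<le>degree B. coeff B j \<noteq> 0 \<and>
        (\<forall>l n. l \<noteq> j \<longrightarrow> vle (\<pi> ^ n * (coeff B j * z ^ j)) (coeff B l * z ^ l))"
        by (rule dominant_term[OF Fs BF B0 z0]) (use no \<open>degree B = d\<close> in auto)
      then obtain j where j: "j \<le> degree B" "coeff B j \<noteq> 0"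
        "\<And>l n. l \<noteq> j \<Longrightarrow> vle (\<pi> ^ n * (coeff B j * z ^ j)) (coeff B l * z ^ l)" by blast
      have "near 1 (poly B z) (coeff B j * z ^ j)"
        unfolding poly_altdef using j(1) j(3)[of _ 1] by (intro dominant_near) auto
      then show False using near_0_iff[of 1] Bz j z0 by fastforce
    qed
    then obtain m b where m: "0 < m" "m \<le> d" "b \<in> F" "same (z ^ m) b" by blast
    have "m = d"
    proof (rule ccontr)
      assume "m \<noteq> d"
      then have "\<exists>s\<in>F. s \<noteq> 0 \<and> same z s" using same_in_field[OF Fs rn m(1) _ m(3,4) z0] m n by simp
      then show False using nos by (simp add: z_def)
    qed
    \<comment> \<open>The exponent is d because smaller ones would put the valuation of z into F.
      The radical w has the valuation of z and hence lies outside F too.\<close>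
    then obtain w where w: "w ^ d \<in> F" "same z w" "w \<noteq> 0" using root_of_same[OF Fs m(1,3,4) z0] by blast
    have "w \<notin> F" using nos w by (auto simp: z_def)
    have "\<not> same (w ^ m) b" if mb: "0 < m" "m < d" "b \<in> F" for m b
    proof
      assume "same (w ^ m) b"
      then obtain s where "s \<in> F" "s \<noteq> 0" "same w s"
        using same_in_field[OF Fs rn mb(1) _ mb(3) _ w(3)] mb n by auto
      then have "same z s" using w(2) same_trans by blast
      then show False using nos \<open>s \<in> F\<close> \<open>s \<noteq> 0\<close> by (auto simp: z_def)
    qed
    from extend_radical[OF R F_def _ w(1,3) this] show ?thesis
      using n \<open>w \<notin> F\<close> by (auto simp: F_def)
  qed
qed

theorem pmap_relclosed:
  fixes R :: "('k \<times> 'k) set"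
  assumes R: "pmap R" shows "\<exists>R'. pmap R' \<and> R \<subseteq> R' \<and> relclosed (Domain R')"
proof -
  define A where "A = {R'. pmap R' \<and> R \<subseteq> R'}"
  have "\<exists>M\<in>A. \<forall>X\<in>A. M \<subseteq> X \<longrightarrow> X = M"
  proof (rule subset_Zorn_nonempty)
    show "A \<noteq> {}" using R by (auto simp: A_def)
    fix C assume C: "C \<noteq> {}" "subset.chain A C"
    have pm: "pmap X" if "X \<in> C" for X using C that by (auto simp: subset.chain_def A_def)
    have two: "\<exists>X\<in>C. u \<in> X \<and> v \<in> X" if "u \<in> \<Union>C" "v \<in> \<Union>C" for u v
      using that C(2) unfolding subset.chain_def by blast
    have "pmap (\<Union>C)"
      unfolding pmap_def
    proof (intro conjI allI impI)
      show "(1, 1) \<in> \<Union>C" using C(1) pm pmap_closed(1) by blast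
    next
      fix x x' y y' assume "(x, x') \<in> \<Union>C" "(y, y') \<in> \<Union>C"
      then obtain X where "X \<in> C" "(x, x') \<in> X" "(y, y') \<in> X" using two by blast
      then show "(x - y, x' - y') \<in> \<Union>C" "(x * y, x' * y') \<in> \<Union>C"
        using pm pmap_closed(3,4) by blast+
    next
      fix x x' assume "(x, x') \<in> \<Union>C"
      then obtain X where X: "X \<in> C" "(x, x') \<in> X" by blast
      then show "(inverse x, inverse x') \<in> \<Union>C" using pm pmap_closed(5) by blast
      show "x = 0 \<longleftrightarrow> x' = 0" using X pm pmap_zero_iff by blast
      show "pw N x \<longleftrightarrow> pw N x'" if "0 < N" for N using X pm pmap_pw that by blast
    qed
    moreover have "R \<subseteq> \<Union>C" using C unfolding subset.chain_def A_def by blast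
    ultimately show "\<Union>C \<in> A" by (simp add: A_def)
  qed
  then obtain M where "M \<in> A" and max: "\<forall>X\<in>A. M \<subseteq> X \<longrightarrow> X = M" by (rule bexE)
  then have M: "pmap M" "R \<subseteq> M" by (auto simp: A_def)
  have M3: "X = M" if "pmap X" "M \<subseteq> X" for X
    using max that M(2) by (simp add: A_def)
  have "relclosed (Domain M)"
  proof (rule ccontr)
    assume "\<not> ?thesis"
    from extend_algebraic[OF M(1) this]
    obtain R' y y' where R': "pmap R'" "M \<subseteq> R'" "(y, y') \<in> R'" "y \<notin> Domain M" by blast
    have "R' = M" by (rule M3[OF R'(1,2)])
    then have "(y, y') \<in> M" using R'(3) by simp
    then show False using R'(4) by (simp add: Domain.simps)
  qed
  then show ?thesis using M by blast
qed

end

section \<open>Definable predicates\<close>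

primrec renT :: "(nat \<Rightarrow> nat) \<Rightarrow> 'a tm \<Rightarrow> 'a tm" where
  "renT f (Var i) = Var (f i)"
| "renT f (Cst c) = Cst c"
| "renT f Zero = Zero"
| "renT f One = One"
| "renT f (Add s t) = Add (renT f s) (renT f t)"
| "renT f (Mul s t) = Mul (renT f s) (renT f t)"
| "renT f (Minus s) = Minus (renT f s)"

primrec renF :: "(nat \<Rightarrow> nat) \<Rightarrow> 'a fm \<Rightarrow> 'a fm" where
  "renF f (Eq s t) = Eq (renT f s) (renT f t)"
| "renF f (FNot \<phi>) = FNot (renF f \<phi>)"
| "renF f (FAnd \<phi> \<psi>) = FAnd (renF f \<phi>) (renF f \<psi>)"
| "renF f (FEx i \<phi>) = FEx (f i) (renF f \<phi>)"

lemma eval_renT: "eval (renT f t) \<rho> = eval t (\<rho> \<circ> f)"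
  by (induction t) auto

lemma map_renT: "map_tm e (renT f t) = renT f (map_tm e t)"
  by (induction t) auto

lemma set_renT: "set_tm (renT f t) = set_tm t"
  by (induction t) auto

lemma sat_renF: "inj f \<Longrightarrow> sat (renF f \<phi>) \<rho> = sat \<phi> (\<rho> \<circ> f)"
proof (induction \<phi> arbitrary: \<rho>)
  case (FEx i \<phi>)
  have "(\<rho>(f i := a)) \<circ> f = (\<rho> \<circ> f)(i := a)" for a
    using FEx.prems by (auto simp: fun_eq_iff inj_eq)
  then have "sat (renF f \<phi>) (\<rho>(f i := a)) = sat \<phi> ((\<rho> \<circ> f)(i := a))" for a
    using FEx.IH[OF FEx.prems, of "\<rho>(f i := a)"] by (simp only:)
  then show ?case by (simp only: renF.simps sat.simps)
qed (auto simp: eval_renT)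

lemma map_renF: "map_fm e (renF f \<phi>) = renF f (map_fm e \<phi>)"
  by (induction \<phi>) (auto simp: map_renT)

lemma set_renF: "set_fm (renF f \<phi>) = set_fm \<phi>"
  by (induction \<phi>) (auto simp: set_renT)

primrec bndT :: "'a tm \<Rightarrow> nat" where
  "bndT (Var i) = Suc i"
| "bndT (Cst c) = 0"
| "bndT Zero = 0"
| "bndT One = 0"
| "bndT (Add s t) = max (bndT s) (bndT t)"
| "bndT (Mul s t) = max (bndT s) (bndT t)"
| "bndT (Minus s) = bndT s"

primrec bnd :: "'a fm \<Rightarrow> nat" where
  "bnd (Eq s t) = max (bndT s) (bndT t)"
| "bnd (FNot \<phi>) = bnd \<phi>"
| "bnd (FAnd \<phi> \<psi>) = max (bnd \<phi>) (bnd \<psi>)"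
| "bnd (FEx i \<phi>) = bnd \<phi>"

lemma bndT_map: "bndT (map_tm e t) = bndT t"
  by (induction t) auto

lemma bnd_map: "bnd (map_fm e \<phi>) = bnd \<phi>"
  by (induction \<phi>) (auto simp: bndT_map)

lemma eval_cong: "(\<And>i. i < bndT t \<Longrightarrow> \<rho> i = \<sigma> i) \<Longrightarrow> eval t \<rho> = eval t \<sigma>"
  by (induction t) auto

lemma sat_cong: "(\<And>i. i < bnd \<phi> \<Longrightarrow> \<rho> i = \<sigma> i) \<Longrightarrow> sat \<phi> \<rho> = sat \<phi> \<sigma>"
proof (induction \<phi> arbitrary: \<rho> \<sigma>)
  case (Eq s t)
  then show ?case using eval_cong[of s \<rho> \<sigma>] eval_cong[of t \<rho> \<sigma>] by simp
next
  case (FEx i \<phi>)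
  have "sat \<phi> (\<rho>(i := a)) = sat \<phi> (\<sigma>(i := a))" for a
    by (rule FEx.IH) (use FEx.prems in auto)
  then show ?case by simp
next
  case (FAnd \<phi> \<psi>)
  have "sat \<phi> \<rho> = sat \<phi> \<sigma>" "sat \<psi> \<rho> = sat \<psi> \<sigma>"
    by (rule FAnd.IH; use FAnd.prems in simp)+
  then show ?case by simp
next
  case (FNot \<phi>)
  have "sat \<phi> \<rho> = sat \<phi> \<sigma>" by (rule FNot.IH) (use FNot.prems in simp)
  then show ?case by simp
qed

text \<open>A pair of predicates on assignments is a \<open>dpair\<close> if one formula with parameters in \<open>A\<close> defines
  the first one, and its image under \<open>e\<close> the second one; \<open>dterm\<close> is the analogue for terms.\<close>
definition dterm ::
  "('a::comm_ring_1 \<Rightarrow> 'b::comm_ring_1) \<Rightarrow> 'a set \<Rightarrow> ((nat \<Rightarrow> 'a) \<Rightarrow> 'a) \<Rightarrow> ((nat \<Rightarrow> 'b) \<Rightarrow> 'b) \<Rightarrow> bool" where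
  "dterm e A s s' \<longleftrightarrow> (\<exists>t. set_tm t \<subseteq> A \<and> s = eval t \<and> s' = eval (map_tm e t))"

definition dpair ::
  "('a::comm_ring_1 \<Rightarrow> 'b::comm_ring_1) \<Rightarrow> 'a set \<Rightarrow> ((nat \<Rightarrow> 'a) \<Rightarrow> bool) \<Rightarrow> ((nat \<Rightarrow> 'b) \<Rightarrow> bool) \<Rightarrow> bool" where
  "dpair e A P P' \<longleftrightarrow> (\<exists>\<phi>. set_fm \<phi> \<subseteq> A \<and> P = sat \<phi> \<and> P' = sat (map_fm e \<phi>))"

section \<open>Closure properties of definable pairs\<close>

lemma dt_const: "c \<in> A \<Longrightarrow> dterm e A (\<lambda>\<rho>. c) (\<lambda>\<rho>. e c)"
  unfolding dterm_def by (intro exI[of _ "Cst c"]) auto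

lemma dt_var: "dterm e A (\<lambda>\<rho>. \<rho> i) (\<lambda>\<rho>. \<rho> i)"
  unfolding dterm_def by (intro exI[of _ "Var i"]) auto

lemma dt_zero: "dterm e A (\<lambda>\<rho>. 0) (\<lambda>\<rho>. 0)"
  unfolding dterm_def by (intro exI[of _ Zero]) auto

lemma dt_one: "dterm e A (\<lambda>\<rho>. 1) (\<lambda>\<rho>. 1)"
  unfolding dterm_def by (intro exI[of _ One]) auto

lemma dt_add:
  assumes "dterm e A s s'" "dterm e A t t'" shows "dterm e A (\<lambda>\<rho>. s \<rho> + t \<rho>) (\<lambda>\<rho>. s' \<rho> + t' \<rho>)"
proof -
  obtain a b where "set_tm a \<subseteq> A" "s = eval a" "s' = eval (map_tm e a)"
    "set_tm b \<subseteq> A" "t = eval b" "t' = eval (map_tm e b)" using assms by (auto simp: dterm_def)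
  then show ?thesis unfolding dterm_def by (intro exI[of _ "Add a b"]) auto
qed

lemma dt_mult:
  assumes "dterm e A s s'" "dterm e A t t'" shows "dterm e A (\<lambda>\<rho>. s \<rho> * t \<rho>) (\<lambda>\<rho>. s' \<rho> * t' \<rho>)"
proof -
  obtain a b where "set_tm a \<subseteq> A" "s = eval a" "s' = eval (map_tm e a)"
    "set_tm b \<subseteq> A" "t = eval b" "t' = eval (map_tm e b)" using assms by (auto simp: dterm_def)
  then show ?thesis unfolding dterm_def by (intro exI[of _ "Mul a b"]) auto
qed

lemma dt_minus:
  assumes "dterm e A s s'" shows "dterm e A (\<lambda>\<rho>. - s \<rho>) (\<lambda>\<rho>. - s' \<rho>)"
proof -
  obtain a where "set_tm a \<subseteq> A" "s = eval a" "s' = eval (map_tm e a)" using assms by (auto simp: dterm_def)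
  then show ?thesis unfolding dterm_def by (intro exI[of _ "Minus a"]) auto
qed

lemma dt_diff:
  "dterm e A s s' \<Longrightarrow> dterm e A t t' \<Longrightarrow> dterm e A (\<lambda>\<rho>. s \<rho> - t \<rho>) (\<lambda>\<rho>. s' \<rho> - t' \<rho>)"
  using dt_add[OF _ dt_minus] by fastforce

lemma dt_power: "dterm e A s s' \<Longrightarrow> dterm e A (\<lambda>\<rho>. s \<rho> ^ n) (\<lambda>\<rho>. s' \<rho> ^ n)"
  by (induction n) (auto intro: dt_one dt_mult)

lemma dt_of_nat: "dterm e A (\<lambda>\<rho>. of_nat n) (\<lambda>\<rho>. of_nat n)"
  by (induction n) (auto intro: dt_zero dt_one dt_add)

lemma dt_sum:
  "(\<And>i. dterm e A (s i) (s' i)) \<Longrightarrow> dterm e A (\<lambda>\<rho>. \<Sum>i\<in>I. s i \<rho>) (\<lambda>\<rho>. \<Sum>i\<in>I. s' i \<rho>)"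
  by (induction I rule: infinite_finite_induct) (auto intro: dt_zero dt_add)

lemma dt_shift: "dterm e A s s' \<Longrightarrow> dterm e A (\<lambda>\<rho>. s (\<lambda>j. \<rho> (Suc j))) (\<lambda>\<rho>. s' (\<lambda>j. \<rho> (Suc j)))"
  unfolding dterm_def
proof (elim exE conjE)
  fix t assume "set_tm t \<subseteq> A" "s = eval t" "s' = eval (map_tm e t)"
  then show "\<exists>t. set_tm t \<subseteq> A \<and> (\<lambda>\<rho>. s (\<lambda>j. \<rho> (Suc j))) = eval t \<and>
      (\<lambda>\<rho>. s' (\<lambda>j. \<rho> (Suc j))) = eval (map_tm e t)"
    by (intro exI[of _ "renT Suc t"]) (auto simp: set_renT eval_renT map_renT comp_def fun_eq_iff)
qed

lemma dp_eq:
  assumes "dterm e A s s'" "dterm e A t t'" shows "dpair e A (\<lambda>\<rho>. s \<rho> = t \<rho>) (\<lambda>\<rho>. s' \<rho> = t' \<rho>)"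
proof -
  obtain a b where "set_tm a \<subseteq> A" "s = eval a" "s' = eval (map_tm e a)"
    "set_tm b \<subseteq> A" "t = eval b" "t' = eval (map_tm e b)" using assms by (auto simp: dterm_def)
  then show ?thesis unfolding dpair_def by (intro exI[of _ "Eq a b"]) auto
qed

lemma dp_not:
  assumes "dpair e A P P'" shows "dpair e A (\<lambda>\<rho>. \<not> P \<rho>) (\<lambda>\<rho>. \<not> P' \<rho>)"
proof -
  obtain a where "set_fm a \<subseteq> A" "P = sat a" "P' = sat (map_fm e a)" using assms by (auto simp: dpair_def)
  then show ?thesis unfolding dpair_def by (intro exI[of _ "FNot a"]) auto
qed

lemma dp_and:
  assumes "dpair e A P P'" "dpair e A Q Q'" shows "dpair e A (\<lambda>\<rho>. P \<rho> \<and> Q \<rho>) (\<lambda>\<rho>. P' \<rho> \<and> Q' \<rho>)"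
proof -
  obtain a b where "set_fm a \<subseteq> A" "P = sat a" "P' = sat (map_fm e a)"
    "set_fm b \<subseteq> A" "Q = sat b" "Q' = sat (map_fm e b)" using assms by (auto simp: dpair_def)
  then show ?thesis unfolding dpair_def by (intro exI[of _ "FAnd a b"]) auto
qed

lemma dp_or: "dpair e A P P' \<Longrightarrow> dpair e A Q Q' \<Longrightarrow> dpair e A (\<lambda>\<rho>. P \<rho> \<or> Q \<rho>) (\<lambda>\<rho>. P' \<rho> \<or> Q' \<rho>)"
  using dp_not[OF dp_and[OF dp_not dp_not]] by fastforce

lemma dp_imp:
  assumes "dpair e A P P'" "dpair e A Q Q'" shows "dpair e A (\<lambda>\<rho>. P \<rho> \<longrightarrow> Q \<rho>) (\<lambda>\<rho>. P' \<rho> \<longrightarrow> Q' \<rho>)"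
  unfolding imp_conv_disj by (intro dp_or dp_not assms)

lemma dp_iff:
  assumes "dpair e A P P'" "dpair e A Q Q'" shows "dpair e A (\<lambda>\<rho>. P \<rho> \<longleftrightarrow> Q \<rho>) (\<lambda>\<rho>. P' \<rho> \<longleftrightarrow> Q' \<rho>)"
  unfolding iff_conv_conj_imp by (intro dp_and dp_imp assms)

lemma dp_True: "dpair e A (\<lambda>\<rho>. True) (\<lambda>\<rho>. True)"
  using dp_eq[OF dt_zero dt_zero] by simp

lemma dp_ball:
  assumes "finite I" "\<And>i. i \<in> I \<Longrightarrow> dpair e A (P i) (P' i)"
  shows "dpair e A (\<lambda>\<rho>. \<forall>i\<in>I. P i \<rho>) (\<lambda>\<rho>. \<forall>i\<in>I. P' i \<rho>)"
  using assms by (induction I rule: finite_induct) (auto intro: dp_True dp_and)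

lemma dp_bex:
  "finite I \<Longrightarrow> (\<And>i. i \<in> I \<Longrightarrow> dpair e A (P i) (P' i)) \<Longrightarrow>
    dpair e A (\<lambda>\<rho>. \<exists>i\<in>I. P i \<rho>) (\<lambda>\<rho>. \<exists>i\<in>I. P' i \<rho>)"
  using dp_not[OF dp_ball[OF _ dp_not, of I e A P P']] by simp

lemma dp_ex_upd:
  assumes "dpair e A P P'" shows "dpair e A (\<lambda>\<rho>. \<exists>a. P (\<rho>(i := a))) (\<lambda>\<rho>. \<exists>a. P' (\<rho>(i := a)))"
proof -
  obtain a where "set_fm a \<subseteq> A" "P = sat a" "P' = sat (map_fm e a)" using assms by (auto simp: dpair_def)
  then show ?thesis unfolding dpair_def by (intro exI[of _ "FEx i a"]) (auto simp: fun_eq_iff)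
qed

lemma dp_ex_block:
  assumes "finite I" "dpair e A P P'"
  shows "dpair e A (\<lambda>\<rho>. \<exists>\<sigma>. P (\<lambda>i. if i \<in> I then \<sigma> i else \<rho> i)) (\<lambda>\<rho>. \<exists>\<sigma>. P' (\<lambda>i. if i \<in> I then \<sigma> i else \<rho> i))"
  using assms(1)
proof (induction I rule: finite_induct)
  case empty
  then show ?case using assms(2) by simp
next
  case (insert j I)
  have *: "(\<exists>\<sigma>. Q (\<lambda>i. if i \<in> insert j I then \<sigma> i else \<rho> i)) \<longleftrightarrow>
      (\<exists>a \<sigma>. Q (\<lambda>i. if i \<in> I then \<sigma> i else (\<rho>(j := a)) i))" for Q and \<rho> :: "nat \<Rightarrow> 'x"
  proof
    assume "\<exists>\<sigma>. Q (\<lambda>i. if i \<in> insert j I then \<sigma> i else \<rho> i)"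
    then obtain \<sigma> where "Q (\<lambda>i. if i \<in> insert j I then \<sigma> i else \<rho> i)" by blast
    moreover have "(\<lambda>i. if i \<in> insert j I then \<sigma> i else \<rho> i) = (\<lambda>i. if i \<in> I then \<sigma> i else (\<rho>(j := \<sigma> j)) i)"
      by auto
    ultimately show "\<exists>a \<sigma>. Q (\<lambda>i. if i \<in> I then \<sigma> i else (\<rho>(j := a)) i)" by metis
  next
    assume "\<exists>a \<sigma>. Q (\<lambda>i. if i \<in> I then \<sigma> i else (\<rho>(j := a)) i)"
    then obtain a \<sigma> where "Q (\<lambda>i. if i \<in> I then \<sigma> i else (\<rho>(j := a)) i)" by blast
    moreover have "(\<lambda>i. if i \<in> I then \<sigma> i else (\<rho>(j := a)) i) =
        (\<lambda>i. if i \<in> insert j I then (\<sigma>(j := a)) i else \<rho> i)"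
      using insert.hyps(2) by auto
    ultimately show "\<exists>\<sigma>. Q (\<lambda>i. if i \<in> insert j I then \<sigma> i else \<rho> i)" by metis
  qed
  show ?case unfolding * by (rule dp_ex_upd[OF insert.IH])
qed

text \<open>In the premise, variable \<open>0\<close> stands for the bound variable and the others are shifted.\<close>
lemma dp_ex:
  assumes "dpair e A (\<lambda>\<rho>. F (\<lambda>j. \<rho> (Suc j)) (\<rho> 0)) (\<lambda>\<rho>. F' (\<lambda>j. \<rho> (Suc j)) (\<rho> 0))"
  shows "dpair e A (\<lambda>\<rho>. \<exists>x. F \<rho> x) (\<lambda>\<rho>. \<exists>x. F' \<rho> x)"
proof -
  obtain \<phi> where phi: "set_fm \<phi> \<subseteq> A" "(\<lambda>\<rho>. F (\<lambda>j. \<rho> (Suc j)) (\<rho> 0)) = sat \<phi>"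
    "(\<lambda>\<rho>. F' (\<lambda>j. \<rho> (Suc j)) (\<rho> 0)) = sat (map_fm e \<phi>)"
    using assms by (auto simp: dpair_def)
  define n where "n = bnd \<phi>"
  \<comment> \<open>A cyclic permutation of 0, ..., n in place of the plain shift, since renaming
    bound variables is sound only for injective maps. Index n is free to hold the witness because
    variables of \<phi> stay below it.\<close>
  define f where "f i = (if i = 0 then n else if i \<le> n then i - 1 else i)" for i
  have f: "inj f" unfolding inj_def f_def by (auto split: if_splits)
  have *: "sat (FEx n (renF f \<psi>)) \<rho> = (\<exists>x. G \<rho> x)"
    if G: "(\<lambda>\<rho>. G (\<lambda>j. \<rho> (Suc j)) (\<rho> 0)) = sat \<psi>" "bnd \<psi> = n" for G and \<psi> :: "'x::comm_ring_1 fm" and \<rho>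
  proof -
    have "sat \<psi> ((\<rho>(n := a)) \<circ> f) = G \<rho> a" for a
    proof -
      have "sat \<psi> ((\<rho>(n := a)) \<circ> f) = sat \<psi> (case_nat a \<rho>)"
        by (rule sat_cong) (auto simp: f_def that split: nat.splits)
      also have "\<dots> = G \<rho> a" using fun_cong[OF G(1), of "case_nat a \<rho>"] by simp
      finally show ?thesis .
    qed
    then show ?thesis by (simp add: sat_renF[OF f])
  qed
  show ?thesis unfolding dpair_def
  proof (intro exI[of _ "FEx n (renF f \<phi>)"] conjI)
    show "set_fm (FEx n (renF f \<phi>)) \<subseteq> A" using phi by (simp add: set_renF)
    show "(\<lambda>\<rho>. \<exists>x. F \<rho> x) = sat (FEx n (renF f \<phi>))"
      by (intro ext, rule sym, rule *[OF phi(2)]) (simp add: n_def)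
    have map: "map_fm e (FEx n (renF f \<phi>)) = FEx n (renF f (map_fm e \<phi>))" by (simp add: map_renF)
    show "(\<lambda>\<rho>. \<exists>x. F' \<rho> x) = sat (map_fm e (FEx n (renF f \<phi>)))"
      unfolding map by (intro ext, rule sym, rule *[OF phi(3)]) (simp add: n_def bnd_map)
  qed
qed

lemma dp_all:
  "dpair e A (\<lambda>\<rho>. F (\<lambda>j. \<rho> (Suc j)) (\<rho> 0)) (\<lambda>\<rho>. F' (\<lambda>j. \<rho> (Suc j)) (\<rho> 0)) \<Longrightarrow>
   dpair e A (\<lambda>\<rho>. \<forall>x. F \<rho> x) (\<lambda>\<rho>. \<forall>x. F' \<rho> x)"
  using dp_not[OF dp_ex[OF dp_not, of e A F F']] by simp

lemma dt_subst:
  assumes "dterm e A t t'" "\<And>i. dterm e A (s i) (s' i)"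
  shows "dterm e A (\<lambda>\<rho>. t (\<lambda>i. s i \<rho>)) (\<lambda>\<rho>. t' (\<lambda>i. s' i \<rho>))"
proof -
  obtain \<tau> where \<tau>: "set_tm \<tau> \<subseteq> A" "t = eval \<tau>" "t' = eval (map_tm e \<tau>)"
    using assms(1) by (auto simp: dterm_def)
  have "dterm e A (\<lambda>\<rho>. eval \<tau> (\<lambda>i. s i \<rho>)) (\<lambda>\<rho>. eval (map_tm e \<tau>) (\<lambda>i. s' i \<rho>))"
    using \<tau>(1) assms(2)
    by (induction \<tau>) (auto intro: dt_zero dt_one dt_add dt_mult dt_minus dt_const)
  then show ?thesis by (simp add: \<tau>)
qed

text \<open>Capture is avoided by passing under a quantifier to variable 0 for the bound variable
  and shifting the substituted terms.\<close>

lemma dp_subst: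
  assumes "dpair e A P P'" "\<And>i. dterm e A (s i) (s' i)"
  shows "dpair e A (\<lambda>\<rho>. P (\<lambda>i. s i \<rho>)) (\<lambda>\<rho>. P' (\<lambda>i. s' i \<rho>))"
proof -
  obtain \<phi> where phi: "set_fm \<phi> \<subseteq> A" "P = sat \<phi>" "P' = sat (map_fm e \<phi>)"
    using assms(1) by (auto simp: dpair_def)
  have "dpair e A (\<lambda>\<rho>. sat \<phi> (\<lambda>i. s i \<rho>)) (\<lambda>\<rho>. sat (map_fm e \<phi>) (\<lambda>i. s' i \<rho>))"
    using phi(1) assms(2)
  proof (induction \<phi> arbitrary: s s')
    case (Eq a b)
    have "dterm e A (eval a) (eval (map_tm e a))" "dterm e A (eval b) (eval (map_tm e b))"
      using Eq.prems(1) by (auto simp: dterm_def)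
    from dp_eq[OF dt_subst[OF this(1) Eq.prems(2)] dt_subst[OF this(2) Eq.prems(2)]]
    show ?case by simp
  next
    case (FNot \<phi>)
    have "dpair e A (\<lambda>\<rho>. sat \<phi> (\<lambda>i. s i \<rho>)) (\<lambda>\<rho>. sat (map_fm e \<phi>) (\<lambda>i. s' i \<rho>))"
      by (rule FNot.IH) (use FNot.prems in auto)
    then show ?case by (simp add: dp_not)
  next
    case (FAnd \<phi> \<psi>)
    have "dpair e A (\<lambda>\<rho>. sat \<phi> (\<lambda>i. s i \<rho>)) (\<lambda>\<rho>. sat (map_fm e \<phi>) (\<lambda>i. s' i \<rho>))"
      "dpair e A (\<lambda>\<rho>. sat \<psi> (\<lambda>i. s i \<rho>)) (\<lambda>\<rho>. sat (map_fm e \<psi>) (\<lambda>i. s' i \<rho>))"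
      by (rule FAnd.IH; use FAnd.prems in auto)+
    then show ?case by (simp add: dp_and)
  next
    case (FEx i \<phi>)
    define r where "r j = (\<lambda>\<rho>. if j = i then \<rho> 0 else s j (\<lambda>j. \<rho> (Suc j)))" for j
    define r' where "r' j = (\<lambda>\<rho>. if j = i then \<rho> 0 else s' j (\<lambda>j. \<rho> (Suc j)))" for j
    have "dterm e A (r j) (r' j)" for j
      unfolding r_def r'_def using dt_shift[OF FEx.prems(2)] by (cases "j = i") (auto intro: dt_var)
    then have "dpair e A (\<lambda>\<rho>. sat \<phi> (\<lambda>j. r j \<rho>)) (\<lambda>\<rho>. sat (map_fm e \<phi>) (\<lambda>j. r' j \<rho>))"
      using FEx by simp
    moreover have "(\<lambda>j. r j \<rho>) = (\<lambda>j. s j (\<lambda>j. \<rho> (Suc j)))(i := \<rho> 0)"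
      "(\<lambda>j. r' j \<sigma>) = (\<lambda>j. s' j (\<lambda>j. \<sigma> (Suc j)))(i := \<sigma> 0)" for \<rho> \<sigma>
      by (auto simp: r_def r'_def fun_eq_iff)
    ultimately have "dpair e A (\<lambda>\<rho>. sat \<phi> ((\<lambda>j. s j (\<lambda>j. \<rho> (Suc j)))(i := \<rho> 0)))
       (\<lambda>\<rho>. sat (map_fm e \<phi>) ((\<lambda>j. s' j (\<lambda>j. \<rho> (Suc j)))(i := \<rho> 0)))" by simp
    then show ?case by (simp add: dp_ex)
  qed
  then show ?thesis by (simp add: phi)
qed

lemma dpair_cong:
  assumes "dpair e A P P'"
  shows "\<exists>n. \<forall>\<rho> \<sigma>. (\<forall>i<n. \<rho> i = \<sigma> i) \<longrightarrow> P \<rho> = P \<sigma>" "\<exists>n. \<forall>\<rho> \<sigma>. (\<forall>i<n. \<rho> i = \<sigma> i) \<longrightarrow> P' \<rho> = P' \<sigma>"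
  using assms sat_cong unfolding dpair_def by metis+

lemma dpair_mono: "dpair e A P P' \<Longrightarrow> A \<subseteq> B \<Longrightarrow> dpair e B P P'"
  unfolding dpair_def by blast

text \<open>This retains the K side alone, with parameters in the image of e; that set is small
  enough for saturation.\<close>

lemma dpair_image: "dpair e A P P' \<Longrightarrow> dpair id (e ` A) P' P'"
  unfolding dpair_def by (metis fm.map_id fm.set_map image_mono)

lemma dpair_sat: "dpair e UNIV (sat \<phi>) (sat (map_fm e \<phi>))"
  unfolding dpair_def by blast

lemma dp_pw: "dterm e A s s' \<Longrightarrow> dpair e A (\<lambda>\<rho>. pw N (s \<rho>)) (\<lambda>\<rho>. pw N (s' \<rho>))"
  unfolding pw_def by (intro dp_ex dp_eq dt_power dt_var dt_shift)

lemma dpair_transfer: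
  "elementary_embedding e \<Longrightarrow> dpair e A P P' \<Longrightarrow> P \<rho> \<longleftrightarrow> P' (e \<circ> \<rho>)"
  unfolding dpair_def elementary_embedding_def by blast

lemmas dp_intros = dp_not dp_and dp_or dp_imp dp_iff dp_ball dp_bex dp_ex dp_all dp_eq
  dt_var dt_zero dt_one dt_add dt_mult dt_minus dt_diff dt_power dt_of_nat dt_sum

section \<open>The p-adic numbers\<close>

locale padic =
  fixes p :: nat and val :: "'q::field_char_0 \<Rightarrow> int"
  assumes prime_p: "prime p" and padic: "padic_field p val"
begin

lemmas padic_unfolded = padic[unfolded padic_field_def]

lemma val_mult: "x \<noteq> 0 \<Longrightarrow> y \<noteq> 0 \<Longrightarrow> val (x * y) = val x + val y"
  using padic_unfolded[THEN conjunct1] by blast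

lemma val_add: "x \<noteq> 0 \<Longrightarrow> y \<noteq> 0 \<Longrightarrow> x + y \<noteq> 0 \<Longrightarrow> min (val x) (val y) \<le> val (x + y)"
  using padic_unfolded[THEN conjunct2, THEN conjunct1] by blast

lemma val_p: "val (of_nat p) = 1"
  using padic_unfolded[THEN conjunct2, THEN conjunct2, THEN conjunct1] .

lemma val_int: "k \<noteq> 0 \<Longrightarrow> \<not> int p dvd k \<Longrightarrow> val (of_int k) = 0"
  using padic_unfolded[THEN conjunct2, THEN conjunct2, THEN conjunct2, THEN conjunct1] by blast

lemma dense: "\<exists>r. x = of_rat r \<or> N \<le> val (x - of_rat r)"
  using padic_unfolded[THEN conjunct2, THEN conjunct2, THEN conjunct2, THEN conjunct2, THEN conjunct1] by blast

lemma complete: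
  "\<forall>N::int. \<exists>M::nat. \<forall>i\<ge>M. \<forall>j\<ge>M. s i = s j \<or> N \<le> val (s i - s j) \<Longrightarrow>
    \<exists>l. \<forall>N::int. \<exists>M. \<forall>i\<ge>M. s i = l \<or> N \<le> val (s i - l)"
  using padic_unfolded[THEN conjunct2, THEN conjunct2, THEN conjunct2, THEN conjunct2, THEN conjunct2] by blast

lemma p_nz: "(of_nat p :: 'q) \<noteq> 0"
  using prime_p by (simp add: prime_gt_0_nat)

lemma val_one: "val 1 = 0"
  using val_mult[of 1 1] by simp

lemma val_minus: "x \<noteq> 0 \<Longrightarrow> val (- x) = val x"
  using val_mult[of "-1" "-1"] val_mult[of "-1" x] val_one by simp

lemma val_inverse: "x \<noteq> 0 \<Longrightarrow> val (inverse x) = - val x"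
  using val_mult[of x "inverse x"] val_one by simp

lemma val_power: "x \<noteq> 0 \<Longrightarrow> val (x ^ n) = int n * val x"
  by (induction n) (auto simp: val_one val_mult algebra_simps)

lemma val_divide: "x \<noteq> 0 \<Longrightarrow> y \<noteq> 0 \<Longrightarrow> val (x / y) = val x - val y"
  by (simp add: divide_inverse val_mult val_inverse)

lemma val_ring_iff: "x \<in> val_ring val \<longleftrightarrow> x = 0 \<or> 0 \<le> val x"
  by (simp add: val_ring_def)

lemma val_ring_diff: assumes "x \<in> val_ring val" "y \<in> val_ring val" shows "x - y \<in> val_ring val"
proof (cases "x = 0 \<or> y = 0 \<or> x - y = 0")
  case True
  then show ?thesis using assms by (cases "y = 0") (auto simp: val_ring_iff val_minus)
next
  case False
  then show ?thesis using assms val_add[of x "- y"] val_minus[of y] by (auto simp: val_ring_iff)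
qed

lemma val_ring_mult: "x \<in> val_ring val \<Longrightarrow> y \<in> val_ring val \<Longrightarrow> x * y \<in> val_ring val"
  by (cases "x = 0"; cases "y = 0") (auto simp: val_ring_iff val_mult)

lemma val_ring_add: "x \<in> val_ring val \<Longrightarrow> y \<in> val_ring val \<Longrightarrow> x + y \<in> val_ring val"
  using val_ring_diff[of x "0 - y"] val_ring_diff[of 0 y] by (simp add: val_ring_iff)

lemma val_ring_one: "1 \<in> val_ring val"
  by (simp add: val_ring_iff val_one)

lemma val_ring_of_nat: "of_nat n \<in> val_ring val"
proof (induction n)
  case (Suc n)
  have "- 1 \<in> val_ring val" using val_ring_diff[of 0 1] val_ring_one by (simp add: val_ring_iff)
  then show ?case using val_ring_diff[of "of_nat n" "-1"] Suc by (simp add: add.commute)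
qed (simp add: val_ring_iff)

lemma val_ring_of_int: "of_int k \<in> val_ring val"
proof (cases "0 \<le> k")
  case True
  then show ?thesis using val_ring_of_nat[of "nat k"] by simp
next
  case False
  have "0 \<in> val_ring val" by (simp add: val_ring_iff)
  from val_ring_diff[OF this val_ring_of_nat[of "nat (- k)"]] show ?thesis using False by simp
qed

text \<open>Approximate x modulo p by a rational a / b. In lowest terms p does not divide b, as a /
  b is integral. Bezout inverts b modulo p, and k is a times this inverse.\<close>

lemma val_ring_residue:
  assumes x: "x \<in> val_ring val"
  shows "\<exists>k<p. (x - of_nat k) / of_nat p \<in> val_ring val"
proof -
  obtain r where r: "x = of_rat r \<or> 1 \<le> val (x - of_rat r)" using dense[of x 1] by blast
  define y where "y = (of_rat r :: 'q)"
  have xy: "(x - y) / of_nat p \<in> val_ring val"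
  proof (cases "x - y = 0")
    case False
    then have "val ((x - y) / of_nat p) = val (x - y) - 1" using p_nz by (subst val_divide) (auto simp: val_p)
    then show ?thesis using r False by (auto simp: y_def val_ring_iff)
  qed (simp add: val_ring_iff)
  have "x - y \<in> val_ring val"
    using val_ring_mult[OF xy val_ring_of_nat[of p]] p_nz by simp
  then have yV: "y \<in> val_ring val" using val_ring_diff[OF x, of "x - y"] by simp
  obtain a b where ab: "quotient_of r = (a, b)" by fastforce
  then have b: "b > 0" "coprime a b" "r = of_int a / of_int b"
    using quotient_of_denom_pos quotient_of_coprime quotient_of_div by blast+
  have y: "y = of_int a / of_int b" by (simp add: y_def b of_rat_divide)
  have pb: "\<not> int p dvd b"
  proof
    assume d: "int p dvd b"
    then have na: "\<not> int p dvd a" using b prime_p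
      by (meson coprime_common_divisor not_prime_unit prime_nat_int_transfer)
    then have "a \<noteq> 0" by auto
    obtain m where m: "b = int p * m" using d by blast
    then have "m \<noteq> 0" using b by auto
    have "val (of_int b) = 1 + val (of_int m)"
      using m \<open>m \<noteq> 0\<close> p_nz val_mult[of "of_nat p" "of_int m"] by (simp add: val_p)
    moreover have "0 \<le> val (of_int m)" using val_ring_of_int[of m] \<open>m \<noteq> 0\<close> by (simp add: val_ring_iff)
    moreover have "val y = val (of_int a) - val (of_int b)"
      unfolding y using \<open>a \<noteq> 0\<close> b by (intro val_divide) auto
    moreover have "y \<noteq> 0" using \<open>a \<noteq> 0\<close> b by (simp add: y)
    ultimately show False using val_int[OF \<open>a \<noteq> 0\<close> na] yV by (simp add: val_ring_iff)
  qed
  then have "coprime (int p) b" using prime_p by (simp add: prime_imp_coprime)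
  then obtain u v where uv: "u * b + v * int p = 1"
    using bezout_int[of b "int p"] by (auto simp: coprime_iff_gcd_eq_1 gcd.commute)
  define k where "k = nat ((a * u) mod int p)"
  have p0: "0 < int p" using prime_p prime_gt_0_nat by simp
  have k: "k < p" "int k = (a * u) mod int p" using p0 by (auto simp: k_def nat_less_iff)
  define w where "w = a * u div int p"
  define c where "c = a * v + b * w"
  have "int k = a * u - int p * w" using k(2) by (simp add: w_def minus_mult_div_eq_mod)
  then have "a - b * int k = int p * (a * v + b * w) + a * (1 - (u * b + v * int p))"
    by (simp only: right_diff_distrib distrib_left mult.commute mult.left_commute)
  then have e: "a - b * int k = int p * c" using uv by (simp add: c_def)
  have "(y - of_nat k) / of_nat p = of_int (a - b * int k) / (of_int b * of_nat p)"
    using b p_nz by (simp add: y field_simps)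
  also have "\<dots> = of_int c / of_int b"
    unfolding e using b p_nz by (simp add: field_simps)
  also have "\<dots> \<in> val_ring val"
  proof (cases "c = 0")
    case False
    then have "0 \<le> val (of_int c)" using val_ring_of_int[of c] by (simp add: val_ring_iff)
    moreover have "val (of_int b) = 0" using val_int[OF _ pb] b by simp
    ultimately show ?thesis using False b by (simp add: val_ring_iff val_divide)
  qed (simp add: val_ring_iff)
  finally have "(y - of_nat k) / of_nat p \<in> val_ring val" .
  from val_ring_add[OF xy this] have "(x - of_nat k) / of_nat p \<in> val_ring val"
    by (simp flip: add_divide_distrib)
  then show ?thesis using k by auto
qed

sublocale vring "val_ring val" p
proof
  show "inverse x \<in> val_ring val" if "x \<notin> val_ring val" for x
    using that val_inverse[of x] by (auto simp: val_ring_iff)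
  show "inverse (of_nat p) \<notin> val_ring val"
    using val_inverse[OF p_nz] p_nz by (simp add: val_ring_iff val_p)
qed (use prime_p val_ring_one val_ring_diff val_ring_mult val_ring_residue in auto)

lemma vle_val: "vle (\<pi> ^ n) x \<longleftrightarrow> x = 0 \<or> int n \<le> val x"
proof (cases "x = 0")
  case False
  then show ?thesis using p_nz val_divide[of x "\<pi> ^ n"] val_power[OF p_nz, of n]
    by (simp add: vle_iff val_ring_iff val_p)
qed simp

text \<open>The archimedean property of integer valuations. It is what fails in K, where an
  infinitesimal can be found.\<close>

lemma vle_all_zero: "(\<And>n. vle (\<pi> ^ n) x) \<Longrightarrow> x = 0"
  using vle_val[of "nat (val x + 1)" x] by (cases "0 \<le> val x") (auto simp: vle_val[of 0 x, simplified] dest: meta_spec[of _ 0])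

lemma bounded_denom: "\<exists>M. x * \<pi> ^ M \<in> val_ring val"
proof (cases "x = 0")
  case False
  then have "val (x * \<pi> ^ nat (- val x)) \<ge> 0"
    using val_mult[of x "\<pi> ^ nat (- val x)"] val_power[OF p_nz, of "nat (- val x)"] p_nz by (simp add: val_p)
  then show ?thesis by (auto simp: val_ring_iff)
qed (simp add: val_ring_iff)

section \<open>Completeness and Hensel's lemma\<close>

lemma cauchy_limit:
  assumes "\<And>n. vle (\<pi> ^ n) (s (Suc n) - s n)"
  shows "\<exists>l. \<forall>n. \<exists>M. \<forall>i\<ge>M. vle (\<pi> ^ n) (s i - l)"
proof -
  have c: "vle (\<pi> ^ n) (s (i + d) - s i)" if "n \<le> i" for n i d
  proof (induction d)
    case (Suc d)
    have "vle (\<pi> ^ n) (s (Suc (i + d)) - s (i + d))"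
      using vle_trans[OF vle_pi_power assms] that by simp
    then show ?case using vle_add[OF _ Suc] by fastforce
  qed simp
  have "\<exists>l. \<forall>N::int. \<exists>M. \<forall>i\<ge>M. s i = l \<or> N \<le> val (s i - l)"
  proof (rule complete, rule allI)
    fix N :: int
    have "s i = s j \<or> N \<le> val (s i - s j)" if "nat N \<le> i" "nat N \<le> j" for i j
    proof -
      have "vle (\<pi> ^ nat N) (s i - s j)"
      proof (cases "j \<le> i")
        case True
        then show ?thesis using c[of "nat N" j "i - j"] that by simp
      next
        case False
        then show ?thesis using c[of "nat N" i "j - i"] that vle_diff_commute by simp
      qed
      then have "s i - s j = 0 \<or> int (nat N) \<le> val (s i - s j)" by (simp only: vle_val)
      moreover have "N \<le> int (nat N)" by simp
      ultimately show ?thesis by (auto intro: order_trans simp del: int_nat_eq)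
    qed
    then show "\<exists>M. \<forall>i\<ge>M. \<forall>j\<ge>M. s i = s j \<or> N \<le> val (s i - s j)" by blast
  qed
  then obtain l where l: "\<And>N::int. \<exists>M. \<forall>i\<ge>M. s i = l \<or> N \<le> val (s i - l)" by blast
  have "\<exists>M. \<forall>i\<ge>M. vle (\<pi> ^ n) (s i - l)" for n
    using l[of "int n"] by (auto simp: vle_val)
  then show ?thesis by blast
qed

text \<open>The equation is the fixed point equation of g. Since only powers of exponent at least 2
  occur, g contracts distances on p V by a factor p, and its iterates converge by
  completeness.\<close>

lemma hensel_series:
  assumes a: "vle \<pi> a" and c: "\<And>i. i < n \<Longrightarrow> c i \<in> val_ring val"
  shows "\<exists>x. vle \<pi> x \<and> a + x + (\<Sum>i<n. c i * x ^ (i + 2)) = 0"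
proof -
  define g where "g x = - (a + (\<Sum>i<n. c i * x ^ (i + 2)))" for x
  have piV: "x \<in> val_ring val" if "vle \<pi> x" for x
    using vle_of_mult[of 1 \<pi> x] that of_nat_V by (simp add: vle_1_iff)
  have pw: "vle (x - y) (x ^ m - y ^ m)" if "x \<in> val_ring val" "y \<in> val_ring val" for x y m
    using poly_diff_vle[of 1 "monom 1 m" x y] that
    by (simp add: cont_def vle_1_iff one_V zero_V poly_monom)
  have pw2: "vle (\<pi> * (x - y)) (x ^ (m + 2) - y ^ (m + 2))" if "vle \<pi> x" "vle \<pi> y" for x y m
  proof -
    have "x ^ (m + 2) - y ^ (m + 2) = x * (x ^ Suc m - y ^ Suc m) + y ^ Suc m * (x - y)"
      by (simp add: algebra_simps)
    moreover have "vle (\<pi> * (x - y)) (x * (x ^ Suc m - y ^ Suc m))"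
      by (intro vle_mult that pw piV)
    moreover have "vle (\<pi> * (x - y)) (y ^ Suc m * (x - y))"
      using that piV by (intro vle_mult) (auto intro!: vle_mult_right power_V)
    ultimately show ?thesis using vle_add by metis
  qed
  have g1: "vle \<pi> (g x)" if "vle \<pi> x" for x
  proof -
    have "vle \<pi> (c i * x ^ (i + 2))" if "i < n" for i
    proof (rule vle_mult_V[OF _ c[OF that]])
      show "vle \<pi> (x ^ (i + 2))"
        using vle_mult_right[OF \<open>vle \<pi> x\<close> power_V[OF piV[OF \<open>vle \<pi> x\<close>], of "Suc i"]] by simp
    qed
    then show ?thesis unfolding g_def vle_minus_iff by (intro vle_add vle_sum a) auto
  qed
  have g2: "vle (\<pi> * (x - y)) (g x - g y)" if "vle \<pi> x" "vle \<pi> y" for x y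
  proof -
    have "g x - g y = - (\<Sum>i<n. c i * (x ^ (i + 2) - y ^ (i + 2)))"
      by (simp add: g_def sum_subtractf right_diff_distrib)
    moreover have "vle (\<pi> * (x - y)) (\<Sum>i<n. c i * (x ^ (i + 2) - y ^ (i + 2)))"
      by (intro vle_sum vle_mult_V pw2 that c) auto
    ultimately show ?thesis by simp
  qed
  define s where "s k = (g ^^ k) 0" for k
  have s1: "vle \<pi> (s k)" for k unfolding s_def by (induction k) (auto intro: g1)
  have sS: "s (Suc k) = g (s k)" for k by (simp add: s_def)
  have "vle (\<pi> ^ k) (s (Suc k) - s k)" for k
  proof (induction k)
    case 0
    then show ?case using s1[of 1] piV by (simp add: s_def vle_1_iff)
  next
    case (Suc k)
    have "vle (\<pi> * \<pi> ^ k) (\<pi> * (s (Suc k) - s k))" by (rule vle_mult_left[OF Suc])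
    then show ?case using vle_trans[OF _ g2[OF s1 s1, of "Suc k" k]] by (simp add: sS)
  qed
  then obtain l where l: "\<And>n. \<exists>M. \<forall>i\<ge>M. vle (\<pi> ^ n) (s i - l)" using cauchy_limit by blast
  have pl: "vle \<pi> l"
  proof -
    obtain M where "vle (\<pi> ^ 1) (s M - l)" using l[of 1] by blast
    then show ?thesis using vle_diff[OF s1[of M], of "s M - l"] by simp
  qed
  have "l - g l = 0"
  proof (rule vle_all_zero)
    fix k
    obtain M where M: "\<forall>i\<ge>M. vle (\<pi> ^ k) (s i - l)" using l by blast
    have "vle (s M - l) (g (s M) - g l)"
      using vle_of_mult[of "s M - l" \<pi>] g2[OF s1[of M] pl] of_nat_V by (simp add: mult.commute)
    then have "vle (\<pi> ^ k) (g (s M) - g l)" using M vle_trans by blast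
    moreover have "vle (\<pi> ^ k) (g (s M) - l)" using M by (simp add: sS[symmetric])
    ultimately show "vle (\<pi> ^ k) (l - g l)"
      using vle_diff[of _ "g (s M) - g l" "g (s M) - l"] by simp
  qed
  then show ?thesis using pl by (intro exI[of _ l]) (simp add: g_def algebra_simps)
qed

sublocale pclosed "val_ring val" p
proof
  fix a :: 'q and n and c :: "nat \<Rightarrow> 'q"
  assume "a / \<pi> \<in> val_ring val" "\<And>i. i < n \<Longrightarrow> c i \<in> val_ring val"
  then show "\<exists>x. x / \<pi> \<in> val_ring val \<and> a + x + (\<Sum>i<n. c i * x ^ (i + 2)) = 0"
    using hensel_series[of a n c] pi_nonzero by (simp add: vle_iff)
next
  fix x :: 'q and N :: nat assume x: "x \<noteq> 0" "0 < N"
  define q where "q = val x div int N"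
  \<comment> \<open>This is p to the power -q, split by sign because exponents are natural
    numbers.\<close>
  define y where "y = (if 0 \<le> q then inverse (\<pi> ^ nat q) else \<pi> ^ nat (- q))"
  define r where "r = nat (val x mod int N)"
  have y: "y \<noteq> 0" "val y = - q"
    using p_nz val_power[OF p_nz] by (auto simp: y_def val_inverse val_p)
  have r: "r < N" "int r = val x mod int N" using x by (auto simp: r_def nat_less_iff)
  have "val (x * y ^ N) = val x - int N * q"
    using x y val_mult[of x "y ^ N"] val_power[OF y(1), of N] by simp
  also have "\<dots> = int r" by (simp add: r q_def minus_mult_div_eq_mod)
  finally have v: "val (x * y ^ N) = int r" .
  have "x * y ^ N \<noteq> 0" "\<pi> ^ r \<noteq> 0" using x y p_nz by auto
  then have "val (x * y ^ N / \<pi> ^ r) = 0" "val (\<pi> ^ r / (x * y ^ N)) = 0"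
    using v val_power[OF p_nz, of r] by (auto simp: val_divide val_p)
  then show "\<exists>y. y \<noteq> 0 \<and> (\<exists>r<N. x * y ^ N / \<pi> ^ r \<in> val_ring val \<and> \<pi> ^ r / (x * y ^ N) \<in> val_ring val)"
    using y(1) r(1) by (intro exI[of _ y]) (auto simp: val_ring_iff)
qed simp

end

lemma inj_nat_set_real: "\<exists>f :: nat set \<Rightarrow> real. inj f"
  using nat_sets_lepoll_reals01 unfolding lepoll_def by blast

text \<open>Rational approximations to all precisions determine x. Coding the sequence of these
  rationals as a set of numbers gives an injection into sets of naturals, hence into the reals. It
  bounds the parameter set for saturation.\<close>

lemma (in padic) inj_real: "\<exists>f :: 'q \<Rightarrow> real. inj f"
proof -
  have ex: "\<exists>r. vle (\<pi> ^ n) (x - of_rat r)" for x n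
    using dense[of x "int n"] by (auto simp: vle_val)
  define a where "a x n = (SOME r. vle (\<pi> ^ n) (x - of_rat r))" for x n
  have a: "vle (\<pi> ^ n) (x - of_rat (a x n))" for x n
    unfolding a_def by (rule someI_ex[OF ex])
  define S where "S x = {prod_encode (n, to_nat (a x n)) | n. True}" for x
  have S: "x = y" if "S x = S y" for x y
  proof -
    have "a x n = a y n" for n
    proof -
      have "prod_encode (n, to_nat (a x n)) \<in> S x" by (auto simp: S_def)
      then have "prod_encode (n, to_nat (a x n)) \<in> S y" by (simp only: that)
      then show ?thesis by (auto simp: S_def)
    qed
    then have "vle (\<pi> ^ n) (x - y)" for n
      using vle_diff[OF a[of n x] a[of n y]] by simp
    then show ?thesis using vle_all_zero by fastforce
  qed
  obtain f :: "nat set \<Rightarrow> real" where f: "inj f" using inj_nat_set_real by blast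
  have "inj (f \<circ> S)" by (rule injI) (use f S in \<open>auto simp: inj_eq\<close>)
  then show ?thesis by blast
qed

section \<open>Transfer and saturation\<close>

text \<open>A definition of the valuation ring that works for every prime \<open>p\<close>; the exponents
  ensure that the valuation of the argument is odd and negative for non-integral \<open>x\<close>.\<close>
definition vset :: "nat \<Rightarrow> 'a::field set" where
  "vset p = {x. pw 2 (1 + of_nat p ^ 3 * x ^ 4)}"

lemma dp_vset: "dterm e A s s' \<Longrightarrow> dpair e A (\<lambda>\<rho>. s \<rho> \<in> vset p) (\<lambda>\<rho>. s' \<rho> \<in> vset p)"
  unfolding vset_def mem_Collect_eq by (intro dp_pw dt_add dt_mult dt_one dt_power dt_of_nat)

lemma (in pclosed) vset_eq: "vset p = V"
  using V_iff_square by (auto simp: vset_def)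

text \<open>A quantifier over assignments is no formula, but P' depends on finitely many variables
  only. The transferred formula is an existential block over those, for the negation of P.\<close>

lemma transfer_all:
  assumes e: "elementary_embedding e" and P: "dpair e A P P'" and all: "\<forall>\<rho>. P \<rho>"
  shows "P' \<sigma>"
proof -
  obtain n where n: "\<And>\<rho> \<sigma>. (\<forall>i<n. \<rho> i = \<sigma> i) \<Longrightarrow> P' \<rho> = P' \<sigma>" using dpair_cong(2)[OF P] by blast
  have "dpair e A (\<lambda>\<rho>. \<exists>\<sigma>. \<not> P (\<lambda>i. if i \<in> {..<n} then \<sigma> i else \<rho> i))
     (\<lambda>\<rho>. \<exists>\<sigma>. \<not> P' (\<lambda>i. if i \<in> {..<n} then \<sigma> i else \<rho> i))"
    using dp_ex_block[OF finite_lessThan dp_not[OF P]] .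
  from dpair_transfer[OF e this, of "\<lambda>_. 0"] all
  have "P' (\<lambda>i. if i \<in> {..<n} then \<sigma> i else (e \<circ> (\<lambda>_. 0)) i)" by blast
  then show ?thesis using n[of "\<lambda>i. if i \<in> {..<n} then \<sigma> i else (e \<circ> (\<lambda>_. 0)) i" \<sigma>] by simp
qed

lemma elementary_hom:
  assumes e: "elementary_embedding e"
  shows "e 0 = 0" "e 1 = 1" "e (a + b) = e a + e b" "e (a * b) = e a * e b" "e (- a) = - e a"
    "e a = e b \<longleftrightarrow> a = b"
proof -
  note * = e[unfolded elementary_embedding_def, rule_format, of _ "\<lambda>_. 0"]
  show "e 0 = 0" using *[of "Eq (Cst 0) Zero"] by simp
  show "e 1 = 1" using *[of "Eq (Cst 1) One"] by simp
  show "e (a + b) = e a + e b" using *[of "Eq (Cst (a + b)) (Add (Cst a) (Cst b))"] by simp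
  show "e (a * b) = e a * e b" using *[of "Eq (Cst (a * b)) (Mul (Cst a) (Cst b))"] by simp
  show "e (- a) = - e a" using *[of "Eq (Cst (- a)) (Minus (Cst a))"] by simp
  show "e a = e b \<longleftrightarrow> a = b" using *[of "Eq (Cst a) (Cst b)"] by simp
qed

text \<open>Division is no ring term; this expresses that x / c lies in V in the same ring formula
  for both fields.\<close>

definition quot_in :: "nat \<Rightarrow> 'a::field \<Rightarrow> 'a \<Rightarrow> bool" where
  "quot_in p x c \<longleftrightarrow> (\<exists>y. y * c = x \<and> y \<in> vset p)"

lemma quot_in_iff: "c \<noteq> 0 \<Longrightarrow> quot_in p x c \<longleftrightarrow> x / c \<in> vset p"
  unfolding quot_in_def by (metis nonzero_eq_divide_eq)

lemma dp_quot_in: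
  "dterm e A s s' \<Longrightarrow> dterm e A t t' \<Longrightarrow>
    dpair e A (\<lambda>\<rho>. quot_in p (s \<rho>) (t \<rho>)) (\<lambda>\<rho>. quot_in p (s' \<rho>) (t' \<rho>))"
  unfolding quot_in_def by (intro dp_ex dp_and dp_eq dp_vset dt_mult dt_var dt_shift)

text \<open>For fixed exponents and numbers of coefficients each axiom is a single sentence, written
  with \<open>quot_in\<close> for divisions.\<close>

lemma pclosed_transfer:
  fixes e :: "'q::field_char_0 \<Rightarrow> 'k::field"
  assumes e: "elementary_embedding e" and Q: "pclosed (vset p :: 'q set) p"
  shows "pclosed (vset p :: 'k set) p"
proof -
  interpret Q: pclosed "vset p :: 'q set" p by (rule Q)
  note T = transfer_all[OF e, where A = UNIV]
  have nat0: "(of_nat n :: 'k) \<noteq> 0" if "0 < n" for n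
  proof -
    have D: "dpair e UNIV (\<lambda>\<rho>. of_nat n \<noteq> (0::'q)) (\<lambda>\<rho>. of_nat n \<noteq> (0::'k))" by (intro dp_intros)
    show ?thesis using T[OF D] that by simp
  qed
  have p0: "(of_nat p :: 'k) \<noteq> 0" using nat0 Q.prime_p prime_gt_0_nat by blast
  have zero: "(0::'k) \<in> vset p"
  proof -
    have D: "dpair e UNIV (\<lambda>\<rho>. (0::'q) \<in> vset p) (\<lambda>\<rho>. (0::'k) \<in> vset p)" by (intro dp_vset dp_intros)
    show ?thesis using T[OF D] Q.zero_V by simp
  qed
  show ?thesis
  proof (unfold_locales)
    show "prime p" by (rule Q.prime_p)
    show "0 < n \<Longrightarrow> (of_nat n :: 'k) \<noteq> 0" for n by (rule nat0)
    show "(1::'k) \<in> vset p"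
    proof -
      have D: "dpair e UNIV (\<lambda>\<rho>. (1::'q) \<in> vset p) (\<lambda>\<rho>. (1::'k) \<in> vset p)" by (intro dp_vset dp_intros)
      show ?thesis using T[OF D] Q.one_V by simp
    qed
    show "x - y \<in> vset p" if "x \<in> vset p" "y \<in> vset p" for x y :: 'k
    proof -
      have D: "dpair e UNIV (\<lambda>\<rho>. \<rho> 0 \<in> vset p \<longrightarrow> \<rho> 1 \<in> vset p \<longrightarrow> \<rho> 0 - \<rho> 1 \<in> vset p)
          (\<lambda>\<rho>. \<rho> 0 \<in> vset p \<longrightarrow> \<rho> 1 \<in> vset p \<longrightarrow> \<rho> 0 - \<rho> 1 \<in> vset p)"
        by (intro dp_vset dp_intros)
      show ?thesis using T[OF D, of "case_nat x (\<lambda>_. y)"] Q.diff_V that by simp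
    qed
    show "x * y \<in> vset p" if "x \<in> vset p" "y \<in> vset p" for x y :: 'k
    proof -
      have D: "dpair e UNIV (\<lambda>\<rho>. \<rho> 0 \<in> vset p \<longrightarrow> \<rho> 1 \<in> vset p \<longrightarrow> \<rho> 0 * \<rho> 1 \<in> vset p)
          (\<lambda>\<rho>. \<rho> 0 \<in> vset p \<longrightarrow> \<rho> 1 \<in> vset p \<longrightarrow> \<rho> 0 * \<rho> 1 \<in> vset p)"
        by (intro dp_vset dp_intros)
      show ?thesis using T[OF D, of "case_nat x (\<lambda>_. y)"] Q.mult_V that by simp
    qed
    show "inverse x \<in> vset p" if "x \<notin> vset p" for x :: 'k
    proof -
      have D: "dpair e UNIV (\<lambda>\<rho>. \<rho> 0 \<in> vset p \<or> quot_in p 1 (\<rho> 0)) (\<lambda>\<rho>. \<rho> 0 \<in> vset p \<or> quot_in p 1 (\<rho> 0))"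
        by (intro dp_vset dp_quot_in dp_intros)
      have "x \<in> vset p \<or> quot_in p 1 x" for x :: 'q
        using Q.inverse_V[of x] Q.zero_V quot_in_iff[of x p 1]
        by (cases "x = 0") (auto simp: inverse_eq_divide)
      then have "\<forall>\<rho> :: nat \<Rightarrow> 'q. \<rho> 0 \<in> vset p \<or> quot_in p 1 (\<rho> 0)" by blast
      from T[OF D this, of "\<lambda>_. x"] show ?thesis
        using that zero quot_in_iff[of x p 1] by (cases "x = 0") (auto simp: inverse_eq_divide)
    qed
    show "inverse (of_nat p) \<notin> (vset p :: 'k set)"
    proof -
      have D: "dpair e UNIV (\<lambda>\<rho>. \<not> quot_in p (1::'q) (of_nat p)) (\<lambda>\<rho>. \<not> quot_in p (1::'k) (of_nat p))"
        by (intro dp_quot_in dp_intros)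
      have "\<not> quot_in p 1 (of_nat p :: 'q)"
        using Q.p_nonunit quot_in_iff[OF Q.pi_nonzero] by (simp add: inverse_eq_divide)
      then have "\<not> quot_in p 1 (of_nat p :: 'k)" using T[OF D] by blast
      then show ?thesis using quot_in_iff[OF p0] by (simp add: inverse_eq_divide)
    qed
    show "\<exists>k<p. (x - of_nat k) / of_nat p \<in> vset p" if "x \<in> vset p" for x :: 'k
    proof -
      have D: "dpair e UNIV (\<lambda>\<rho>. \<rho> 0 \<in> vset p \<longrightarrow> (\<exists>k\<in>{..<p}. quot_in p (\<rho> 0 - of_nat k) (of_nat p)))
         (\<lambda>\<rho>. \<rho> 0 \<in> vset p \<longrightarrow> (\<exists>k\<in>{..<p}. quot_in p (\<rho> 0 - of_nat k) (of_nat p)))"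
        by (intro dp_vset dp_quot_in dp_intros finite_lessThan)
      have "\<forall>\<rho> :: nat \<Rightarrow> 'q. \<rho> 0 \<in> vset p \<longrightarrow> (\<exists>k\<in>{..<p}. quot_in p (\<rho> 0 - of_nat k) (of_nat p))"
        unfolding quot_in_iff[OF Q.pi_nonzero] using Q.residue by auto
      from T[OF D this, of "\<lambda>_. x"] show ?thesis using that unfolding quot_in_iff[OF p0] by auto
    qed
    show "\<exists>x. x / of_nat p \<in> vset p \<and> a + x + (\<Sum>i<n. c i * x ^ (i + 2)) = 0"
      if a: "a / of_nat p \<in> vset p" and c: "\<And>i. i < n \<Longrightarrow> c i \<in> vset p" for a :: 'k and n c
    proof -
      \<comment> \<open>The variables below n hold the coefficients c, and variable n holds the
        constant term a.\<close>
      have D: "dpair e UNIV (\<lambda>\<rho>. quot_in p (\<rho> n) (of_nat p) \<and> (\<forall>i\<in>{..<n}. \<rho> i \<in> vset p) \<longrightarrow>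
          (\<exists>x. quot_in p x (of_nat p) \<and> \<rho> n + x + (\<Sum>i\<in>{..<n}. \<rho> i * x ^ (i + 2)) = 0))
        (\<lambda>\<rho>. quot_in p (\<rho> n) (of_nat p) \<and> (\<forall>i\<in>{..<n}. \<rho> i \<in> vset p) \<longrightarrow>
          (\<exists>x. quot_in p x (of_nat p) \<and> \<rho> n + x + (\<Sum>i\<in>{..<n}. \<rho> i * x ^ (i + 2)) = 0))"
        by (intro dp_vset dp_quot_in dp_intros finite_lessThan)
      have *: "\<forall>\<rho> :: nat \<Rightarrow> 'q. quot_in p (\<rho> n) (of_nat p) \<and> (\<forall>i\<in>{..<n}. \<rho> i \<in> vset p) \<longrightarrow>
          (\<exists>x. quot_in p x (of_nat p) \<and> \<rho> n + x + (\<Sum>i\<in>{..<n}. \<rho> i * x ^ (i + 2)) = 0)"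
        unfolding quot_in_iff[OF Q.pi_nonzero] using Q.hensel_form by blast
      have "quot_in p ((c(n := a)) n) (of_nat p)" "\<forall>i\<in>{..<n}. (c(n := a)) i \<in> vset p"
        using a c by (auto simp: quot_in_iff[OF p0])
      then obtain x where x: "quot_in p x (of_nat p)"
        "(c(n := a)) n + x + (\<Sum>i\<in>{..<n}. (c(n := a)) i * x ^ (i + 2)) = 0"
        using T[OF D *, of "c(n := a)"] by blast
      have "(\<Sum>i\<in>{..<n}. (c(n := a)) i * x ^ (i + 2)) = (\<Sum>i<n. c i * x ^ (i + 2))"
        by (intro sum.cong) auto
      then show ?thesis using x unfolding quot_in_iff[OF p0] by (intro exI[of _ x]) simp
    qed
    show "\<exists>y. y \<noteq> 0 \<and> (\<exists>r<N. x * y ^ N / of_nat p ^ r \<in> vset p \<and> of_nat p ^ r / (x * y ^ N) \<in> vset p)"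
      if x: "x \<noteq> 0" "0 < N" for x :: 'k and N
    proof -
      have D: "dpair e UNIV (\<lambda>\<rho>. \<rho> 0 \<noteq> 0 \<longrightarrow> (\<exists>y. y \<noteq> 0 \<and> (\<exists>r\<in>{..<N}.
            quot_in p (\<rho> 0 * y ^ N) (of_nat p ^ r) \<and> quot_in p (of_nat p ^ r) (\<rho> 0 * y ^ N))))
         (\<lambda>\<rho>. \<rho> 0 \<noteq> 0 \<longrightarrow> (\<exists>y. y \<noteq> 0 \<and> (\<exists>r\<in>{..<N}.
            quot_in p (\<rho> 0 * y ^ N) (of_nat p ^ r) \<and> quot_in p (of_nat p ^ r) (\<rho> 0 * y ^ N))))"
        by (intro dp_quot_in dp_intros finite_lessThan)
      have *: "\<forall>\<rho> :: nat \<Rightarrow> 'q. \<rho> 0 \<noteq> 0 \<longrightarrow> (\<exists>y. y \<noteq> 0 \<and> (\<exists>r\<in>{..<N}.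
            quot_in p (\<rho> 0 * y ^ N) (of_nat p ^ r) \<and> quot_in p (of_nat p ^ r) (\<rho> 0 * y ^ N)))"
      proof (intro allI impI)
        fix \<rho> :: "nat \<Rightarrow> 'q" assume r0: "\<rho> 0 \<noteq> 0"
        obtain y r where y: "y \<noteq> 0" "r < N" "\<rho> 0 * y ^ N / of_nat p ^ r \<in> vset p"
          "of_nat p ^ r / (\<rho> 0 * y ^ N) \<in> vset p" using Q.zgroup[OF r0 x(2)] by blast
        have nz: "(of_nat p :: 'q) ^ r \<noteq> 0" "\<rho> 0 * y ^ N \<noteq> 0" using r0 y Q.pi_nonzero by auto
        show "\<exists>y. y \<noteq> 0 \<and> (\<exists>r\<in>{..<N}.
            quot_in p (\<rho> 0 * y ^ N) (of_nat p ^ r) \<and> quot_in p (of_nat p ^ r) (\<rho> 0 * y ^ N))"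
          using y(1,2) y(3,4)[folded quot_in_iff[OF nz(1)] quot_in_iff[OF nz(2)]] by blast
      qed
      obtain y r where y: "y \<noteq> 0" "r < N" "quot_in p (x * y ^ N) (of_nat p ^ r)"
          "quot_in p (of_nat p ^ r) (x * y ^ N)"
        using T[OF D *, of "\<lambda>_. x"] x by auto
      have nz: "(of_nat p :: 'k) ^ r \<noteq> 0" "x * y ^ N \<noteq> 0" using x y p0 by auto
      show ?thesis using y(1,2) y(3,4)[unfolded quot_in_iff[OF nz(1)] quot_in_iff[OF nz(2)]] by blast
    qed
  qed
qed

lemma ext_val_ring_eq:
  fixes e :: "'q::field_char_0 \<Rightarrow> 'k::field"
  assumes e: "elementary_embedding e" and v: "val_ring val = (vset p :: 'q set)"
  shows "ext_val_ring val e = vset p"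
proof (rule set_eqI)
  fix x :: 'k
  have eq: "sat (map_fm e \<phi>) (\<lambda>_. x) \<longleftrightarrow> x \<in> vset p"
    if phi: "\<forall>y. y \<in> val_ring val \<longleftrightarrow> sat \<phi> (\<lambda>_. y)" for \<phi>
  proof -
    have "dpair e UNIV (\<lambda>\<rho>. sat \<phi> (\<lambda>i. \<rho> 0) \<longleftrightarrow> \<rho> 0 \<in> vset p)
       (\<lambda>\<rho>. sat (map_fm e \<phi>) (\<lambda>i. \<rho> 0) \<longleftrightarrow> \<rho> 0 \<in> vset p)"
      by (intro dp_iff dp_vset dt_var dp_subst[OF dpair_sat])
    from transfer_all[OF e this, of "\<lambda>_. x"] show ?thesis using phi v by simp
  qed
  have "dpair e UNIV (\<lambda>\<rho>::nat \<Rightarrow> 'q. \<rho> 0 \<in> vset p) (\<lambda>\<rho>. \<rho> 0 \<in> vset p)" by (intro dp_vset dt_var)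
  then obtain \<phi> :: "'q fm" where "(\<lambda>\<rho>. \<rho> 0 \<in> vset p) = sat \<phi>" unfolding dpair_def by blast
  then have "\<forall>y. y \<in> val_ring val \<longleftrightarrow> sat \<phi> (\<lambda>_. y)" by (metis v)
  then show "x \<in> ext_val_ring val e \<longleftrightarrow> x \<in> vset p"
    using eq by (auto simp: ext_val_ring_def)
qed

lemma small_insert:
  assumes "\<exists>f :: 'a \<Rightarrow> real. inj_on f A" shows "\<exists>f :: 'a \<Rightarrow> real. inj_on f (insert x A)"
proof -
  obtain f :: "'a \<Rightarrow> real" where f: "inj_on f A" using assms by blast
  \<comment> \<open>The range of arctan lies below pi / 2 < 2, which leaves 2 as a fresh value for
    x.\<close>
  have "arctan y \<noteq> 2" for y using arctan_ubound[of y] pi_less_4 by linarith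
  then have "inj_on (\<lambda>y. if y = x then 2 else arctan (f y)) (insert x A)"
    using f by (auto simp: inj_on_def arctan_eq_iff)
  then show ?thesis by blast
qed

text \<open>Induction on the number of variables. The 1-type of variable n asserts that the other n
  variables can be chosen for each finite part; a realization x is then added to the parameters.
  Setting all free variables to x is harmless, as only the first n + 1 matter and n of them are
  bound.\<close>

lemma saturated_types:
  fixes \<Sigma> :: "((nat \<Rightarrow> 'k::comm_ring_1) \<Rightarrow> bool) set"
  assumes sat: "saturated_2aleph0_plus TYPE('k)"
    and A: "\<exists>f :: 'k \<Rightarrow> real. inj_on f A"
    and S: "\<And>P. P \<in> \<Sigma> \<Longrightarrow> dpair id A P P"
    and dep: "\<And>P \<rho> \<sigma>. P \<in> \<Sigma> \<Longrightarrow> (\<And>i. i < n \<Longrightarrow> \<rho> i = \<sigma> i) \<Longrightarrow> P \<rho> = P \<sigma>"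
    and fin: "\<And>\<Sigma>0. finite \<Sigma>0 \<Longrightarrow> \<Sigma>0 \<subseteq> \<Sigma> \<Longrightarrow> \<exists>\<rho>. \<forall>P\<in>\<Sigma>0. P \<rho>"
  shows "\<exists>\<rho>. \<forall>P\<in>\<Sigma>. P \<rho>"
  using A S dep fin
proof (induction n arbitrary: A \<Sigma>)
  case 0
  have "P (\<lambda>_. 0)" if "P \<in> \<Sigma>" for P
  proof -
    obtain \<rho> where "P \<rho>" using 0(4)[of "{P}"] \<open>P \<in> \<Sigma>\<close> by blast
    then show ?thesis using 0(3)[OF \<open>P \<in> \<Sigma>\<close>, of "\<lambda>_. 0" \<rho>] by simp
  qed
  then show ?case by blast
next
  case (Suc n)
  define T where "T \<Sigma>0 \<rho> \<longleftrightarrow> (\<exists>\<sigma>. \<forall>P\<in>\<Sigma>0. P (\<lambda>i. if i \<in> {..<n} then \<sigma> i else \<rho> i))"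
    for \<Sigma>0 :: "((nat \<Rightarrow> 'k) \<Rightarrow> bool) set" and \<rho>
  have T: "dpair id A (T \<Sigma>0) (T \<Sigma>0)" if "finite \<Sigma>0" "\<Sigma>0 \<subseteq> \<Sigma>" for \<Sigma>0
  proof -
    have "dpair id A (\<lambda>\<rho>. \<forall>P\<in>\<Sigma>0. P \<rho>) (\<lambda>\<rho>. \<forall>P\<in>\<Sigma>0. P \<rho>)"
      by (rule dp_ball) (use that Suc.prems(2) in blast)+
    from dp_ex_block[OF finite_lessThan this, of n] show ?thesis by (simp add: T_def[abs_def])
  qed
  define \<Phi> where "\<Phi> = {\<phi>. set_fm \<phi> \<subseteq> A \<and> (\<exists>\<Sigma>0. finite \<Sigma>0 \<and> \<Sigma>0 \<subseteq> \<Sigma> \<and> sat \<phi> = T \<Sigma>0)}"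
  have "\<exists>x. \<forall>\<phi>\<in>\<Phi>. sat \<phi> (\<lambda>_. x)"
  proof (rule sat[unfolded saturated_2aleph0_plus_def, rule_format])
    show "\<exists>f :: 'k \<Rightarrow> real. inj_on f A" by (rule Suc.prems(1))
    show "set_fm \<phi> \<subseteq> A" if "\<phi> \<in> \<Phi>" for \<phi> using that by (simp add: \<Phi>_def)
    fix \<Phi>0 assume \<Phi>0: "finite \<Phi>0 \<and> \<Phi>0 \<subseteq> \<Phi>"
    then have "\<forall>\<phi>\<in>\<Phi>0. \<exists>\<Sigma>0. finite \<Sigma>0 \<and> \<Sigma>0 \<subseteq> \<Sigma> \<and> sat \<phi> = T \<Sigma>0" by (auto simp: \<Phi>_def)
    then obtain F where F: "\<And>\<phi>. \<phi> \<in> \<Phi>0 \<Longrightarrow> finite (F \<phi>) \<and> F \<phi> \<subseteq> \<Sigma> \<and> sat \<phi> = T (F \<phi>)" by metis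
    have "finite (\<Union>(F ` \<Phi>0))" "\<Union>(F ` \<Phi>0) \<subseteq> \<Sigma>" using F \<Phi>0 by auto
    then obtain \<rho> where \<rho>: "\<forall>P\<in>\<Union>(F ` \<Phi>0). P \<rho>" using Suc.prems(4) by blast
    have "sat \<phi> (\<lambda>_. \<rho> n)" if phi: "\<phi> \<in> \<Phi>0" for \<phi>
    proof -
      have "P (\<lambda>i. if i \<in> {..<n} then \<rho> i else \<rho> n)" if "P \<in> F \<phi>" for P
      proof -
        have "P \<in> \<Sigma>" using F phi that by blast
        then have "P (\<lambda>i. if i \<in> {..<n} then \<rho> i else \<rho> n) = P \<rho>"
          by (rule Suc.prems(3)) (auto simp: less_Suc_eq)
        then show ?thesis using \<rho> phi that by blast
      qed
      then have "T (F \<phi>) (\<lambda>_. \<rho> n)" unfolding T_def by blast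
      then show ?thesis using F[OF phi] by simp
    qed
    then show "\<exists>x. \<forall>\<phi>\<in>\<Phi>0. sat \<phi> (\<lambda>_. x)" by blast
  qed
  then obtain x where x: "\<And>\<phi>. \<phi> \<in> \<Phi> \<Longrightarrow> sat \<phi> (\<lambda>_. x)" by blast
  have Tx: "T \<Sigma>0 (\<lambda>_. x)" if S0: "finite \<Sigma>0" "\<Sigma>0 \<subseteq> \<Sigma>" for \<Sigma>0
  proof -
    obtain \<phi> where phi: "set_fm \<phi> \<subseteq> A" "T \<Sigma>0 = sat \<phi>" using T[OF S0] unfolding dpair_def by blast
    then have "\<phi> \<in> \<Phi>" using S0 unfolding \<Phi>_def by auto
    then show ?thesis using x phi by simp
  qed
  define U where "U P \<rho> = P (\<rho>(n := x))" for P :: "(nat \<Rightarrow> 'k) \<Rightarrow> bool" and \<rho>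
  have "\<exists>\<rho>. \<forall>P\<in>U ` \<Sigma>. P \<rho>"
  proof (rule Suc.IH)
    show "\<exists>f :: 'k \<Rightarrow> real. inj_on f (insert x A)" by (rule small_insert[OF Suc.prems(1)])
    fix P assume "P \<in> U ` \<Sigma>"
    then obtain P0 where P0: "P0 \<in> \<Sigma>" "P = U P0" by blast
    have "dpair id (insert x A) P0 P0" using dpair_mono[OF Suc.prems(2)[OF P0(1)]] by blast
    then have "dpair id (insert x A) (\<lambda>\<rho>. P0 (\<lambda>i. (if i = n then (\<lambda>\<rho>. x) else (\<lambda>\<rho>. \<rho> i)) \<rho>))
       (\<lambda>\<rho>. P0 (\<lambda>i. (if i = n then (\<lambda>\<rho>. x) else (\<lambda>\<rho>. \<rho> i)) \<rho>))"
      by (rule dp_subst) (use dt_const[of x "insert x A" id] dt_var in \<open>auto\<close>)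
    moreover have "(\<lambda>\<rho>. P0 (\<lambda>i. (if i = n then (\<lambda>\<rho>. x) else (\<lambda>\<rho>. \<rho> i)) \<rho>)) = P"
      by (auto simp: P0(2) U_def fun_eq_iff intro!: arg_cong[of _ _ P0])
    ultimately show "dpair id (insert x A) P P" by simp
    fix \<rho> \<sigma> :: "nat \<Rightarrow> 'k" assume "\<And>i. i < n \<Longrightarrow> \<rho> i = \<sigma> i"
    then show "P \<rho> = P \<sigma>" unfolding P0(2) U_def
      by (intro Suc.prems(3)[OF P0(1)]) (auto simp: less_Suc_eq)
  next
    fix \<Sigma>1 assume "finite \<Sigma>1" "\<Sigma>1 \<subseteq> U ` \<Sigma>"
    then obtain \<Sigma>0 where S0: "\<Sigma>0 \<subseteq> \<Sigma>" "finite \<Sigma>0" "\<Sigma>1 = U ` \<Sigma>0" using finite_subset_image by metis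
    obtain \<sigma> where \<sigma>: "\<forall>P\<in>\<Sigma>0. P (\<lambda>i. if i \<in> {..<n} then \<sigma> i else x)"
      using Tx[OF S0(2,1)] by (auto simp: T_def)
    have "U P \<sigma>" if P: "P \<in> \<Sigma>0" for P
    proof -
      have "P (\<sigma>(n := x)) = P (\<lambda>i. if i \<in> {..<n} then \<sigma> i else x)"
        by (rule Suc.prems(3)) (use P S0 in \<open>auto simp: less_Suc_eq\<close>)
      then show ?thesis using \<sigma> P unfolding U_def by blast
    qed
    then show "\<exists>\<rho>. \<forall>P\<in>\<Sigma>1. P \<rho>" using S0 by blast
  qed
  then show ?case by (auto simp: U_def)
qed

section \<open>Quantifier elimination\<close>

lemma psim_pw: "psim N x y \<Longrightarrow> pw N x \<longleftrightarrow> pw N y"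
  using pw_power_mult unfolding psim_def by blast

text \<open>Boolean combinations of the atoms of Macintyre's language; valuation conditions are
  included through \<open>V_iff_square\<close>. Both fields are kept side by side, so that
  elimination in K also describes sets in the p-adic field.\<close>

inductive qf :: "('q::field \<Rightarrow> 'k::field) \<Rightarrow> ((nat \<Rightarrow> 'q) \<Rightarrow> bool) \<Rightarrow> ((nat \<Rightarrow> 'k) \<Rightarrow> bool) \<Rightarrow> bool"
  for e where
  zero: "dterm e UNIV s s' \<Longrightarrow> qf e (\<lambda>\<rho>. s \<rho> = 0) (\<lambda>\<rho>. s' \<rho> = 0)"
| power: "0 < N \<Longrightarrow> dterm e UNIV s s' \<Longrightarrow> qf e (\<lambda>\<rho>. pw N (s \<rho>)) (\<lambda>\<rho>. pw N (s' \<rho>))"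
| neg: "qf e P P' \<Longrightarrow> qf e (\<lambda>\<rho>. \<not> P \<rho>) (\<lambda>\<rho>. \<not> P' \<rho>)"
| conj: "qf e P P' \<Longrightarrow> qf e Q Q' \<Longrightarrow> qf e (\<lambda>\<rho>. P \<rho> \<and> Q \<rho>) (\<lambda>\<rho>. P' \<rho> \<and> Q' \<rho>)"

lemma qf_dpair: "qf e P P' \<Longrightarrow> dpair e UNIV P P'"
  by (induction rule: qf.induct) (intro dp_eq dp_pw dp_not dp_and dt_zero; assumption)+

lemma qf_subst:
  assumes "qf e P P'" "\<And>i. dterm e UNIV (r i) (r' i)"
  shows "qf e (\<lambda>\<rho>. P (\<lambda>i. r i \<rho>)) (\<lambda>\<rho>. P' (\<lambda>i. r' i \<rho>))"
  using assms(1)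
proof (induction rule: qf.induct)
  case (zero s s')
  from qf.zero[OF dt_subst[OF zero assms(2)]] show ?case .
next
  case (power N s s')
  from qf.power[OF power(1) dt_subst[OF power(2) assms(2)]] show ?case .
next
  case (neg P P')
  from qf.neg[OF neg.IH] show ?case .
next
  case (conj P P' Q Q')
  from qf.conj[OF conj.IH] show ?case .
qed

lemma qf_ball:
  "finite S \<Longrightarrow> (\<And>Q'. Q' \<in> S \<Longrightarrow> \<exists>Q. qf e Q Q') \<Longrightarrow> \<exists>Q. qf e Q (\<lambda>\<rho>. \<forall>Q'\<in>S. Q' \<rho>)"
proof (induction S rule: finite_induct)
  case empty
  then show ?case using qf.zero[OF dt_zero, of e] by auto
next
  case (insert P' S)
  obtain P where P: "qf e P P'" using insert.prems by blast
  obtain Q where Q: "qf e Q (\<lambda>\<rho>. \<forall>Q'\<in>S. Q' \<rho>)" using insert.IH insert.prems by blast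
  from qf.conj[OF P Q] show ?case by auto
qed

section \<open>One step of quantifier elimination\<close>

context pclosed
begin

context
  fixes e :: "'q::field \<Rightarrow> 'k" and \<rho> \<sigma> :: "nat \<Rightarrow> 'k"
  assumes agree: "\<And>P P'. qf e P P' \<Longrightarrow> P' \<rho> = P' \<sigma>"
begin

lemma pmap_of_agree:
  "\<exists>R. pmap R \<and> (\<forall>s s'. dterm e UNIV s s' \<longrightarrow> (s' \<rho>, s' \<sigma>) \<in> R)"
proof -
  define S where "S = {(s' \<rho>, s' \<sigma>) | s s'. dterm e UNIV s s'}"
  have I: "(a, b) \<in> S" if "dterm e UNIV s s'" "a = s' \<rho>" "b = s' \<sigma>" for a b s s'
    using that unfolding S_def by blast
  have E: "\<exists>s s'. a = s' \<rho> \<and> b = s' \<sigma> \<and> dterm e UNIV s s'" if "(a, b) \<in> S" for a b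
    using that unfolding S_def by blast
  have "\<exists>R. pmap R \<and> S \<subseteq> R"
  proof (rule pmap_fractions)
    show "(1, 1) \<in> S" by (rule I[OF dt_one]) auto
    show "(a - b, a' - b') \<in> S" "(a * b, a' * b') \<in> S" if ab: "(a, a') \<in> S" "(b, b') \<in> S" for a a' b b'
    proof -
      obtain s s' where s: "a = s' \<rho>" "a' = s' \<sigma>" "dterm e UNIV s s'" using E[OF ab(1)] by blast
      obtain t t' where t: "b = t' \<rho>" "b' = t' \<sigma>" "dterm e UNIV t t'" using E[OF ab(2)] by blast
      show "(a - b, a' - b') \<in> S" "(a * b, a' * b') \<in> S"
        using I[OF dt_diff[OF s(3) t(3)]] I[OF dt_mult[OF s(3) t(3)]] s t by simp_all
    qed
    fix a a' assume "(a, a') \<in> S"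
    then obtain s s' where s: "a = s' \<rho>" "a' = s' \<sigma>" "dterm e UNIV s s'" using E by blast
    show "a = 0 \<longleftrightarrow> a' = 0" unfolding s(1,2) by (rule agree[OF qf.zero[OF s(3)]])
    show "pw N a \<longleftrightarrow> pw N a'" if "0 < N" for N unfolding s(1,2) by (rule agree[OF qf.power[OF that s(3)]])
  qed
  then obtain R where R: "pmap R" "S \<subseteq> R" by blast
  have "(s' \<rho>, s' \<sigma>) \<in> R" if "dterm e UNIV s s'" for s s'
    using I[OF that refl refl] R(2) by (rule rev_subsetD)
  then show ?thesis using R(1) by blast
qed

lemma dterm_poly:
  assumes R: "pmap R" "\<And>s s'. dterm e UNIV s s' \<Longrightarrow> (s' \<rho>, s' \<sigma>) \<in> R" and t: "dterm e UNIV t t'"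
  shows "\<exists>g h. rpoly R g h \<and> (\<forall>x. t' (\<rho>(n := x)) = poly g x) \<and> (\<forall>x. t' (\<sigma>(n := x)) = poly h x)"
proof -
  obtain \<tau> where "t' = eval (map_tm e \<tau>)" using t by (auto simp: dterm_def)
  moreover have "\<exists>g h. rpoly R g h \<and> (\<forall>x. eval (map_tm e \<tau>) (\<rho>(n := x)) = poly g x) \<and>
     (\<forall>x. eval (map_tm e \<tau>) (\<sigma>(n := x)) = poly h x)"
  proof (induction \<tau>)
    case (Var i)
    show ?case
    proof (cases "i = n")
      case True
      then show ?thesis
        by (intro exI[of _ "[:0, 1:]"]) (auto simp: rpoly_pCons rpoly_0[OF R(1)] pmap_closed[OF R(1)])
    next
      case False
      then show ?thesis using R(2)[OF dt_var[of e UNIV i]]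
        by (intro exI[of _ "[:\<rho> i:]"] exI[of _ "[:\<sigma> i:]"]) (auto simp: rpoly_pCons rpoly_0[OF R(1)])
    qed
  next
    case (Cst c)
    show ?case using R(2)[OF dt_const[of c UNIV e]]
      by (intro exI[of _ "[:e c:]"]) (auto simp: rpoly_pCons rpoly_0[OF R(1)])
  next
    case Zero
    show ?case by (intro exI[of _ 0]) (auto simp: rpoly_0[OF R(1)])
  next
    case One
    show ?case by (intro exI[of _ 1]) (auto simp: rpoly_one[OF R(1)])
  next
    case (Add s t)
    then show ?case using rpoly_add[OF R(1)] by simp (metis poly_add)
  next
    case (Mul s t)
    then show ?case using rpoly_mult[OF R(1)] by simp (metis poly_mult)
  next
    case (Minus s)
    then obtain g h where "rpoly R g h" "\<forall>x. eval (map_tm e s) (\<rho>(n := x)) = poly g x"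
      "\<forall>x. eval (map_tm e s) (\<sigma>(n := x)) = poly h x" by blast
    then have "\<forall>x. eval (map_tm e (Minus s)) (\<rho>(n := x)) = poly (0 - g) x"
      "\<forall>x. eval (map_tm e (Minus s)) (\<sigma>(n := x)) = poly (0 - h) x" by simp_all
    then show ?case using rpoly_diff[OF R(1) rpoly_0[OF R(1)] \<open>rpoly R g h\<close>] by blast
  qed
  ultimately show ?thesis by simp
qed

text \<open>The image of a itself is not constructed. The formula involves finitely many
  polynomials, which by \<open>relclosed_approx\<close> take on some t in the domain the same power
  classes as at a; the image b of t then satisfies the formula over \<sigma>.\<close>

lemma qf_realized:
  assumes P: "qf e P P'" and a: "P' (\<rho>(n := a))" shows "\<exists>b. P' (\<sigma>(n := b))"
proof -
  obtain R0 where R0: "pmap R0" "\<And>s s'. dterm e UNIV s s' \<Longrightarrow> (s' \<rho>, s' \<sigma>) \<in> R0"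
    using pmap_of_agree by blast
  obtain R where R: "pmap R" "R0 \<subseteq> R" "relclosed (Domain R)" using pmap_relclosed[OF R0(1)] by blast
  have dt: "\<exists>g h. rpoly R g h \<and> (\<forall>x. t' (\<rho>(n := x)) = poly g x) \<and> (\<forall>x. t' (\<sigma>(n := x)) = poly h x)"
    if "dterm e UNIV t t'" for t t'
    by (rule dterm_poly[OF R(1) _ that]) (use R0(2) R(2) in blast)
  have "\<exists>G N. finite G \<and> (\<forall>g\<in>G. polys (Domain R) g) \<and> 0 < N \<and>
    (\<forall>a t b. (\<forall>g\<in>G. psim N (poly g t) (poly g a)) \<longrightarrow> (t, b) \<in> R \<longrightarrow> P' (\<sigma>(n := b)) = P' (\<rho>(n := a)))"
    using P
  proof (induction rule: qf.induct)
    case (zero s s')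
    obtain g h where g: "rpoly R g h" "\<And>x. s' (\<rho>(n := x)) = poly g x" "\<And>x. s' (\<sigma>(n := x)) = poly h x"
      using dt[OF zero] by blast
    show ?case
    proof (intro exI[of _ "{g}"] exI[of _ 1] conjI allI impI)
      fix a t b assume "\<forall>g\<in>{g}. psim 1 (poly g t) (poly g a)" "(t, b) \<in> R"
      then have "poly g t = 0 \<longleftrightarrow> poly g a = 0" "(poly g t, poly h b) \<in> R"
        using rpoly_poly[OF R(1) g(1)] by (auto simp: psim_def)
      then show "(s' (\<sigma>(n := b)) = 0) = (s' (\<rho>(n := a)) = 0)"
        using pmap_zero_iff[OF R(1)] by (simp add: g)
    qed (use rpoly_polys[OF g(1)] in auto)
  next
    case (power N s s')
    obtain g h where g: "rpoly R g h" "\<And>x. s' (\<rho>(n := x)) = poly g x" "\<And>x. s' (\<sigma>(n := x)) = poly h x"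
      using dt[OF power(2)] by blast
    show ?case
    proof (intro exI[of _ "{g}"] exI[of _ N] conjI allI impI)
      fix a t b assume "\<forall>g\<in>{g}. psim N (poly g t) (poly g a)" "(t, b) \<in> R"
      then have "pw N (poly g t) \<longleftrightarrow> pw N (poly g a)" "(poly g t, poly h b) \<in> R"
        using rpoly_poly[OF R(1) g(1)] psim_pw[of N "poly g t" "poly g a"] by simp_all
      then show "pw N (s' (\<sigma>(n := b))) = pw N (s' (\<rho>(n := a)))"
        using pmap_pw[OF R(1) _ power(1)] by (simp add: g)
    qed (use rpoly_polys[OF g(1)] power(1) in auto)
  next
    case (neg P P')
    then show ?case by blast
  next
    case (conj P P' Q Q')
    obtain G1 N1 where 1: "finite G1" "\<forall>g\<in>G1. polys (Domain R) g" "0 < N1"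
      "\<And>a t b. \<forall>g\<in>G1. psim N1 (poly g t) (poly g a) \<Longrightarrow> (t, b) \<in> R \<Longrightarrow> P' (\<sigma>(n := b)) = P' (\<rho>(n := a))"
      using conj.IH(1) by blast
    obtain G2 N2 where 2: "finite G2" "\<forall>g\<in>G2. polys (Domain R) g" "0 < N2"
      "\<And>a t b. \<forall>g\<in>G2. psim N2 (poly g t) (poly g a) \<Longrightarrow> (t, b) \<in> R \<Longrightarrow> Q' (\<sigma>(n := b)) = Q' (\<rho>(n := a))"
      using conj.IH(2) by blast
    have ps: "psim N1 x y" "psim N2 x y" if xy: "psim (N1 * N2) x y" for x y :: 'k
    proof -
      obtain r where r: "r \<noteq> 0" "x = r ^ (N1 * N2) * y" using xy by (auto simp: psim_def)
      have "x = (r ^ N2) ^ N1 * y" "x = (r ^ N1) ^ N2 * y"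
        using r by (simp_all add: mult.commute flip: power_mult)
      then show "psim N1 x y" "psim N2 x y" unfolding psim_def using r(1) power_not_zero by blast+
    qed
    show ?case
    proof (intro exI[of _ "G1 \<union> G2"] exI[of _ "N1 * N2"] conjI allI impI)
      fix a t b
      assume "\<forall>g\<in>G1 \<union> G2. psim (N1 * N2) (poly g t) (poly g a)" "(t, b) \<in> R"
      then have "P' (\<sigma>(n := b)) = P' (\<rho>(n := a))" "Q' (\<sigma>(n := b)) = Q' (\<rho>(n := a))"
        using 1(4)[of t a b] 2(4)[of t a b] ps by blast+
      then show "(P' (\<sigma>(n := b)) \<and> Q' (\<sigma>(n := b))) = (P' (\<rho>(n := a)) \<and> Q' (\<rho>(n := a)))" by simp
    qed (use 1 2 in auto)
  qed
  then obtain G N where G: "finite G" "\<And>g. g \<in> G \<Longrightarrow> polys (Domain R) g" "0 < N"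
    "\<And>a t b. \<forall>g\<in>G. psim N (poly g t) (poly g a) \<Longrightarrow> (t, b) \<in> R \<Longrightarrow> P' (\<sigma>(n := b)) = P' (\<rho>(n := a))"
    by blast
  have "\<exists>t\<in>Domain R. \<forall>g\<in>G. psim N (poly g t) (poly g a)"
  proof (cases "a \<in> Domain R")
    case True
    then show ?thesis using psim_refl by blast
  next
    case False
    then show ?thesis using relclosed_approx[OF R(3) G(1,2,3)] by blast
  qed
  then obtain t b where "(t, b) \<in> R" "\<forall>g\<in>G. psim N (poly g t) (poly g a)" by blast
  then show ?thesis using G(4) a by blast
qed

end

end

text \<open>If \<theta>' did not follow from finitely many of its quantifier-free consequences,
  compactness would give a point \<sigma> with all of them but without \<theta>'. By compactness
  again the quantifier-free type of \<sigma> is consistent with \<theta>', realized at some \<rho>.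
  The two points agree on all of \<open>qf\<close>, contradicting the hypothesis.\<close>

lemma qf_separation:
  fixes e :: "'q::field \<Rightarrow> 'k::field"
  assumes sat: "saturated_2aleph0_plus TYPE('k)" and small: "\<exists>f :: 'k \<Rightarrow> real. inj_on f (range e)"
    and \<theta>: "dpair e UNIV \<theta> \<theta>'"
    and agree: "\<And>\<rho> \<sigma>. (\<And>Q Q'. qf e Q Q' \<Longrightarrow> Q' \<rho> = Q' \<sigma>) \<Longrightarrow> \<theta>' \<rho> \<Longrightarrow> \<theta>' \<sigma>"
  shows "\<exists>Q. qf e Q \<theta>'"
proof -
  obtain m where m: "\<And>\<rho> \<sigma>. \<forall>i<m. \<rho> i = \<sigma> i \<Longrightarrow> \<theta>' \<rho> = \<theta>' \<sigma>" using dpair_cong(2)[OF \<theta>] by blast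
  \<comment> \<open>Types control only the first m variables. Truncation extends agreement to all
    quantifier-free predicates.\<close>
  define tr where "tr \<rho> i = (if i < m then \<rho> i else 0)" for \<rho> :: "nat \<Rightarrow> 'k" and i
  define B where "B = {Q'. (\<exists>Q. qf e Q Q') \<and> (\<forall>\<rho> \<sigma>. (\<forall>i<m. \<rho> i = \<sigma> i) \<longrightarrow> Q' \<rho> = Q' \<sigma>)}"
  have Bneg: "(\<lambda>\<rho>. \<not> Q' \<rho>) \<in> B" if "Q' \<in> B" for Q' using that qf.neg unfolding B_def by blast
  have Bconj: "(\<lambda>\<rho>. \<forall>Q'\<in>S. Q' \<rho>) \<in> B" if "finite S" "S \<subseteq> B" for S
    using that qf_ball[of S e] unfolding B_def by blast
  have dB: "dpair id (range e) Q' Q'" if "Q' \<in> B" for Q'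
    using that dpair_image[OF qf_dpair] unfolding B_def by blast
  have dth: "dpair id (range e) \<theta>' \<theta>'" by (rule dpair_image[OF \<theta>])
  define \<Gamma> where "\<Gamma> = {Q' \<in> B. \<forall>\<rho>. \<theta>' \<rho> \<longrightarrow> Q' \<rho>}"
  have types: "\<exists>\<rho>. \<forall>P\<in>\<Sigma>. P \<rho>"
    if "\<Sigma> \<subseteq> B \<union> {\<theta>', \<lambda>\<rho>. \<not> \<theta>' \<rho>}" "\<And>\<Sigma>0. finite \<Sigma>0 \<Longrightarrow> \<Sigma>0 \<subseteq> \<Sigma> \<Longrightarrow> \<exists>\<rho>. \<forall>P\<in>\<Sigma>0. P \<rho>" for \<Sigma>
  proof (rule saturated_types[OF sat small, where n = m])
    show "dpair id (range e) P P" if "P \<in> \<Sigma>" for P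
    proof -
      have "P \<in> B \<or> P = \<theta>' \<or> P = (\<lambda>\<rho>. \<not> \<theta>' \<rho>)" using that \<open>\<Sigma> \<subseteq> _\<close> by blast
      then show ?thesis using dB dth dp_not[OF dth] by (elim disjE) simp_all
    qed
    show "P \<rho> = P \<sigma>" if "P \<in> \<Sigma>" "\<And>i. i < m \<Longrightarrow> \<rho> i = \<sigma> i" for P \<rho> \<sigma>
    proof -
      have th: "\<theta>' \<rho> = \<theta>' \<sigma>" using m that(2) by blast
      have "P \<in> B \<or> P = \<theta>' \<or> P = (\<lambda>\<rho>. \<not> \<theta>' \<rho>)" using that(1) \<open>\<Sigma> \<subseteq> _\<close> by blast
      then show ?thesis
      proof (elim disjE)
        assume "P \<in> B"
        then show ?thesis using that(2) unfolding B_def by blast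
      qed (simp_all add: th)
    qed
  qed (use that in blast)
  have "\<exists>\<Sigma>0. finite \<Sigma>0 \<and> \<Sigma>0 \<subseteq> insert (\<lambda>\<rho>. \<not> \<theta>' \<rho>) \<Gamma> \<and> \<not> (\<exists>\<rho>. \<forall>P\<in>\<Sigma>0. P \<rho>)"
  proof (rule ccontr)
    assume nex: "\<not> ?thesis"
    have "\<exists>\<rho>. \<forall>P\<in>insert (\<lambda>\<rho>. \<not> \<theta>' \<rho>) \<Gamma>. P \<rho>"
      by (rule types) (use nex in \<open>auto simp: \<Gamma>_def\<close>)
    then obtain \<sigma> where s: "\<forall>P\<in>insert (\<lambda>\<rho>. \<not> \<theta>' \<rho>) \<Gamma>. P \<sigma>" by (rule exE)
    have \<sigma>: "\<not> \<theta>' \<sigma>" "\<And>Q'. Q' \<in> \<Gamma> \<Longrightarrow> Q' \<sigma>" using s by auto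
    define \<Delta> where "\<Delta> = {Q' \<in> B. Q' \<sigma>}"
    have "\<exists>\<rho>. \<forall>P\<in>insert \<theta>' \<Delta>. P \<rho>"
    proof (rule types)
      show "insert \<theta>' \<Delta> \<subseteq> B \<union> {\<theta>', \<lambda>\<rho>. \<not> \<theta>' \<rho>}" by (auto simp: \<Delta>_def)
      fix \<Sigma>0 assume S0: "finite \<Sigma>0" "\<Sigma>0 \<subseteq> insert \<theta>' \<Delta>"
      define S where "S = \<Sigma>0 \<inter> \<Delta>"
      have S: "finite S" "S \<subseteq> B" "\<forall>Q'\<in>S. Q' \<sigma>" using S0 by (auto simp: S_def \<Delta>_def)
      show "\<exists>\<rho>. \<forall>P\<in>\<Sigma>0. P \<rho>"
      proof (rule ccontr)
        assume no: "\<not> ?thesis"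
        have "\<theta>' \<rho> \<longrightarrow> \<not> (\<forall>Q'\<in>S. Q' \<rho>)" for \<rho>
        proof (intro impI notI)
          assume "\<theta>' \<rho>" "\<forall>Q'\<in>S. Q' \<rho>"
          then have "\<forall>P\<in>\<Sigma>0. P \<rho>" using S0(2) by (auto simp: S_def)
          then show False using no by blast
        qed
        then have "(\<lambda>\<rho>. \<not> (\<forall>Q'\<in>S. Q' \<rho>)) \<in> \<Gamma>" using Bneg[OF Bconj[OF S(1,2)]] by (simp add: \<Gamma>_def)
        then show False using \<sigma>(2) S(3) by blast
      qed
    qed
    then obtain \<rho> where r: "\<forall>P\<in>insert \<theta>' \<Delta>. P \<rho>" by (rule exE)
    have \<rho>: "\<theta>' \<rho>" "\<And>Q'. Q' \<in> B \<Longrightarrow> Q' \<sigma> \<Longrightarrow> Q' \<rho>" using r by (auto simp: \<Delta>_def)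
    have "\<theta>' (tr \<sigma>)"
    proof (rule agree)
      show "\<theta>' (tr \<rho>)" using \<rho>(1) m[of \<rho> "tr \<rho>"] by (simp add: tr_def)
      fix Q Q' assume Q: "qf e Q Q'"
      have d: "dterm e UNIV (\<lambda>\<rho>. if i < m then \<rho> i else 0) (\<lambda>\<rho>. if i < m then \<rho> i else 0)" for i
        by (cases "i < m") (auto intro: dt_var dt_zero)
      have "qf e (\<lambda>\<rho>. Q (\<lambda>i. if i < m then \<rho> i else 0)) (\<lambda>\<rho>. Q' (\<lambda>i. if i < m then \<rho> i else 0))"
        by (rule qf_subst[OF Q d])
      then have "(\<lambda>\<rho>. Q' (tr \<rho>)) \<in> B"
        unfolding B_def tr_def[abs_def] by (auto intro!: arg_cong[of _ _ Q'])
      then show "Q' (tr \<rho>) = Q' (tr \<sigma>)" using \<rho>(2) Bneg by blast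
    qed
    then have "\<theta>' \<sigma>" using m[of \<sigma> "tr \<sigma>"] by (simp add: tr_def)
    then show False using \<sigma>(1) by simp
  qed
  then obtain \<Sigma>0 where S0: "finite \<Sigma>0" "\<Sigma>0 \<subseteq> insert (\<lambda>\<rho>. \<not> \<theta>' \<rho>) \<Gamma>" "\<not> (\<exists>\<rho>. \<forall>P\<in>\<Sigma>0. P \<rho>)" by blast
  define S where "S = \<Sigma>0 \<inter> \<Gamma>"
  have S: "finite S" "S \<subseteq> B" "\<And>Q' \<rho>. Q' \<in> S \<Longrightarrow> \<theta>' \<rho> \<Longrightarrow> Q' \<rho>" using S0 by (auto simp: S_def \<Gamma>_def)
  have "\<theta>' = (\<lambda>\<rho>. \<forall>Q'\<in>S. Q' \<rho>)"
  proof (intro ext iffI)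
    fix \<rho> assume *: "\<forall>Q'\<in>S. Q' \<rho>"
    show "\<theta>' \<rho>"
    proof (rule ccontr)
      assume "\<not> \<theta>' \<rho>"
      then have "\<forall>P\<in>\<Sigma>0. P \<rho>" using S0(2) * by (auto simp: S_def)
      then show False using S0(3) by blast
    qed
  qed (use S in blast)
  then show ?thesis using Bconj[OF S(1,2)] unfolding B_def by auto
qed

theorem quantifier_elimination:
  fixes e :: "'q::field \<Rightarrow> 'k::field" and W :: "'k set"
  assumes e: "elementary_embedding e" and K: "pclosed W p"
    and sat: "saturated_2aleph0_plus TYPE('k)" and small: "\<exists>f :: 'k \<Rightarrow> real. inj_on f (range e)"
  shows "qf e (sat \<phi>) (sat (map_fm e \<phi>))"
proof -
  interpret K: pclosed W p by (rule K)
  \<comment> \<open>\<open>qf_separation\<close> determines only the predicate on K; elementarity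
    identifies its partner with the original formula.\<close>
  have *: "qf e (sat \<psi>) (sat (map_fm e \<psi>))" if "qf e Q (sat (map_fm e \<psi>))" for Q \<psi>
  proof -
    have "Q \<rho> = sat \<psi> \<rho>" for \<rho>
      using dpair_transfer[OF e qf_dpair[OF that]] e unfolding elementary_embedding_def by blast
    then have "Q = sat \<psi>" by blast
    then show ?thesis using that by simp
  qed
  show ?thesis
  proof (induction \<phi>)
    case (Eq s t)
    have "dterm e UNIV (eval s) (eval (map_tm e s))" "dterm e UNIV (eval t) (eval (map_tm e t))"
      by (auto simp: dterm_def)
    from qf.zero[OF dt_diff[OF this]] have "qf e (\<lambda>\<rho>. eval s \<rho> = eval t \<rho>)
        (\<lambda>\<rho>. eval (map_tm e s) \<rho> = eval (map_tm e t) \<rho>)" by simp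
    then show ?case by (simp add: fun_eq_iff)
  next
    case (FNot \<phi>)
    from qf.neg[OF this] show ?case by (simp add: fun_eq_iff)
  next
    case (FAnd \<phi> \<psi>)
    from qf.conj[OF this] show ?case by (simp add: fun_eq_iff)
  next
    case (FEx n \<phi>)
    have "\<exists>Q. qf e Q (sat (map_fm e (FEx n \<phi>)))"
    proof (rule qf_separation[OF sat small dpair_sat])
      fix \<rho> \<sigma> :: "nat \<Rightarrow> 'k"
      assume ag: "\<And>Q Q'. qf e Q Q' \<Longrightarrow> Q' \<rho> = Q' \<sigma>" and "sat (map_fm e (FEx n \<phi>)) \<rho>"
      then obtain a where a: "sat (map_fm e \<phi>) (\<rho>(n := a))" by auto
      have "\<exists>b. sat (map_fm e \<phi>) (\<sigma>(n := b))"
      proof (rule K.qf_realized[of e \<rho> \<sigma>])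
        show "Q' \<rho> = Q' \<sigma>" if "qf e Q Q'" for Q Q' by (rule ag[OF that])
      qed (fact FEx a)+
      then show "sat (map_fm e (FEx n \<phi>)) \<sigma>" by simp
    qed
    then show ?case using * by blast
  qed
qed

section \<open>Tracing definable sets by balls\<close>

context padic
begin

text \<open>For products, s t - s' t' is s dt + t ds - ds dt. The exponents B and C bound the
  denominators of the values at \<rho>, and the required precisions of the factors are raised by
  them.\<close>

lemma dterm_continuous:
  fixes e :: "'q \<Rightarrow> 'k::field"
  assumes "dterm e A s s'"
  shows "\<exists>K. \<forall>\<sigma>. (\<forall>i. vle (\<pi> ^ K) (\<rho> i - \<sigma> i)) \<longrightarrow> vle (\<pi> ^ M) (s \<rho> - s \<sigma>)"
proof -
  obtain t where t: "s = eval t" using assms by (auto simp: dterm_def)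
  have both: "\<exists>K. \<forall>\<sigma>. (\<forall>i. vle (\<pi> ^ K) (\<rho> i - \<sigma> i)) \<longrightarrow> P \<sigma> \<and> Q \<sigma>"
    if ex: "\<exists>K. \<forall>\<sigma>. (\<forall>i. vle (\<pi> ^ K) (\<rho> i - \<sigma> i)) \<longrightarrow> P \<sigma>"
      "\<exists>K. \<forall>\<sigma>. (\<forall>i. vle (\<pi> ^ K) (\<rho> i - \<sigma> i)) \<longrightarrow> Q \<sigma>" for P Q
  proof -
    obtain K L where KL: "\<And>\<sigma>. \<forall>i. vle (\<pi> ^ K) (\<rho> i - \<sigma> i) \<Longrightarrow> P \<sigma>"
      "\<And>\<sigma>. \<forall>i. vle (\<pi> ^ L) (\<rho> i - \<sigma> i) \<Longrightarrow> Q \<sigma>" using ex by blast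
    have "P \<sigma> \<and> Q \<sigma>" if "\<forall>i. vle (\<pi> ^ max K L) (\<rho> i - \<sigma> i)" for \<sigma>
      using KL vle_trans[OF vle_pi_power, of _ "max K L"] that by simp
    then show ?thesis by blast
  qed
  have "\<exists>K. \<forall>\<sigma>. (\<forall>i. vle (\<pi> ^ K) (\<rho> i - \<sigma> i)) \<longrightarrow> vle (\<pi> ^ M) (eval t \<rho> - eval t \<sigma>)" for M
  proof (induction t arbitrary: M)
    case (Add s t)
    have "vle (\<pi> ^ M) ((eval s \<rho> - eval s \<sigma>) + (eval t \<rho> - eval t \<sigma>))"
      if "vle (\<pi> ^ M) (eval s \<rho> - eval s \<sigma>) \<and> vle (\<pi> ^ M) (eval t \<rho> - eval t \<sigma>)" for \<sigma>
      using that vle_add by blast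
    then show ?case using both[OF Add.IH(1)[of M] Add.IH(2)[of M]] unfolding eval.simps add_diff_add by blast
  next
    case (Mul s t)
    obtain B C where BC: "eval s \<rho> * \<pi> ^ B \<in> val_ring val" "eval t \<rho> * \<pi> ^ C \<in> val_ring val"
      using bounded_denom by metis
    have *: "vle (\<pi> ^ M) (eval s \<rho> * eval t \<rho> - eval s \<sigma> * eval t \<sigma>)"
      if st: "vle (\<pi> ^ (M + C)) (eval s \<rho> - eval s \<sigma>) \<and> vle (\<pi> ^ (M + B)) (eval t \<rho> - eval t \<sigma>)" for \<sigma>
    proof -
      obtain u v where u: "eval s \<rho> - eval s \<sigma> = \<pi> ^ (M + C) * u" "u \<in> val_ring val"
        and v: "eval t \<rho> - eval t \<sigma> = \<pi> ^ (M + B) * v" "v \<in> val_ring val"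
        using st by (auto simp: vle_def)
      have "eval s \<rho> * eval t \<rho> - eval s \<sigma> * eval t \<sigma> =
          eval s \<rho> * (eval t \<rho> - eval t \<sigma>) + eval t \<rho> * (eval s \<rho> - eval s \<sigma>)
          - (eval s \<rho> - eval s \<sigma>) * (eval t \<rho> - eval t \<sigma>)"
        by (simp add: algebra_simps)
      also have "\<dots> = \<pi> ^ M * ((eval s \<rho> * \<pi> ^ B) * v + (eval t \<rho> * \<pi> ^ C) * u - (\<pi> ^ (C + M + B) * u) * v)"
        unfolding u v by (simp add: power_add algebra_simps)
      finally show ?thesis
        unfolding vle_def using BC u v
        by (intro bexI[of _ "(eval s \<rho> * \<pi> ^ B) * v + (eval t \<rho> * \<pi> ^ C) * u - (\<pi> ^ (C + M + B) * u) * v"])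
           (auto intro!: diff_V add_V mult_V power_V of_nat_V)
    qed
    show ?case using both[OF Mul.IH(1)[of "M + C"] Mul.IH(2)[of "M + B"]] * by simp blast
  next
    case (Minus t)
    have "vle (\<pi> ^ M) (- eval t \<rho> + eval t \<sigma>) \<longleftrightarrow> vle (\<pi> ^ M) (eval t \<rho> - eval t \<sigma>)" for \<sigma>
      using vle_minus_iff[of "\<pi> ^ M" "eval t \<rho> - eval t \<sigma>"] by simp
    then show ?case using Minus.IH[of M] by simp
  qed auto
  then show ?thesis by (simp add: t)
qed

lemma zero_closed:
  fixes e :: "'q \<Rightarrow> 'k::field"
  assumes "dterm e A s s'" "s \<rho> \<noteq> 0"
  shows "\<exists>K. \<forall>\<sigma>. (\<forall>i. vle (\<pi> ^ K) (\<rho> i - \<sigma> i)) \<longrightarrow> s \<sigma> \<noteq> 0"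
proof -
  obtain M where "\<not> vle (\<pi> ^ M) (s \<rho>)" using vle_all_zero assms(2) by blast
  then show ?thesis using dterm_continuous[OF assms(1), of \<rho> M] by (metis diff_zero)
qed

text \<open>Zero is an N-th power, so a non-power is nonzero. Near a nonzero value the class modulo
  N-th powers is constant.\<close>

lemma power_closed:
  fixes e :: "'q \<Rightarrow> 'k::field"
  assumes "dterm e A s s'" "\<not> pw N (s \<rho>)" "0 < N"
  shows "\<exists>K. \<forall>\<sigma>. (\<forall>i. vle (\<pi> ^ K) (\<rho> i - \<sigma> i)) \<longrightarrow> \<not> pw N (s \<sigma>)"
proof -
  have "s \<rho> \<noteq> 0" using assms(2,3) by (metis pw_def zero_power)
  then obtain M where "\<not> vle (\<pi> ^ M) (s \<rho>)" using vle_all_zero by blast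
  then have M: "vle (s \<rho>) (\<pi> ^ M)" using vle_total by blast
  obtain L where L: "\<And>x y. near L x y \<Longrightarrow> pw N x \<longleftrightarrow> pw N y" using near_pw[OF assms(3)] by blast
  have "\<not> pw N (s \<sigma>)" if "vle (\<pi> ^ (L + M)) (s \<rho> - s \<sigma>)" for \<sigma>
  proof -
    have "vle (\<pi> ^ L * s \<rho>) (\<pi> ^ L * \<pi> ^ M)" by (rule vle_mult_left[OF M])
    then have "vle (\<pi> ^ L * s \<rho>) (s \<sigma> - s \<rho>)"
      using vle_trans that vle_diff_commute unfolding power_add by blast
    then have "near L (s \<sigma>) (s \<rho>)" by (simp add: near_def)
    then show ?thesis using L assms(2) by blast
  qed
  then show ?thesis using dterm_continuous[OF assms(1), of \<rho> "L + M"] by blast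
qed

end

section \<open>Definable sets of balls\<close>

lemma decode_props:
  assumes "codes V n zs"
  shows "length (decode V n zs) = n" "set (decode V n zs) \<subseteq> balls V"
    "i < n \<Longrightarrow> decode V n zs ! i = ball V (zs ! (2 * i)) (zs ! (2 * i + 1))"
proof -
  have "ball V (zs ! (2 * i)) (zs ! (2 * i + 1)) \<in> balls V" if "i < n" for i
    using assms that unfolding codes_def balls_def by blast
  then show "set (decode V n zs) \<subseteq> balls V" by (auto simp: decode_def)
qed (auto simp: decode_def)

lemma ball_definable_iff:
  "ball_definable V n Y \<longleftrightarrow> Y \<subseteq> {bs. length bs = n \<and> set bs \<subseteq> balls V} \<and>
    (\<exists>P. dpair id UNIV P P \<and> (\<forall>zs. codes V n zs \<and> decode V n zs \<in> Y \<longleftrightarrow> length zs = 2 * n \<and> P (asg zs)))"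
proof -
  have "definable (2 * n) {zs. codes V n zs \<and> decode V n zs \<in> Y} \<longleftrightarrow>
    (\<exists>P. dpair id UNIV P P \<and> (\<forall>zs. codes V n zs \<and> decode V n zs \<in> Y \<longleftrightarrow> length zs = 2 * n \<and> P (asg zs)))"
  proof
    assume "definable (2 * n) {zs. codes V n zs \<and> decode V n zs \<in> Y}"
    then obtain \<phi> where
      phi: "{zs. codes V n zs \<and> decode V n zs \<in> Y} = {zs. length zs = 2 * n \<and> sat \<phi> (asg zs)}"
      unfolding definable_def by blast
    have "dpair id UNIV (sat \<phi>) (sat \<phi>)" unfolding dpair_def by (metis fm.map_id subset_UNIV)
    then show "\<exists>P. dpair id UNIV P P \<and>
        (\<forall>zs. codes V n zs \<and> decode V n zs \<in> Y \<longleftrightarrow> length zs = 2 * n \<and> P (asg zs))"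
      using phi by (auto simp: set_eq_iff)
  next
    assume "\<exists>P. dpair id UNIV P P \<and>
        (\<forall>zs. codes V n zs \<and> decode V n zs \<in> Y \<longleftrightarrow> length zs = 2 * n \<and> P (asg zs))"
    then obtain \<phi> where "\<forall>zs. codes V n zs \<and> decode V n zs \<in> Y \<longleftrightarrow> length zs = 2 * n \<and> sat \<phi> (asg zs)"
      unfolding dpair_def by blast
    then show "definable (2 * n) {zs. codes V n zs \<and> decode V n zs \<in> Y}"
      unfolding definable_def by (intro exI[of _ \<phi>]) auto
  qed
  then show ?thesis by (simp add: ball_definable_def)
qed

definition pcodes :: "nat \<Rightarrow> nat \<Rightarrow> (nat \<Rightarrow> 'k::field) \<Rightarrow> bool" where
  "pcodes p n \<rho> \<longleftrightarrow> (\<forall>i\<in>{..<n}. \<rho> (2 * i) \<in> vset p \<and> \<rho> (2 * i + 1) \<in> vset p \<and> \<rho> (2 * i + 1) \<noteq> 0)"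

lemma dp_pcodes: "dpair e A (pcodes p n) (pcodes p n)"
  unfolding pcodes_def[abs_def] by (intro dp_intros dp_vset finite_lessThan)

lemma codes_iff: "length zs = 2 * n \<Longrightarrow> codes (vset p) n zs \<longleftrightarrow> pcodes p n (asg zs)"
  by (auto simp: codes_def pcodes_def asg_def)

lemma ball_definable_neg:
  assumes "ball_definable (vset p) n Y"
  shows "ball_definable (vset p) n ({bs. length bs = n \<and> set bs \<subseteq> balls (vset p)} - Y)"
proof -
  obtain P where P: "dpair id UNIV P P"
    "\<And>zs. codes (vset p) n zs \<and> decode (vset p) n zs \<in> Y \<longleftrightarrow> length zs = 2 * n \<and> P (asg zs)"
    using assms unfolding ball_definable_iff by blast
  have "codes (vset p) n zs \<and> decode (vset p) n zs \<in> {bs. length bs = n \<and> set bs \<subseteq> balls (vset p)} - Y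
     \<longleftrightarrow> length zs = 2 * n \<and> pcodes p n (asg zs) \<and> \<not> P (asg zs)" for zs
  proof (cases "codes (vset p) n zs")
    case True
    then show ?thesis using P(2)[of zs] decode_props(1,2)[OF True] codes_iff[of zs n p] by (simp add: codes_def)
  next
    case False
    then show ?thesis using codes_iff[of zs n p] by blast
  qed
  then show ?thesis unfolding ball_definable_iff using dp_and[OF dp_pcodes dp_not[OF P(1)], of p n] by blast
qed

lemma ball_definable_conj:
  assumes "ball_definable (vset p) n Y" "ball_definable (vset p) n Z"
  shows "ball_definable (vset p) n (Y \<inter> Z)"
proof -
  obtain P where P: "dpair id UNIV P P"
    "\<And>zs. codes (vset p) n zs \<and> decode (vset p) n zs \<in> Y \<longleftrightarrow> length zs = 2 * n \<and> P (asg zs)"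
    using assms(1) unfolding ball_definable_iff by blast
  obtain Q where Q: "dpair id UNIV Q Q"
    "\<And>zs. codes (vset p) n zs \<and> decode (vset p) n zs \<in> Z \<longleftrightarrow> length zs = 2 * n \<and> Q (asg zs)"
    using assms(2) unfolding ball_definable_iff by blast
  have "codes (vset p) n zs \<and> decode (vset p) n zs \<in> Y \<inter> Z
     \<longleftrightarrow> length zs = 2 * n \<and> P (asg zs) \<and> Q (asg zs)" for zs
    using P(2)[of zs] Q(2)[of zs] by blast
  moreover have "Y \<inter> Z \<subseteq> {bs. length bs = n \<and> set bs \<subseteq> balls (vset p)}"
    using assms(1) unfolding ball_definable_def by blast
  ultimately show ?thesis unfolding ball_definable_iff using dp_and[OF P(1) Q(1)] by blast
qed

text \<open>The codes of the balls occupy the first 2 n variables, and the witnesses x the next n,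
  which are then bound as a block. Membership in a ball does not depend on the code chosen for
  it.\<close>

lemma ball_definable_meet:
  fixes c :: "'k::field"
  assumes P: "dpair id UNIV P P"
  shows "ball_definable (vset p) n {bs. length bs = n \<and> set bs \<subseteq> balls (vset p) \<and>
    (\<exists>x. (\<forall>i<n. c * x i \<in> bs ! i) \<and> P (\<lambda>i. if i < n then x i else 0))}"
    (is "ball_definable _ _ ?Y")
proof -
  define G where "G \<rho> \<longleftrightarrow> (\<forall>i\<in>{..<n}. quot_in p (c * \<rho> (2 * n + i) - \<rho> (2 * i)) (\<rho> (2 * i + 1))) \<and>
    P (\<lambda>i. if i < n then \<rho> (2 * n + i) else 0)" for \<rho> :: "nat \<Rightarrow> 'k"
  have d: "dterm id UNIV (\<lambda>\<rho>::nat \<Rightarrow> 'k. if i < n then \<rho> (2 * n + i) else 0) (\<lambda>\<rho>. if i < n then \<rho> (2 * n + i) else 0)" for i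
    by (cases "i < n") (auto intro: dt_var dt_zero)
  have c: "dterm id UNIV (\<lambda>\<rho>. c) (\<lambda>\<rho>. c)" using dt_const[of c UNIV id] by simp
  have G: "dpair id UNIV G G"
    unfolding G_def[abs_def] by (intro dp_and dp_ball dp_quot_in dt_diff dt_mult dt_var c dp_subst[OF P d] finite_lessThan)
  define H where "H \<rho> \<longleftrightarrow> pcodes p n \<rho> \<and> (\<exists>\<sigma>. G (\<lambda>i. if i \<in> {2*n..<3*n} then \<sigma> i else \<rho> i))" for \<rho> :: "nat \<Rightarrow> 'k"
  have H: "dpair id UNIV H H"
    unfolding H_def[abs_def] by (intro dp_and dp_pcodes dp_ex_block G finite_atLeastLessThan)
  have "codes (vset p) n zs \<and> decode (vset p) n zs \<in> ?Y \<longleftrightarrow> length zs = 2 * n \<and> H (asg zs)" for zs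
  proof (cases "codes (vset p) n zs")
    case False
    then show ?thesis using codes_iff[of zs n p] by (auto simp: H_def)
  next
    case True
    then have len: "length zs = 2 * n" by (simp add: codes_def)
    have m: "c * x \<in> decode (vset p) n zs ! i \<longleftrightarrow> quot_in p (c * x - asg zs (2 * i)) (asg zs (2 * i + 1))"
      if "i < n" for x i
    proof -
      have "zs ! (2 * i + 1) \<noteq> 0" using True that by (simp add: codes_def)
      moreover have "asg zs (2 * i) = zs ! (2 * i)" "asg zs (2 * i + 1) = zs ! (2 * i + 1)"
        using len that by (auto simp: asg_def)
      ultimately show ?thesis using decode_props(3)[OF True that] by (simp add: ball_def quot_in_iff)
    qed
    have "codes (vset p) n zs \<and> decode (vset p) n zs \<in> ?Y \<longleftrightarrow>
      (\<exists>x. (\<forall>i<n. quot_in p (c * x i - asg zs (2 * i)) (asg zs (2 * i + 1))) \<and> P (\<lambda>i. if i < n then x i else 0))"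
      using True decode_props(1,2)[OF True] m by auto
    also have "\<dots> \<longleftrightarrow> (\<exists>\<sigma>. G (\<lambda>i. if i \<in> {2*n..<3*n} then \<sigma> i else asg zs i))"
    proof
      assume "\<exists>x. (\<forall>i<n. quot_in p (c * x i - asg zs (2 * i)) (asg zs (2 * i + 1))) \<and> P (\<lambda>i. if i < n then x i else 0)"
      then obtain x where x: "\<forall>i<n. quot_in p (c * x i - asg zs (2 * i)) (asg zs (2 * i + 1))"
        "P (\<lambda>i. if i < n then x i else 0)" by blast
      have e: "(\<lambda>i. if i < n then (if 2 * n + i \<in> {2*n..<3*n} then x (2 * n + i - 2 * n) else asg zs (2 * n + i)) else 0)
        = (\<lambda>i. if i < n then x i else 0)" by auto
      have "G (\<lambda>i. if i \<in> {2*n..<3*n} then x (i - 2 * n) else asg zs i)"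
        unfolding G_def e using x by auto
      then show "\<exists>\<sigma>. G (\<lambda>i. if i \<in> {2*n..<3*n} then \<sigma> i else asg zs i)" by (intro exI[of _ "\<lambda>i. x (i - 2 * n)"])
    next
      assume "\<exists>\<sigma>. G (\<lambda>i. if i \<in> {2*n..<3*n} then \<sigma> i else asg zs i)"
      then obtain \<sigma> where s: "G (\<lambda>i. if i \<in> {2*n..<3*n} then \<sigma> i else asg zs i)" by blast
      have e: "(\<lambda>i. if i < n then (if 2 * n + i \<in> {2*n..<3*n} then \<sigma> (2 * n + i) else asg zs (2 * n + i)) else 0)
        = (\<lambda>i. if i < n then \<sigma> (2 * n + i) else 0)" by auto
      show "\<exists>x. (\<forall>i<n. quot_in p (c * x i - asg zs (2 * i)) (asg zs (2 * i + 1))) \<and> P (\<lambda>i. if i < n then x i else 0)"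
        using s[unfolded G_def e] by (intro exI[of _ "\<lambda>i. \<sigma> (2 * n + i)"]) auto
    qed
    also have "\<dots> \<longleftrightarrow> length zs = 2 * n \<and> H (asg zs)"
      using True len codes_iff[OF len, of p] by (simp add: H_def)
    finally show ?thesis .
  qed
  then show ?thesis unfolding ball_definable_iff using H by blast
qed

text \<open>Finitely many of the conditions are satisfied by a high power of p; saturation over the
  empty parameter set does the rest.\<close>

lemma infinitesimal_exists:
  fixes e :: "'q::field_char_0 \<Rightarrow> 'k::field"
  assumes sat: "saturated_2aleph0_plus TYPE('k)" and K: "pclosed (vset p :: 'k set) p"
  shows "\<exists>c::'k. c \<noteq> 0 \<and> (\<forall>M. quot_in p c (of_nat p ^ M))"
proof -
  interpret K: pclosed "vset p :: 'k set" p by (rule K)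
  define Q where "Q M \<rho> = quot_in p (\<rho> 0) (of_nat p ^ M)" for M and \<rho> :: "nat \<Rightarrow> 'k"
  define Z where "Z \<rho> \<longleftrightarrow> \<rho> 0 \<noteq> 0" for \<rho> :: "nat \<Rightarrow> 'k"
  have nz: "(of_nat p :: 'k) ^ M \<noteq> 0" for M using K.pi_nonzero by simp
  have "\<exists>\<rho>. \<forall>P\<in>insert Z (range Q). P \<rho>"
  proof (rule saturated_types[OF sat, where A = "{}" and n = 1])
    show "\<exists>f :: 'k \<Rightarrow> real. inj_on f {}" by simp
    fix P assume P: "P \<in> insert Z (range Q)"
    have "dpair id {} Z Z" unfolding Z_def[abs_def] by (intro dp_intros)
    moreover have "dpair id {} (Q M) (Q M)" for M
      unfolding Q_def[abs_def] by (intro dp_quot_in dp_intros)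
    ultimately show "dpair id {} P P" using P by auto
    show "P \<rho> = P \<sigma>" if "\<And>i. i < 1 \<Longrightarrow> \<rho> i = \<sigma> i" for \<rho> \<sigma>
      using P that[of 0] by (auto simp: Z_def Q_def)
  next
    fix \<Sigma>0 assume S0: "finite \<Sigma>0" "\<Sigma>0 \<subseteq> insert Z (range Q)"
    then have "finite (\<Sigma>0 - {Z})" "\<Sigma>0 - {Z} \<subseteq> Q ` UNIV" by auto
    then obtain I where I: "finite I" "\<Sigma>0 - {Z} = Q ` I" using finite_subset_image by metis
    define m where "m = Max (insert 0 I)"
    have "Q M (\<lambda>_. of_nat p ^ m)" if "M \<in> I" for M
    proof -
      have "M \<le> m" using I that by (simp add: m_def)
      then have "K.vle (of_nat p ^ M) (of_nat p ^ m)" by (rule K.vle_pi_power)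
      then show ?thesis using nz[of M] by (simp add: Q_def quot_in_iff K.vle_iff)
    qed
    moreover have "Z (\<lambda>_. of_nat p ^ m)" using nz by (simp add: Z_def)
    moreover have "P = Z \<or> P \<in> Q ` I" if "P \<in> \<Sigma>0" for P using I(2) that by blast
    ultimately have "\<forall>P\<in>\<Sigma>0. P (\<lambda>_. of_nat p ^ m)" by blast
    then show "\<exists>\<rho>. \<forall>P\<in>\<Sigma>0. P \<rho>" by blast
  qed
  then obtain \<rho> where "\<forall>P\<in>insert Z (range Q). P \<rho>" by (rule exE)
  then show ?thesis by (intro exI[of _ "\<rho> 0"]) (auto simp: Z_def Q_def)
qed

theorem theorem1p4:
  fixes p :: nat
    and val :: "'q::field_char_0 \<Rightarrow> int"
    and e :: "'q \<Rightarrow> 'k::field"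
  assumes "prime p"
    and "padic_field p val"
    and "elementary_embedding e"
    and "saturated_2aleph0_plus TYPE('k)"
  shows "balls_trace_define (ext_val_ring val e) TYPE('q)"
proof -
  interpret Q: padic p val using assms by unfold_locales
  note e = assms(3) and hom = elementary_hom[OF assms(3)]
  have VQ: "val_ring val = vset p" using Q.vset_eq by simp
  have K: "pclosed (vset p :: 'k set) p"
    by (rule pclosed_transfer[OF e]) (use Q.pclosed_axioms VQ in simp)
  interpret K: pclosed "vset p :: 'k set" p by (rule K)
  have VK: "ext_val_ring val e = vset p" by (rule ext_val_ring_eq[OF e VQ])
  obtain f :: "'q \<Rightarrow> real" where f: "inj f" using Q.inj_real by blast
  have "inj_on (f \<circ> inv e) (range e)"
    by (intro comp_inj_on inj_on_inv_into) (use f in \<open>auto intro: inj_on_subset\<close>)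
  then have small: "\<exists>f :: 'k \<Rightarrow> real. inj_on f (range e)" by blast
  have enat: "e (of_nat m) = of_nat m" for m by (induction m) (auto simp: hom)
  have epow: "e (x ^ m) = e x ^ m" for x m by (induction m) (auto simp: hom)
  have ediff: "e (x - y) = e x - e y" for x y using hom(3)[of x "- y"] hom(5)[of y] by simp
  obtain c :: 'k where c: "c \<noteq> 0" "\<And>M. quot_in p c (of_nat p ^ M)"
    using infinitesimal_exists[OF assms(4) K] by blast
  have Knz: "(of_nat p :: 'k) ^ M \<noteq> 0" for M using K.pi_nonzero by simp
  have cV: "K.vle (of_nat p ^ M) c" for M
    using c(2)[of M] Knz[of M] by (simp add: quot_in_iff K.vle_iff)
  have eV: "x \<in> vset p \<longleftrightarrow> e x \<in> vset p" for x
    using dpair_transfer[OF e dp_vset[OF dt_var[of e UNIV 0]], of "\<lambda>_. x"] by (simp add: comp_def)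
  have evle: "Q.vle (of_nat p ^ M) x \<longleftrightarrow> K.vle (of_nat p ^ M) (e x)" for M x
  proof -
    have "e x = of_nat p ^ M * e (x / of_nat p ^ M)"
      using hom(4)[of "of_nat p ^ M" "x / of_nat p ^ M"] Q.p_nz by (simp add: epow enat)
    then have "e x / of_nat p ^ M = e (x / of_nat p ^ M)" using Knz by simp
    moreover have "Q.vle (of_nat p ^ M) x \<longleftrightarrow> x / of_nat p ^ M \<in> val_ring val"
      using Q.p_nz by (intro Q.vle_iff) simp
    moreover have "K.vle (of_nat p ^ M) (e x) \<longleftrightarrow> e x / of_nat p ^ M \<in> vset p"
      using Knz by (intro K.vle_iff) simp
    ultimately show ?thesis using eV VQ by metis
  qed
  \<comment> \<open>Centers must lie in V, but a may have negative valuation. That valuation is a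
    finite integer, so multiplication by c repairs it.\<close>
  have ceV: "c * e a \<in> vset p" for a
  proof -
    obtain M where "a * of_nat p ^ M \<in> val_ring val" using Q.bounded_denom by blast
    then have ea: "e a * of_nat p ^ M \<in> vset p" using eV[of "a * of_nat p ^ M"] VQ by (simp add: hom epow enat)
    obtain y where y: "y \<in> vset p" "c = of_nat p ^ M * y" using cV[of M] by (auto simp: K.vle_def)
    have "(e a * of_nat p ^ M) * y \<in> vset p" by (rule K.mult_V[OF ea y(1)])
    moreover have "c * e a = (e a * of_nat p ^ M) * y" using y(2) by (simp add: mult_ac)
    ultimately show ?thesis by (simp only:)
  qed
  \<comment> \<open>After the scaling by c, the radius of c squared corresponds to the infinite
    distance \<open>v c\<close> between the unscaled points.\<close>
  define \<tau> where "\<tau> a = ball (vset p) (c * e a) (c\<^sup>2)" for a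
  have tau_iff: "c * x \<in> \<tau> a \<longleftrightarrow> K.vle c (x - e a)" for x a
  proof -
    have "c * x - c * e a = c\<^sup>2 * ((x - e a) / c)" using c(1) by (simp add: power2_eq_square field_simps)
    then show ?thesis using c(1) by (simp add: \<tau>_def ball_def K.vle_iff)
  qed
  have tau_balls: "\<tau> a \<in> balls (vset p)" for a
  proof -
    have "c \<in> vset p" using cV[of 0] by (simp add: K.vle_1_iff)
    then have "c\<^sup>2 \<in> vset p" by (rule K.power_V)
    then show ?thesis unfolding \<tau>_def balls_def using ceV c(1) by fastforce
  qed
  \<comment> \<open>Equal balls put a and b infinitely close in K, hence by \<open>evle\<close>
    closer than every integer in the p-adic field.\<close>
  have inj: "a = b" if "\<tau> a = \<tau> b" for a b
  proof -
    have "c * e b \<in> \<tau> a" using that tau_iff[of "e b" b] by simp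
    then have "K.vle c (e b - e a)" using tau_iff by blast
    then have "K.vle (of_nat p ^ M) (e (b - a))" for M using K.vle_trans[OF cV] by (simp add: ediff)
    then have "b - a = 0" using evle by (intro Q.vle_all_zero) blast
    then show ?thesis by simp
  qed
  have closed: "\<exists>Y. ball_definable (vset p) n Y \<and> (\<forall>xs. length xs = n \<longrightarrow> (map \<tau> xs \<in> Y \<longleftrightarrow> P (asg xs)))"
    if P: "dpair e UNIV P P'"
      and cl: "\<And>\<rho>. \<not> P \<rho> \<Longrightarrow> \<exists>M. \<forall>\<sigma>. (\<forall>i. Q.vle (of_nat p ^ M) (\<rho> i - \<sigma> i)) \<longrightarrow> \<not> P \<sigma>" for P P' n
  proof -
    define Y where "Y = {bs. length bs = n \<and> set bs \<subseteq> balls (vset p) \<and>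
      (\<exists>x. (\<forall>i<n. c * x i \<in> bs ! i) \<and> P' (\<lambda>i. if i < n then x i else 0))}"
    have dP': "dpair id UNIV P' P'" by (rule dpair_mono[OF dpair_image[OF P]]) simp
    have "map \<tau> xs \<in> Y \<longleftrightarrow> P (asg xs)" if len: "length xs = n" for xs
    proof
      assume "P (asg xs)"
      then have "P' (e \<circ> asg xs)" using dpair_transfer[OF e P] by blast
      moreover have "e \<circ> asg xs = (\<lambda>i. if i < n then e (xs ! i) else 0)"
        using len by (auto simp: asg_def fun_eq_iff hom)
      ultimately have "P' (\<lambda>i. if i < n then e (xs ! i) else 0)" by simp
      moreover have "\<forall>i<n. c * e (xs ! i) \<in> map \<tau> xs ! i" using len tau_iff by simp
      ultimately show "map \<tau> xs \<in> Y" unfolding Y_def using len tau_balls by auto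
    next
      assume "map \<tau> xs \<in> Y"
      then obtain x where x: "\<And>i. i < n \<Longrightarrow> c * x i \<in> \<tau> (xs ! i)" "P' (\<lambda>i. if i < n then x i else 0)"
        unfolding Y_def using len by auto
      show "P (asg xs)"
      proof (rule ccontr)
        assume "\<not> P (asg xs)"
        then obtain M where M: "\<And>\<sigma>. \<forall>i. Q.vle (of_nat p ^ M) (asg xs i - \<sigma> i) \<Longrightarrow> \<not> P \<sigma>" using cl by blast
        have d: "dterm e UNIV (\<lambda>\<rho>. if i < n then \<rho> i else 0) (\<lambda>\<rho>. if i < n then \<rho> i else 0)" for i
          by (cases "i < n") (auto intro: dt_var dt_zero)
        \<comment> \<open>This says that the ball of radius p^M around the given point misses P.
          Transferred to K, it excludes every infinitely close witness x.\<close>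
        have D: "dpair e UNIV
          (\<lambda>\<rho>. (\<forall>i\<in>{..<n}. quot_in p (asg xs i - \<rho> i) (of_nat p ^ M)) \<longrightarrow> \<not> P (\<lambda>i. if i < n then \<rho> i else 0))
          (\<lambda>\<rho>. (\<forall>i\<in>{..<n}. quot_in p (e (asg xs i) - \<rho> i) (of_nat p ^ M)) \<longrightarrow> \<not> P' (\<lambda>i. if i < n then \<rho> i else 0))"
          by (intro dp_imp dp_not dp_ball dp_quot_in dt_diff dt_power dt_of_nat dt_var dp_subst[OF P d]
              finite_lessThan dt_const UNIV_I)
        have "\<forall>\<rho>. (\<forall>i\<in>{..<n}. quot_in p (asg xs i - \<rho> i) (of_nat p ^ M)) \<longrightarrow> \<not> P (\<lambda>i. if i < n then \<rho> i else 0)"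
        proof (intro allI impI M)
          fix \<rho> i assume q: "\<forall>i\<in>{..<n}. quot_in p (asg xs i - \<rho> i) (of_nat p ^ M)"
          show "Q.vle (of_nat p ^ M) (asg xs i - (if i < n then \<rho> i else 0))"
          proof (cases "i < n")
            case True
            then have "(asg xs i - \<rho> i) / of_nat p ^ M \<in> val_ring val"
              using q Q.p_nz by (simp add: quot_in_iff VQ)
            then show ?thesis using True Q.p_nz Q.vle_iff[of "of_nat p ^ M"] by simp
          qed (use len in \<open>simp add: asg_def\<close>)
        qed
        note transfer_all[OF e D this, of x]
        moreover have "quot_in p (e (asg xs i) - x i) (of_nat p ^ M)" if "i < n" for i
        proof -
          have "K.vle (of_nat p ^ M) (x i - e (xs ! i))"
            using K.vle_trans[OF cV] x(1)[OF that] tau_iff by blast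
          then have "K.vle (of_nat p ^ M) (e (xs ! i) - x i)" using K.vle_diff_commute by blast
          then show ?thesis using that len Knz[of M] by (simp add: asg_def quot_in_iff K.vle_iff)
        qed
        ultimately show False using x(2) by simp
      qed
    qed
    then show ?thesis using ball_definable_meet[OF dP', of p n c] unfolding Y_def by blast
  qed
  have trace: "\<exists>Y. ball_definable (vset p) n Y \<and> (\<forall>xs. length xs = n \<longrightarrow> (map \<tau> xs \<in> Y \<longleftrightarrow> P (asg xs)))"
    if "qf e P P'" for P P' n
    using that
  proof (induction rule: qf.induct)
    case (zero s s')
    show ?case by (rule closed[OF dp_eq[OF zero dt_zero]]) (rule Q.zero_closed[OF zero])
  next
    case (power N s s')
    show ?case by (rule closed[OF dp_pw[OF power(2)]]) (rule Q.power_closed[OF power(2) _ power(1)])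
  next
    \<comment> \<open>The complement is formed among tuples of balls. This is how sets that are not
      closed become traceable.\<close>
    case (neg P P')
    then obtain Y where Y: "ball_definable (vset p) n Y" "\<And>xs. length xs = n \<Longrightarrow> map \<tau> xs \<in> Y \<longleftrightarrow> P (asg xs)"
      by blast
    show ?case
      by (intro exI conjI, rule ball_definable_neg[OF Y(1)]) (use Y(2) tau_balls in auto)
  next
    case (conj P P' Q Q')
    then obtain Y Z where Y: "ball_definable (vset p) n Y" "\<And>xs. length xs = n \<Longrightarrow> map \<tau> xs \<in> Y \<longleftrightarrow> P (asg xs)"
      "ball_definable (vset p) n Z" "\<And>xs. length xs = n \<Longrightarrow> map \<tau> xs \<in> Z \<longleftrightarrow> Q (asg xs)"
      by blast
    show ?case
      by (intro exI conjI, rule ball_definable_conj[OF Y(1,3)]) (use Y(2,4) in auto)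
  qed
  show ?thesis
    unfolding balls_trace_define_def VK
  proof (intro exI[of _ 1] exI[of _ "\<lambda>a. [\<tau> a]"] conjI allI impI)
    show "inj (\<lambda>a. [\<tau> a])" using inj by (auto simp: inj_def)
    show "length [\<tau> a] = 1" "set [\<tau> a] \<subseteq> balls (vset p)" for a using tau_balls by auto
    fix n and X :: "'q list set" assume "definable n X"
    then obtain \<phi> where X: "X = {xs. length xs = n \<and> sat \<phi> (asg xs)}" by (auto simp: definable_def)
    obtain Y where Y: "ball_definable (vset p) n Y"
      "\<And>xs. length xs = n \<Longrightarrow> map \<tau> xs \<in> Y \<longleftrightarrow> sat \<phi> (asg xs)"
      using trace[OF quantifier_elimination[OF e K assms(4) small], of n \<phi>] by blast
    have "concat (map (\<lambda>a. [\<tau> a]) xs) = map \<tau> xs" for xs by (induction xs) auto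
    then show "\<exists>Y. ball_definable (vset p) (1 * n) Y \<and>
        X = {xs. length xs = n \<and> concat (map (\<lambda>a. [\<tau> a]) xs) \<in> Y}"
      using Y by (intro exI[of _ Y]) (auto simp: X)
  qed
qed

end
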